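(* For every $\delta>0$ there is a constant $C_\delta$ (independent of $p$ and $N$) such that the following holds. Let $p$ be a prime and $\mathbb{F}_p$ the finite field of order $p$. Let $N$ be a positive integer with $N<p$, let $P$ be a set of points in $\mathbb{F}_p^2$ and $L$ a set of lines in $\mathbb{F}_p^2$ with $|P|,|L|\leq N$. Then $$I(P,L)\leq C_\delta\, N^{\frac{3}{2}-\frac{1}{806}+\delta}.$$ (Equivalently, $I(P,L)\ll N^{\frac{3}{2}-\frac{1}{806}+o(1)}$ as $N\to\infty$, with implied constants absolute.)
   Context: $I(P,L)$ denotes the number of incidences between $P$ and $L$, i.e. the number of pairs $(q,\ell)\in P\times L$ with the point $q$ lying on the line $\ell$. *)

theory Defs
  imports Complex_Main "HOL-Number_Theory.Residues"
begin

definition affine_plane :: "('a, 'm) ring_scheme \<Rightarrow> ('a \<times> 'a) set" where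
  "affine_plane F = carrier F \<times> carrier F"

definition affine_lines :: "('a, 'm) ring_scheme \<Rightarrow> ('a \<times> 'a) set set" where
  "affine_lines F =
     {{(x, y). (x, y) \<in> affine_plane F \<and> a \<otimes>\<^bsub>F\<^esub> x \<oplus>\<^bsub>F\<^esub> b \<otimes>\<^bsub>F\<^esub> y = c} | a b c.
        a \<in> carrier F \<and> b \<in> carrier F \<and> c \<in> carrier F \<and> (a, b) \<noteq> (\<zero>\<^bsub>F\<^esub>, \<zero>\<^bsub>F\<^esub>)}"

definition incidences :: "'a set \<Rightarrow> 'a set set \<Rightarrow> nat" where
  "incidences P L = card {(q, l). q \<in> P \<and> l \<in> L \<and> q \<in> l}"

end

theory Submission
  imports Defs "HOL-Library.Set_Algebras" "HOL-Real_Asymp.Real_Asymp"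
begin

text \<open>
  The proof is by contradiction. Suppose that there are almost \<open>N\<^sup>3\<^sup>/\<^sup>2\<close> incidences. After passing to
  points of roughly equal degree \<open>D\<close>, some line \<open>l0\<close> of \<open>L\<close> is such that its points are joined by lines
  of \<open>L\<close> to a large proportion of \<open>P\<close>. Send \<open>l0\<close> to infinity by a projective transformation: its points
  become many directions in each of which a large part of \<open>P\<close> has only about \<open>D\<close> projections. Two
  directions serve as coordinate axes and a third as the direction of the sum \<open>a + b\<close>; the
  Balog-Szemeredi-Gowers argument then gives a set \<open>A0\<close> with controlled difference set, and all
  further directions \<open>\<lambda>\<close> have the property that \<open>A0 - \<lambda> A0\<close> is small.

  Let \<open>V\<close> be the set of these \<open>\<lambda>\<close>. Either every field element is a quotient
  \<open>(l3 - l4) / (l5 - l6)\<close> of differences of \<open>V\<close>, or, because \<open>1\<close> generates the additive group of a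
  prime field, some quotient \<open>\<eta>\<close> is such that \<open>\<eta> + 1\<close> is not a quotient, so that all the sums
  \<open>s + (\<eta> + 1) t\<close> with \<open>s\<close>, \<open>t\<close> in \<open>V\<close> are distinct. In both cases there are about \<open>N\<close> dilation
  factors \<open>\<zeta>\<close> for which Pluennecke-type inequalities bound \<open>A0 + \<zeta> B\<close> with \<open>B\<close> a large set. But a
  second moment count shows that \<open>A0 + \<zeta> B\<close> has almost maximal size for some of them.
\<close>

section \<open>Sumsets\<close>

text \<open>The obstacle is a set of dilation factors that lies in a proper subfield: its ratios
  would never leave that subfield and no growth could be forced. A field of prime order has none,
  and this enters only through the fact that \<open>e\<close> generates the additive group. All
  losses are measured by \<kappa>, the factor by which the incidences fall short of
  \<open>N * sqrt N\<close>. Two derived parameters carry the loss: \<open>M\<close>, for the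
  density of the point set between its projections, is about \<kappa>^4, and 1/\<rho>, for the share
  of directions good for a point, is about \<kappa>^2. Tracking powers yields \<open>sqrt N\<close>
  at most a constant times \<kappa>^378, where each \<kappa> also carries a logarithm. Hence
  \<kappa> cannot be below N^(1/756) up to logarithms, and 1/806 < 1/756 leaves room for them. The
  condition that \<open>N\<close> does not exceed \<open>p\<close> enters once: if all field
  elements are ratios, the argument bounds the field size by a power of \<kappa> times
  \<open>sqrt N\<close>, which is absurd only for a field of at least \<open>N\<close>
  elements.\<close>

lemma card_mult_le_card_of_fibers:
  fixes k :: real
  assumes "finite S" and "\<And>q. q \<in> Q \<Longrightarrow> k \<le> real (card {s \<in> S. f s = q})"
  shows "real (card Q) * k \<le> real (card S)"
proof (cases "finite Q")
  case True
  have "real (card Q) * k = (\<Sum>q\<in>Q. k)" by simp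
  also have "\<dots> \<le> (\<Sum>q\<in>Q. real (card {s \<in> S. f s = q}))"
    using assms(2) by (intro sum_mono) auto
  also have "\<dots> = real (card (\<Union>q\<in>Q. {s \<in> S. f s = q}))"
    using True assms(1) by (subst card_UN_disjoint) auto
  also have "\<dots> \<le> real (card S)"
    using assms(1) by (intro of_nat_mono card_mono) auto
  finally show ?thesis .
next
  \<comment> \<open>\<open>card\<close> of an infinite set is 0, so the left side vanishes.\<close>
  case False
  then show ?thesis by simp
qed

text \<open>Ruzsa's triangle inequality: after fixing one representation t = x - w of every
  difference, the pair (x + z, z + w) determines t as the difference of its coordinates, and then
  z.\<close>

lemma ruzsa_triangle:
  fixes X Z W :: "'a::ab_group_add set"
  assumes "finite X" "finite Z" "finite W"
  shows "card (X + uminus ` W) * card Z \<le> card (X + Z) * card (Z + W)"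
proof -
  define h where "h t = (SOME xw. fst xw \<in> X \<and> snd xw \<in> W \<and> t = fst xw - snd xw)" for t
  have h: "fst (h t) \<in> X \<and> snd (h t) \<in> W \<and> t = fst (h t) - snd (h t)"
    if "t \<in> X + uminus ` W" for t
    unfolding h_def
  proof (rule someI_ex)
    from that obtain x w where "x \<in> X" "w \<in> W" "t = x + - w"
      by (auto elim!: set_plus_elim)
    then show "\<exists>xw. fst xw \<in> X \<and> snd xw \<in> W \<and> t = fst xw - snd xw"
      by (intro exI[of _ "(x, w)"]) auto
  qed
  define g where "g = (\<lambda>(t, z). (fst (h t) + z, z + snd (h t)))"
  have "inj_on g ((X + uminus ` W) \<times> Z)"
  proof (rule inj_onI, clarify)
    fix t z t' z'
    assume t: "t \<in> X + uminus ` W" "t' \<in> X + uminus ` W" and eq: "g (t, z) = g (t', z')"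
    then have e1: "fst (h t) + z = fst (h t') + z'" and e2: "z + snd (h t) = z' + snd (h t')"
      by (auto simp: g_def)
    have "fst (h t) - snd (h t) = (fst (h t) + z) - (z + snd (h t))" by simp
    also have "\<dots> = fst (h t') - snd (h t')" unfolding e1 e2 by simp
    finally have "t = t'" using h t by metis
    then show "t = t' \<and> z = z'" using e1 by simp
  qed
  moreover have "g ` ((X + uminus ` W) \<times> Z) \<subseteq> (X + Z) \<times> (Z + W)"
    using h by (auto simp: g_def intro!: set_plus_intro)
  moreover have "finite ((X + Z) \<times> (Z + W))"
    using assms by (simp add: finite_set_plus)
  ultimately have "card ((X + uminus ` W) \<times> Z) \<le> card ((X + Z) \<times> (Z + W))"
    by (metis card_image card_mono)
  then show ?thesis by (simp add: card_cartesian_product)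
qed

lemma card_translate:
  fixes A :: "'a::ab_group_add set"
  shows "card (A + {c}) = card A"
proof -
  have "A + {c} = (\<lambda>x. x + c) ` A" by (auto simp: set_plus_def)
  then show ?thesis by (simp add: card_image)
qed

text \<open>Petridis: a subset of \<^term>\<open>A\<close> of minimal relative growth does not grow faster when a
  further summand is added.\<close>

lemma petridis:
  fixes A X :: "'a::ab_group_add set"
  assumes "finite A" "A \<noteq> {}" "finite X"
  obtains Z where "Z \<subseteq> A" "Z \<noteq> {}" "card (Z + X) * card A \<le> card (A + X) * card Z"
    "\<And>C. finite C \<Longrightarrow> card (Z + X + C) * card Z \<le> card (Z + X) * card (Z + C)"
proof -
  define r where "r Z = real (card (Z + X)) / real (card Z)" for Z
  define F where "F = {Z. Z \<subseteq> A \<and> Z \<noteq> {}}"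
  have F: "finite F" "F \<noteq> {}" using assms by (auto simp: F_def)
  define Z where "Z = arg_min_on r F"
  have Z: "Z \<in> F" "\<And>Z'. Z' \<in> F \<Longrightarrow> r Z \<le> r Z'"
    using arg_min_if_finite(1)[OF F, of r] arg_min_least[OF F, of _ r] by (auto simp: Z_def)
  have ZA: "Z \<subseteq> A" "Z \<noteq> {}" using Z(1) by (auto simp: F_def)
  have finZ: "finite Z" using ZA assms finite_subset by blast
  have cZ: "card Z > 0" using ZA finZ by (simp add: card_gt_0_iff)
  define k where "k = r Z"
  have k: "real (card (Z + X)) = k * real (card Z)" using cZ by (simp add: k_def r_def)
  have min: "k * real (card Z') \<le> real (card (Z' + X))" if "Z' \<subseteq> Z" for Z'
  proof (cases "Z' = {}")
    case False
    then have "k \<le> r Z'" using Z(2)[of Z'] that ZA by (auto simp: F_def k_def)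
    moreover have "card Z' > 0" using False that finZ finite_subset by (auto simp: card_gt_0_iff)
    ultimately show ?thesis by (simp add: r_def field_simps)
  qed (simp add: set_plus_def)
  have k0: "k \<ge> 0" by (simp add: k_def r_def)
  have main: "real (card (Z + X + C)) \<le> k * real (card (Z + C))" if "finite C" for C
    using that
  proof (induction C rule: finite_induct)
    case empty
    then show ?case by (simp add: set_plus_def)
  next
    case (insert c C)
    \<comment> \<open>Induction adds one element \<open>c\<close>. For z in \<open>Z0\<close> the
      translate of \<open>X\<close> by z + c brings nothing new, so at most |Z + X| - |Z0 + X| sums
      are new, and minimality of the ratio gives |Z0 + X| >= k |Z0|. \<open>Z1\<close> plays the
      same role for \<open>Z + C\<close>, where the count must be exact; \<open>Z1\<close> being
      inside \<open>Z0\<close> makes the two counts compatible.\<close>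
    define Z0 where "Z0 = {z \<in> Z. {z} + X + {c} \<subseteq> Z + X + C}"
    define Z1 where "Z1 = {z \<in> Z. z + c \<in> Z + C}"
    have Z10: "Z1 \<subseteq> Z0"
    proof
      fix z assume z: "z \<in> Z1"
      then obtain y d where y: "y \<in> Z" "d \<in> C" "z + c = y + d"
        by (auto simp: Z1_def elim!: set_plus_elim)
      have "z + x + c \<in> Z + X + C" if "x \<in> X" for x
      proof -
        have "z + x + c = y + x + d" using y(3) by (simp add: algebra_simps)
        moreover have "y + x + d \<in> Z + X + C" using y that by (auto intro!: set_plus_intro)
        ultimately show ?thesis by metis
      qed
      then show "z \<in> Z0" using z by (auto simp: Z0_def Z1_def elim!: set_plus_elim)
    qed
    have fins: "finite (Z + X + C)" "finite (Z + X + {c})" "finite (Z0 + X + {c})" "finite (Z + C)"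
      "finite (Z + {c})" "finite Z0" "finite Z1" "finite (Z0 + X)"
      using finZ assms insert by (auto simp: Z0_def Z1_def intro!: finite_set_plus)
    have Z0s: "Z0 \<subseteq> Z" by (auto simp: Z0_def)
    have sub: "Z0 + X + {c} \<subseteq> Z + X + {c}"
      using Z0s by (intro set_plus_mono2) auto
    have "Z + X + insert c C \<subseteq> (Z + X + C) \<union> ((Z + X + {c}) - (Z0 + X + {c}))"
    proof
      fix t assume "t \<in> Z + X + insert c C"
      then obtain z x d where t: "t = z + x + d" "z \<in> Z" "x \<in> X" "d \<in> insert c C"
        by (auto elim!: set_plus_elim)
      show "t \<in> (Z + X + C) \<union> ((Z + X + {c}) - (Z0 + X + {c}))"
      proof (cases "t \<in> Z + X + C")
        case False
        then have "d = c" using t by (auto intro!: set_plus_intro)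
        moreover have "t \<notin> Z0 + X + {c}"
        proof
          assume "t \<in> Z0 + X + {c}"
          then obtain z' x' where "z' \<in> Z0" "x' \<in> X" "t = z' + x' + c"
            by (auto elim!: set_plus_elim)
          then have "t \<in> {z'} + X + {c}" "z' \<in> Z0" by (auto intro!: set_plus_intro)
          then show False using False by (auto simp: Z0_def)
        qed
        ultimately show ?thesis using t by (auto intro!: set_plus_intro)
      qed simp
    qed
    then have "card (Z + X + insert c C) \<le> card ((Z + X + C) \<union> ((Z + X + {c}) - (Z0 + X + {c})))"
      using fins by (intro card_mono) auto
    also have "\<dots> \<le> card (Z + X + C) + card ((Z + X + {c}) - (Z0 + X + {c}))"
      by (rule card_Un_le)
    also have "card ((Z + X + {c}) - (Z0 + X + {c})) = card (Z + X) - card (Z0 + X)"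
      using sub fins by (subst card_Diff_subset) (auto simp: card_translate)
    finally have "real (card (Z + X + insert c C)) \<le> real (card (Z + X + C)) + real (card (Z + X) - card (Z0 + X))"
      by linarith
    also have "card (Z0 + X) \<le> card (Z + X)"
      using Z0s finZ assms by (intro card_mono finite_set_plus set_plus_mono2) auto
    then have "real (card (Z + X) - card (Z0 + X)) = real (card (Z + X)) - real (card (Z0 + X))"
      by (rule of_nat_diff)
    finally have 1: "real (card (Z + X + insert c C))
        \<le> k * real (card (Z + C)) + k * real (card Z) - k * real (card Z0)"
      using insert.IH k min[OF Z0s] by linarith
    have "Z + insert c C = (Z + C) \<union> ((Z + {c}) - (Z1 + {c}))"
    proof (intro equalityI subsetI)
      fix t assume "t \<in> Z + insert c C"
      then obtain z d where t: "t = z + d" "z \<in> Z" "d \<in> insert c C"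
        by (auto elim!: set_plus_elim)
      show "t \<in> (Z + C) \<union> ((Z + {c}) - (Z1 + {c}))"
      proof (cases "t \<in> Z + C")
        case False
        then have "d = c" using t by (auto intro!: set_plus_intro)
        moreover have "t \<notin> Z1 + {c}"
          using False by (auto simp: Z1_def elim!: set_plus_elim)
        ultimately show ?thesis using t by (auto intro!: set_plus_intro)
      qed simp
    next
      fix t assume "t \<in> (Z + C) \<union> ((Z + {c}) - (Z1 + {c}))"
      then show "t \<in> Z + insert c C" by (auto elim!: set_plus_elim intro!: set_plus_intro)
    qed
    moreover have "(Z + C) \<inter> ((Z + {c}) - (Z1 + {c})) = {}"
    proof (intro equals0I, elim IntE DiffE)
      fix t assume t: "t \<in> Z + C" "t \<in> Z + {c}" "t \<notin> Z1 + {c}"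
      then obtain z where z: "z \<in> Z" "t = z + c" by (auto elim!: set_plus_elim)
      then have "z \<in> Z1" using t(1) by (simp add: Z1_def)
      then show False using t(3) z by (auto intro!: set_plus_intro)
    qed
    ultimately have "card (Z + insert c C) = card (Z + C) + card ((Z + {c}) - (Z1 + {c}))"
      using fins by (metis card_Un_disjoint finite_Diff)
    also have "card ((Z + {c}) - (Z1 + {c})) = card (Z + {c}) - card (Z1 + {c})"
      using fins by (intro card_Diff_subset finite_set_plus set_plus_mono2) (auto simp: Z1_def)
    also have "\<dots> = card Z - card Z1" by (simp add: card_translate)
    finally have "real (card (Z + insert c C)) \<ge> real (card (Z + C)) + real (card Z) - real (card Z1)"
      by linarith
    moreover have "card Z1 \<le> card Z0" using Z10 fins by (intro card_mono) auto
    ultimately have "real (card (Z + insert c C)) \<ge> real (card (Z + C)) + real (card Z) - real (card Z0)"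
      by linarith
    then have "k * (real (card (Z + C)) + real (card Z) - real (card Z0)) \<le> k * real (card (Z + insert c C))"
      using k0 by (rule mult_left_mono)
    then show ?case using 1 by (simp add: algebra_simps)
  qed
  show thesis
  proof
    show "Z \<subseteq> A" "Z \<noteq> {}" by (fact ZA)+
    have "k \<le> r A" using Z(2)[of A] assms by (auto simp: F_def k_def)
    then have "k * real (card A) \<le> real (card (A + X))"
      using assms by (simp add: r_def field_simps card_gt_0_iff)
    then have "k * real (card A) * real (card Z) \<le> real (card (A + X)) * real (card Z)"
      by (rule mult_right_mono) simp
    then have "real (card (Z + X)) * real (card A) \<le> real (card (A + X)) * real (card Z)"
      using k by (simp add: algebra_simps)
    then show "card (Z + X) * card A \<le> card (A + X) * card Z"
      by (metis of_nat_le_iff of_nat_mult)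
    fix C :: "'a set" assume "finite C"
    from main[OF this] have "real (card (Z + X + C)) * real (card Z) \<le> k * real (card (Z + C)) * real (card Z)"
      by (rule mult_right_mono) simp
    also have "\<dots> = real (card (Z + X)) * real (card (Z + C))" using k by (simp add: algebra_simps)
    finally show "card (Z + X + C) * card Z \<le> card (Z + X) * card (Z + C)"
      by (metis of_nat_le_iff of_nat_mult)
  qed
qed

lemma card_uminus_image: "card (uminus ` A) = card A" for A :: "'a::ab_group_add set"
  by (intro card_image inj_onI) simp

lemma uminus_image_plus: "uminus ` (A + B) = uminus ` A + uminus ` B"
  for A B :: "'a::ab_group_add set"
proof (intro equalityI subsetI)
  fix t assume "t \<in> uminus ` A + uminus ` B"
  then obtain a b where "a \<in> A" "b \<in> B" "t = - a + - b" by (auto elim!: set_plus_elim)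
  then have "t = - (a + b)" "a + b \<in> A + B" by (auto intro!: set_plus_intro)
  then show "t \<in> uminus ` (A + B)" by blast
next
  fix t assume "t \<in> uminus ` (A + B)"
  then obtain a b where "a \<in> A" "b \<in> B" "t = - a + - b" by (auto elim!: set_plus_elim)
  then show "t \<in> uminus ` A + uminus ` B" using set_plus_intro[of "- a" "uminus ` A" "- b"] by blast
qed

text \<open>Each copy of \<open>X\<close> added to the minimal subset \<open>Z\<close> costs a
  factor \<kappa>. Three copies are added twice, and the triangle inequality with \<open>Z\<close>
  in the middle joins the two estimates into one with three copies of either sign. Six is the number
  of dilates that the later identities consume.\<close>

lemma petridis_sextuple:
  fixes A X :: "'a::ab_group_add set" and \<kappa> :: real
  assumes "finite A" "A \<noteq> {}" "finite X" and \<kappa>: "real (card (A + X)) \<le> \<kappa> * real (card A)"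
  shows "real (card (A + (X + X + X) + uminus ` (X + X + X)))
           \<le> \<kappa> ^ 6 * real (card (A + uminus ` A))"
proof -
  obtain Z where Z: "Z \<subseteq> A" "Z \<noteq> {}" "card (Z + X) * card A \<le> card (A + X) * card Z"
    and pet: "\<And>C. finite C \<Longrightarrow> card (Z + X + C) * card Z \<le> card (Z + X) * card (Z + C)"
    using petridis[OF assms(1-3)] by metis
  have finZ: "finite Z" using Z assms finite_subset by blast
  have cZ: "card Z > 0" using Z finZ by (simp add: card_gt_0_iff)
  have cA: "card A > 0" using assms by (simp add: card_gt_0_iff)
  have k0: "\<kappa> \<ge> 0"
  proof (rule ccontr)
    assume "\<not> \<kappa> \<ge> 0"
    then have "\<kappa> * real (card A) < 0" using cA by (simp add: mult_neg_pos)
    then show False using \<kappa> by linarith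
  qed
  have "real (card (Z + X)) * real (card A) \<le> real (card (A + X)) * real (card Z)"
    using Z(3) by (metis of_nat_le_iff of_nat_mult)
  also have "\<dots> \<le> (\<kappa> * real (card A)) * real (card Z)"
    using \<kappa> by (rule mult_right_mono) simp
  finally have ZX: "real (card (Z + X)) \<le> \<kappa> * real (card Z)"
    using cA by (simp add: algebra_simps)
  have step: "real (card (Z + X + C)) \<le> \<kappa> * real (card (Z + C))" if "finite C" for C
  proof -
    have "real (card (Z + X + C)) * real (card Z) \<le> real (card (Z + X)) * real (card (Z + C))"
      using pet[OF that] by (metis of_nat_le_iff of_nat_mult)
    also have "\<dots> \<le> (\<kappa> * real (card Z)) * real (card (Z + C))"
      using ZX by (rule mult_right_mono) simp
    finally show ?thesis using cZ by (simp add: algebra_simps)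
  qed
  have step3: "real (card (Z + (X + X + X) + C)) \<le> \<kappa> ^ 3 * real (card (Z + C))" if "finite C" for C
  proof -
    have "real (card (Z + (X + X + X) + C)) = real (card (Z + X + (X + X + C)))"
      by (simp add: ac_simps)
    also have "\<dots> \<le> \<kappa> * real (card (Z + (X + X + C)))"
      using that assms by (intro step finite_set_plus)
    also have "Z + (X + X + C) = Z + X + (X + C)" by (simp add: ac_simps)
    also have "\<kappa> * real (card \<dots>) \<le> \<kappa> * (\<kappa> * real (card (Z + (X + C))))"
      using that assms k0 by (intro mult_left_mono step finite_set_plus)
    also have "Z + (X + C) = Z + X + C" by (simp add: ac_simps)
    also have "\<kappa> * (\<kappa> * real (card \<dots>)) \<le> \<kappa> * (\<kappa> * (\<kappa> * real (card (Z + C))))"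
      using that assms k0 by (intro mult_left_mono step)
    finally show ?thesis by (simp add: power3_eq_cube algebra_simps)
  qed
  define X3 where "X3 = X + X + X"
  have fX3: "finite X3" using assms by (auto simp: X3_def intro!: finite_set_plus)
  have "real (card ((X3 + uminus ` A) + uminus ` X3)) * real (card Z)
      \<le> real (card ((X3 + uminus ` A) + Z)) * real (card (Z + X3))"
    using ruzsa_triangle[of "X3 + uminus ` A" Z X3] fX3 assms finZ
    by (metis finite_imageI finite_set_plus of_nat_le_iff of_nat_mult)
  also have "\<dots> \<le> (\<kappa> ^ 3 * real (card (A + uminus ` A))) * (\<kappa> ^ 3 * real (card Z))"
  proof (rule mult_mono)
    have "real (card ((X3 + uminus ` A) + Z)) = real (card (Z + X3 + uminus ` A))"
      by (simp add: ac_simps)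
    also have "\<dots> \<le> \<kappa> ^ 3 * real (card (Z + uminus ` A))"
      unfolding X3_def using assms by (intro step3) auto
    also have "card (Z + uminus ` A) \<le> card (A + uminus ` A)"
      using assms Z by (intro card_mono finite_set_plus set_plus_mono2) auto
    then have "\<kappa> ^ 3 * real (card (Z + uminus ` A)) \<le> \<kappa> ^ 3 * real (card (A + uminus ` A))"
      using k0 by (intro mult_left_mono) auto
    finally show "real (card ((X3 + uminus ` A) + Z)) \<le> \<kappa> ^ 3 * real (card (A + uminus ` A))" .
    show "real (card (Z + X3)) \<le> \<kappa> ^ 3 * real (card Z)"
      using step3[of "{0}"] unfolding X3_def by simp
  qed (use k0 in auto)
  finally have "real (card ((X3 + uminus ` A) + uminus ` X3)) * real (card Z)
      \<le> (\<kappa> ^ 6 * real (card (A + uminus ` A))) * real (card Z)"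
    by (simp add: algebra_simps power_add[symmetric])
  then have "real (card ((X3 + uminus ` A) + uminus ` X3)) \<le> \<kappa> ^ 6 * real (card (A + uminus ` A))"
    using cZ by simp
  \<comment> \<open>The triangle inequality bounded X3 - A - X3; negation turns it into the set with
    a positive \<open>A\<close>.\<close>
  moreover have "uminus ` ((X3 + uminus ` A) + uminus ` X3) = A + X3 + uminus ` X3"
    by (simp add: uminus_image_plus image_image ac_simps)
  ultimately show ?thesis using card_uminus_image[of "(X3 + uminus ` A) + uminus ` X3"]
    by (simp add: X3_def)
qed

section \<open>The Balog-Szemeredi-Gowers argument\<close>

text \<open>Cauchy-Schwarz against the constant 1, read off from the nonnegative variance about the
  mean \<open>t\<close>.\<close>

lemma square_of_sum_le:
  fixes f :: "'b \<Rightarrow> real"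
  assumes "finite I" "real (card I) \<le> m"
  shows "(\<Sum>i\<in>I. f i)\<^sup>2 \<le> m * (\<Sum>i\<in>I. (f i)\<^sup>2)"
proof (cases "I = {}")
  case False
  then have c: "real (card I) > 0" using assms by (simp add: card_gt_0_iff)
  define t where "t = (\<Sum>i\<in>I. f i) / real (card I)"
  have t: "(\<Sum>i\<in>I. f i) = real (card I) * t" using c by (simp add: t_def)
  have "0 \<le> (\<Sum>i\<in>I. (f i - t)\<^sup>2)" by (intro sum_nonneg) auto
  also have "\<dots> = (\<Sum>i\<in>I. (f i)\<^sup>2) - 2 * t * (\<Sum>i\<in>I. f i) + real (card I) * t\<^sup>2"
    by (simp add: power2_diff sum.distrib sum_subtractf sum_distrib_left sum_distrib_right algebra_simps)
  finally have "real (card I) * t\<^sup>2 \<le> (\<Sum>i\<in>I. (f i)\<^sup>2)"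
    unfolding t by (simp add: power2_eq_square algebra_simps)
  then have "real (card I) * (real (card I) * t\<^sup>2) \<le> m * (\<Sum>i\<in>I. (f i)\<^sup>2)"
    using assms c by (intro mult_mono) (auto intro!: sum_nonneg)
  then show ?thesis unfolding t by (simp add: power2_eq_square algebra_simps)
qed simp

lemma sum_card_swap:
  assumes "finite A" "finite B"
  shows "(\<Sum>a\<in>A. card {b \<in> B. R a b}) = (\<Sum>b\<in>B. card {a \<in> A. R a b})"
proof -
  have "(\<Sum>a\<in>A. card {b \<in> B. R a b}) = (\<Sum>a\<in>A. \<Sum>b\<in>B. if R a b then 1 else 0)"
    using assms by (simp add: sum.If_cases Int_def)
  also have "\<dots> = (\<Sum>b\<in>B. \<Sum>a\<in>A. if R a b then 1 else 0)" by (rule sum.swap)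
  also have "\<dots> = (\<Sum>b\<in>B. card {a \<in> A. R a b})"
    using assms by (simp add: sum.If_cases Int_def)
  finally show ?thesis .
qed

lemma card_eq_sum_fibers:
  assumes "finite A" "finite B" "G \<subseteq> A \<times> B"
  shows "card G = (\<Sum>a\<in>A. card {b \<in> B. (a, b) \<in> G})"
proof -
  have "G = Sigma A (\<lambda>a. {b \<in> B. (a, b) \<in> G})" using assms by auto
  then have "card G = card (Sigma A (\<lambda>a. {b \<in> B. (a, b) \<in> G}))" by simp
  also have "\<dots> = (\<Sum>a\<in>A. card {b \<in> B. (a, b) \<in> G})" using assms by (intro card_SigmaI) auto
  finally show ?thesis .
qed

text \<open>Dependent random choice: the neighbourhood of a random vertex \<^term>\<open>b\<close> contains
  few pairs with a small common neighbourhood.\<close>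

lemma dependent_random_choice:
  fixes A :: "'a set" and B :: "'b set" and m M \<epsilon> :: real
  assumes fin: "finite A" "finite B" and G: "G \<subseteq> A \<times> B"
    and card: "real (card A) \<le> m" "real (card B) \<le> m" "m\<^sup>2 \<le> M * real (card G)"
    and pos: "0 < m" "0 < M" "0 < \<epsilon>"
  obtains A1 where "A1 \<subseteq> A" "m \<le> 4 * M * real (card A1)"
    "\<And>a. a \<in> A1 \<Longrightarrow> m \<le> 2 * M * real (card {b \<in> B. (a, b) \<in> G})"
    "real (card {(a, a') \<in> A1 \<times> A1. real (card {b \<in> B. (a, b) \<in> G \<and> (a', b) \<in> G}) < \<epsilon> / (8 * M\<^sup>2) * m})
       \<le> \<epsilon> * (real (card A1))\<^sup>2"
proof -
  define deg where "deg a = card {b \<in> B. (a, b) \<in> G}" for a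
  define codeg where "codeg a a' = card {b \<in> B. (a, b) \<in> G \<and> (a', b) \<in> G}" for a a'
  define \<tau> where "\<tau> = \<epsilon> / (8 * M\<^sup>2)"
  \<comment> \<open>Vertices of degree below m / (2M) carry at most half of the m^2 / M edges that
    are guaranteed, so \<open>At\<close> keeps the other half.\<close>
  define At where "At = {a \<in> A. m \<le> 2 * M * real (deg a)}"
  define N where "N b = {a \<in> At. (a, b) \<in> G}" for b
  define bad where "bad b = card {(a, a') \<in> N b \<times> N b. real (codeg a a') < \<tau> * m}" for b
  have finAt: "finite At" "At \<subseteq> A" using fin by (auto simp: At_def)
  have finN: "finite (N b)" for b using finAt by (simp add: N_def)
  have "real (card G) = (\<Sum>a\<in>A. real (deg a))"
    using card_eq_sum_fibers[OF fin G] by (simp add: deg_def)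
  also have "\<dots> = (\<Sum>a\<in>At. real (deg a)) + (\<Sum>a\<in>A - At. real (deg a))"
    using fin finAt by (metis add.commute sum.subset_diff)
  also have "(\<Sum>a\<in>A - At. real (deg a)) \<le> (\<Sum>a\<in>A - At. m / (2 * M))"
    using pos by (intro sum_mono) (auto simp: At_def field_simps)
  also have "\<dots> \<le> m * (m / (2 * M))"
  proof -
    have "card (A - At) \<le> card A" using fin by (intro card_mono) auto
    then show ?thesis using card pos by (simp add: divide_right_mono mult_right_mono)
  qed
  finally have "m\<^sup>2 / M \<le> (\<Sum>a\<in>At. real (deg a)) + m * (m / (2 * M))"
    using card pos by (simp add: field_simps)
  then have sumdeg: "m\<^sup>2 / (2 * M) \<le> (\<Sum>a\<in>At. real (deg a))"
    using pos by (simp add: field_simps power2_eq_square)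
  have "(\<Sum>a\<in>At. deg a) = (\<Sum>b\<in>B. card (N b))"
    unfolding deg_def N_def using finAt fin by (intro sum_card_swap)
  then have sumN: "m\<^sup>2 / (2 * M) \<le> (\<Sum>b\<in>B. real (card (N b)))"
    using sumdeg by (simp flip: of_nat_sum)
  have "(m\<^sup>2 / (2 * M))\<^sup>2 \<le> (\<Sum>b\<in>B. real (card (N b)))\<^sup>2"
    using sumN pos by (intro power_mono) auto
  also have "\<dots> \<le> m * (\<Sum>b\<in>B. (real (card (N b)))\<^sup>2)"
    using fin card by (intro square_of_sum_le)
  finally have "m * (m ^ 3 / (4 * M\<^sup>2)) \<le> m * (\<Sum>b\<in>B. (real (card (N b)))\<^sup>2)"
    by (simp add: power_divide power_mult_distrib power2_eq_square power3_eq_cube algebra_simps)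
  then have sumN2: "m ^ 3 / (4 * M\<^sup>2) \<le> (\<Sum>b\<in>B. (real (card (N b)))\<^sup>2)"
    using pos mult_le_cancel_left_pos by blast
  define Bad where "Bad = {x \<in> At \<times> At. real (codeg (fst x) (snd x)) < \<tau> * m}"
  have finBad: "finite Bad" using finAt by (simp add: Bad_def)
  have bad_eq: "bad b = card {x \<in> Bad. (fst x, b) \<in> G \<and> (snd x, b) \<in> G}" for b
    unfolding bad_def by (rule arg_cong[of _ _ card]) (auto simp: Bad_def N_def)
  have "(\<Sum>b\<in>B. bad b) = (\<Sum>x\<in>Bad. codeg (fst x) (snd x))"
    unfolding bad_eq codeg_def using sum_card_swap[OF fin(2) finBad] .
  then have "(\<Sum>b\<in>B. real (bad b)) = (\<Sum>x\<in>Bad. real (codeg (fst x) (snd x)))"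
    by (simp flip: of_nat_sum)
  also have "\<dots> \<le> (\<Sum>x\<in>Bad. \<tau> * m)" by (intro sum_mono) (auto simp: Bad_def)
  also have "\<dots> = real (card Bad) * (\<tau> * m)" by simp
  also have "\<dots> \<le> (m * m) * (\<tau> * m)"
  proof (rule mult_right_mono)
    have "card Bad \<le> card (At \<times> At)" using finAt by (intro card_mono) (auto simp: Bad_def)
    also have "\<dots> \<le> card A * card A"
      using finAt fin by (simp add: card_cartesian_product card_mono mult_mono)
    finally have "real (card Bad) \<le> real (card A) * real (card A)" by (metis of_nat_le_iff of_nat_mult)
    also have "\<dots> \<le> m * m" using card pos by (intro mult_mono) auto
    finally show "real (card Bad) \<le> m * m" .
    show "0 \<le> \<tau> * m" using pos by (simp add: \<tau>_def)
  qed
  finally have sumbad: "(\<Sum>b\<in>B. real (bad b) / \<epsilon>) \<le> m ^ 3 / (8 * M\<^sup>2)"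
    using pos by (simp add: sum_divide_distrib[symmetric] \<tau>_def field_simps power3_eq_cube)
  \<comment> \<open>First moment method: summed over \<open>b\<close>, the squares contribute at
    least m^3 / (4 M^2) and the penalty at most half of that. A single \<open>b\<close> above the
    average has both a large neighbourhood and few bad pairs in it.\<close>
  have "\<exists>b\<in>B. m\<^sup>2 / (8 * M\<^sup>2) \<le> (real (card (N b)))\<^sup>2 - real (bad b) / \<epsilon>"
  proof (rule ccontr)
    assume "\<not> ?thesis"
    then have lt: "(real (card (N b)))\<^sup>2 - real (bad b) / \<epsilon> < m\<^sup>2 / (8 * M\<^sup>2)" if "b \<in> B" for b
      using that by force
    have "m\<^sup>2 / (2 * M) > 0" using pos by simp
    then have "B \<noteq> {}" using sumN by auto
    then have "(\<Sum>b\<in>B. (real (card (N b)))\<^sup>2 - real (bad b) / \<epsilon>) < (\<Sum>b\<in>B. m\<^sup>2 / (8 * M\<^sup>2))"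
      using fin lt by (intro sum_strict_mono)
    also have "\<dots> = real (card B) * (m\<^sup>2 / (8 * M\<^sup>2))" by simp
    also have "\<dots> \<le> m * (m\<^sup>2 / (8 * M\<^sup>2))" using card by (intro mult_right_mono) auto
    also have "\<dots> = m ^ 3 / (8 * M\<^sup>2)" by (simp add: power2_eq_square power3_eq_cube)
    finally have "(\<Sum>b\<in>B. (real (card (N b)))\<^sup>2) < m ^ 3 / (8 * M\<^sup>2) + m ^ 3 / (8 * M\<^sup>2)"
      using sumbad by (simp add: sum_subtractf)
    also have "\<dots> = m ^ 3 / (4 * M\<^sup>2)" by simp
    finally show False using sumN2 by simp
  qed
  then obtain b where b: "m\<^sup>2 / (8 * M\<^sup>2) \<le> (real (card (N b)))\<^sup>2 - real (bad b) / \<epsilon>" by blast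
  have bad0: "real (bad b) / \<epsilon> \<ge> 0" using pos by simp
  have m0: "m\<^sup>2 / (8 * M\<^sup>2) \<ge> 0" by simp
  have "(m / (4 * M))\<^sup>2 \<le> m\<^sup>2 / (8 * M\<^sup>2)"
    using pos by (simp add: power_divide power_mult_distrib frac_le)
  also have "\<dots> \<le> (real (card (N b)))\<^sup>2" using b bad0 by linarith
  finally have "m / (4 * M) \<le> real (card (N b))" by (rule power2_le_imp_le) simp
  then have 1: "m \<le> 4 * M * real (card (N b))" using pos by (simp add: field_simps)
  have "real (bad b) / \<epsilon> \<le> (real (card (N b)))\<^sup>2" using b m0 by linarith
  then have 2: "real (bad b) \<le> \<epsilon> * (real (card (N b)))\<^sup>2" using pos by (simp add: field_simps)
  show thesis
  proof
    show "N b \<subseteq> A" using finAt by (auto simp: N_def)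
    show "m \<le> 4 * M * real (card (N b))" by (fact 1)
    show "m \<le> 2 * M * real (card {b \<in> B. (a, b) \<in> G})" if "a \<in> N b" for a
      using that by (auto simp: N_def At_def deg_def)
    show "real (card {(a, a') \<in> N b \<times> N b. real (card {b \<in> B. (a, b) \<in> G \<and> (a', b) \<in> G}) < \<epsilon> / (8 * M\<^sup>2) * m})
       \<le> \<epsilon> * (real (card (N b)))\<^sup>2"
      using 2 by (simp add: bad_def codeg_def \<tau>_def)
  qed
qed

lemma card_ge_of_inj:
  assumes "finite S" "inj_on h T" "h ` T \<subseteq> S"
  shows "card T \<le> card S"
  using assms by (metis card_image card_mono)

text \<open>\<open>D\<close> consists of the differences a - a' with many common neighbours b, hence
  with many representations (a + b) - (a' + b) by elements of the sumset along \<open>G\<close>.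
  \<open>A0\<close> keeps the elements whose differences with nearly all of \<open>A1\<close> lie in
  \<open>D\<close>. The set \<open>D\<close> and this pointwise property are part of the conclusion
  because the dilates are handled through them, and \<rho> enters so that the exceptional share can
  be made smaller than the fibres used there.\<close>

lemma bsg_structure:
  fixes G :: "('a::ab_group_add \<times> 'a) set" and m M \<rho> \<tau> :: real
  assumes fin: "finite G"
    and card: "real (card (fst ` G)) \<le> m" "real (card (snd ` G)) \<le> m"
      "real (card ((\<lambda>(a, b). a + b) ` G)) \<le> m" "m\<^sup>2 \<le> M * real (card G)"
    and pos: "0 < m" "1 \<le> M" "0 < \<rho>" "\<rho> \<le> 1"
    and \<tau>: "\<tau> = \<rho> / (512 * M ^ 3)"
  obtains A1 A0 B' D where "A0 \<subseteq> A1" "A1 \<subseteq> fst ` G" "B' \<subseteq> snd ` G"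
    "m \<le> 4 * M * real (card A1)" "3 * real (card A1) \<le> 4 * real (card A0)"
    "m * real (card A1) \<le> 4 * M * real (card (G \<inter> A0 \<times> B'))"
    "finite D" "real (card D) * \<tau> \<le> m"
    "\<And>z. z \<in> A0 \<Longrightarrow> real (card {a \<in> A1. z - a \<notin> D}) \<le> \<rho> / (16 * M) * real (card A1)"
    "real (card (A0 + B')) * (real (card A1) * \<tau>) \<le> 16 * M * m\<^sup>2"
    "real (card (A0 + uminus ` A0)) * (real (card A1) * \<tau>\<^sup>2) \<le> 2 * m\<^sup>2"
proof -
  define A where "A = fst ` G"
  define B where "B = snd ` G"
  define C where "C = (\<lambda>(a, b). a + b) ` G"
  \<comment> \<open>An element of \<open>A0\<close> has at most 4 \<epsilon> |A1| = \<rho> |A1| /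
    (16 M) bad partners. This is half of the fibre size \<rho> |A1| / (8 M) that pigeonholing
    produces for each dilate, and at most half of the degree |A1| / (8 M) required in
    \<open>B'\<close>.\<close>
  define \<epsilon> where "\<epsilon> = \<rho> / (64 * M)"
  define cn where "cn a a' = {b \<in> B. (a, b) \<in> G \<and> (a', b) \<in> G}" for a a'
  have M: "M > 0" using pos by simp
  have \<epsilon>: "\<epsilon> > 0" "\<epsilon> / (8 * M\<^sup>2) = \<tau>"
    using pos by (auto simp: \<epsilon>_def \<tau> field_simps power2_eq_square power3_eq_cube)
  have \<tau>0: "\<tau> > 0" using pos by (simp add: \<tau>)
  have finABC: "finite A" "finite B" "finite C" using fin by (auto simp: A_def B_def C_def)
  have GAB: "G \<subseteq> A \<times> B" by (force simp: A_def B_def)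
  have GC: "a + b \<in> C" if "(a, b) \<in> G" for a b using that by (force simp: C_def)
  have cC: "real (card C) \<le> m" using card by (simp add: C_def)
  have cAB: "real (card A) \<le> m" "real (card B) \<le> m" using card by (simp_all add: A_def B_def)
  obtain A1 where A1: "A1 \<subseteq> A" "m \<le> 4 * M * real (card A1)"
    "\<And>a. a \<in> A1 \<Longrightarrow> m \<le> 2 * M * real (card {b \<in> B. (a, b) \<in> G})"
    "real (card {(a, a') \<in> A1 \<times> A1. real (card {b \<in> B. (a, b) \<in> G \<and> (a', b) \<in> G}) < \<epsilon> / (8 * M\<^sup>2) * m})
       \<le> \<epsilon> * (real (card A1))\<^sup>2"
    by (fact dependent_random_choice[OF finABC(1,2) GAB cAB card(4) pos(1) M \<epsilon>(1)])
  define a1 where "a1 = real (card A1)"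
  have a1: "a1 > 0"
  proof (rule ccontr)
    assume "\<not> a1 > 0"
    then have "a1 = 0" by (simp add: a1_def)
    then show False using A1(2) pos by (simp add: a1_def)
  qed
  have finA1: "finite A1" using A1 finABC finite_subset by blast
  define bd where "bd a = {a' \<in> A1. real (card (cn a a')) < \<tau> * m}" for a
  define A0 where "A0 = {a \<in> A1. real (card (bd a)) \<le> 4 * \<epsilon> * a1}"
  define D where "D = (\<lambda>(a, a'). a - a') ` {(a, a') \<in> A \<times> A. \<tau> * m \<le> real (card (cn a a'))}"
  define B' where "B' = {b \<in> B. a1 \<le> 8 * M * real (card {a \<in> A1. (a, b) \<in> G})}"
  have A0: "A0 \<subseteq> A1" "finite A0" using finA1 by (auto simp: A0_def)
  have finB': "finite B'" using finABC by (simp add: B'_def)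
  have "finite {(a, a') \<in> A \<times> A. \<tau> * m \<le> real (card (cn a a'))}"
    by (rule finite_subset[of _ "A \<times> A"]) (use finABC in auto)
  then have finD: "finite D" by (simp add: D_def)
  have DI: "a - a' \<in> D" if "a \<in> A" "a' \<in> A" "\<tau> * m \<le> real (card (cn a a'))" for a a'
    using that by (force simp: D_def)
  have badD: "real (card {a \<in> A1. z - a \<notin> D}) \<le> 4 * \<epsilon> * a1" if "z \<in> A0" for z
  proof -
    have "{a \<in> A1. z - a \<notin> D} \<subseteq> bd z"
      using that A0 A1 DI by (force simp: bd_def)
    then have "card {a \<in> A1. z - a \<notin> D} \<le> card (bd z)"
      using finA1 by (intro card_mono) (auto simp: bd_def)
    also have "real \<dots> \<le> 4 * \<epsilon> * a1" using that by (simp add: A0_def)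
    finally show ?thesis by simp
  qed

  \<comment> \<open>Markov's inequality: the total number of bad pairs is at most \<epsilon> |A1|^2,
    so at most a quarter of \<open>A1\<close> can have more than 4 \<epsilon> |A1| bad
    partners.\<close>
  have "real (card A1 - card A0) * (4 * \<epsilon> * a1) = (\<Sum>a\<in>A1 - A0. 4 * \<epsilon> * a1)"
    using A0 by (simp add: card_Diff_subset)
  also have "\<dots> \<le> (\<Sum>a\<in>A1 - A0. real (card (bd a)))"
    by (intro sum_mono) (auto simp: A0_def)
  also have "\<dots> \<le> (\<Sum>a\<in>A1. real (card (bd a)))"
    using finA1 by (intro sum_mono2) auto
  also have "\<dots> = real (card (Sigma A1 bd))"
    using finA1 by (subst card_SigmaI) (auto simp: bd_def)
  also have "Sigma A1 bd = {(a, a') \<in> A1 \<times> A1. real (card {b \<in> B. (a, b) \<in> G \<and> (a', b) \<in> G}) < \<epsilon> / (8 * M\<^sup>2) * m}"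
    by (auto simp: bd_def cn_def \<epsilon>)
  finally have "real (card A1 - card A0) * (4 * \<epsilon> * a1) \<le> \<epsilon> * a1\<^sup>2"
    using A1(4) by (simp add: a1_def)
  then have "(real (card A1 - card A0) * 4) * (\<epsilon> * a1) \<le> a1 * (\<epsilon> * a1)"
    by (simp add: power2_eq_square algebra_simps)
  then have "real (card A1 - card A0) * 4 \<le> a1"
    using \<epsilon> a1 by simp
  moreover have "card A0 \<le> card A1" using A0 finA1 by (intro card_mono) auto
  ultimately have cA0: "3 * a1 \<le> 4 * real (card A0)"
    by (simp add: a1_def of_nat_diff)

  have "real (card D) * (\<tau> * m) \<le> real (card (C \<times> C))"
  proof (rule card_mult_le_card_of_fibers[where f = "\<lambda>(c, c'). c - c'"])
    show "finite (C \<times> C)" using finABC by simp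
    fix q assume "q \<in> D"
    then obtain a a' where q: "q = a - a'" "\<tau> * m \<le> real (card (cn a a'))"
      by (auto simp: D_def)
    have "card (cn a a') \<le> card {s \<in> C \<times> C. (\<lambda>(c, c'). c - c') s = q}"
    proof (rule card_ge_of_inj[where h = "\<lambda>b. (a + b, a' + b)"])
      show "finite {s \<in> C \<times> C. (\<lambda>(c, c'). c - c') s = q}" using finABC by simp
    qed (auto simp: inj_on_def cn_def GC q)
    then show "\<tau> * m \<le> real (card {s \<in> C \<times> C. (\<lambda>(c, c'). c - c') s = q})"
      using q by linarith
  qed
  also have "\<dots> \<le> m * m" unfolding card_cartesian_product of_nat_mult
    using cC pos by (intro mult_mono) auto
  finally have cD: "real (card D) * \<tau> \<le> m" using pos by simp

  \<comment> \<open>Every a in \<open>A1\<close> that is good for both z and z' gives z - z' = (z -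
    a) - (z' - a) with both terms in \<open>D\<close>, and at least half of \<open>A1\<close> is
    good for both.\<close>
  have "real (card (A0 + uminus ` A0)) * (a1 / 2) \<le> real (card (D \<times> D))"
  proof (rule card_mult_le_card_of_fibers[where f = "\<lambda>(c, c'). c - c'"])
    show "finite (D \<times> D)" using finD by simp
    fix q assume "q \<in> A0 + uminus ` A0"
    then obtain z z' where q: "q = z - z'" "z \<in> A0" "z' \<in> A0"
      by (auto elim!: set_plus_elim)
    define T where "T = {a \<in> A1. z - a \<in> D \<and> z' - a \<in> D}"
    have "A1 \<subseteq> T \<union> ({a \<in> A1. z - a \<notin> D} \<union> {a \<in> A1. z' - a \<notin> D})"
      by (auto simp: T_def)
    then have "card A1 \<le> card (T \<union> ({a \<in> A1. z - a \<notin> D} \<union> {a \<in> A1. z' - a \<notin> D}))"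
      using finA1 by (intro card_mono) (auto simp: T_def)
    also have "\<dots> \<le> card T + (card {a \<in> A1. z - a \<notin> D} + card {a \<in> A1. z' - a \<notin> D})"
      by (intro order_trans[OF card_Un_le] add_mono order.refl)
    finally have "a1 \<le> real (card T) + 4 * \<epsilon> * a1 + 4 * \<epsilon> * a1"
      using badD[OF q(2)] badD[OF q(3)] unfolding a1_def by linarith
    moreover have "4 * \<epsilon> \<le> 1 / 4"
      using pos by (simp add: \<epsilon>_def field_simps)
    then have "4 * \<epsilon> * a1 \<le> 1 / 4 * a1" using a1 by (intro mult_right_mono) auto
    ultimately have "a1 / 2 \<le> real (card T)" by linarith
    also have "card T \<le> card {s \<in> D \<times> D. (\<lambda>(c, c'). c - c') s = q}"
    proof (rule card_ge_of_inj[where h = "\<lambda>a. (z - a, z' - a)"])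
      show "finite {s \<in> D \<times> D. (\<lambda>(c, c'). c - c') s = q}" using finD by simp
    qed (auto simp: inj_on_def T_def q)
    finally show "a1 / 2 \<le> real (card {s \<in> D \<times> D. (\<lambda>(c, c'). c - c') s = q})" by simp
  qed
  then have "real (card (A0 + uminus ` A0)) * (a1 / 2) \<le> (real (card D))\<^sup>2"
    by (simp add: card_cartesian_product power2_eq_square)
  then have "real (card (A0 + uminus ` A0)) * (a1 / 2) * \<tau>\<^sup>2 \<le> (real (card D))\<^sup>2 * \<tau>\<^sup>2"
    by (rule mult_right_mono) simp
  also have "\<dots> = (real (card D) * \<tau>)\<^sup>2" by (simp add: power_mult_distrib)
  also have "\<dots> \<le> m\<^sup>2" using cD \<tau>0 by (intro power_mono) auto
  finally have cdiff: "real (card (A0 + uminus ` A0)) * (a1 * \<tau>\<^sup>2) \<le> 2 * m\<^sup>2"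
    by (simp add: algebra_simps)

  \<comment> \<open>Paths of length three: a + b = (a + b') - (a' + b') + (a' + b), with a' a
    neighbour of b that is good for a, and b' a common neighbour of a and a'.\<close>
  have "real (card (A0 + B')) * (a1 / (16 * M) * (\<tau> * m)) \<le> real (card (C \<times> C \<times> C))"
  proof (rule card_mult_le_card_of_fibers[where f = "\<lambda>(c1, c2, c3). c1 - c2 + c3"])
    show "finite (C \<times> C \<times> C)" using finABC by simp
    fix q assume "q \<in> A0 + B'"
    then obtain a b where q: "q = a + b" "a \<in> A0" "b \<in> B'"
      by (auto elim!: set_plus_elim)
    define T where "T = {a' \<in> A1. (a', b) \<in> G} - bd a"
    have finT: "finite T" using finA1 by (simp add: T_def)
    have "a1 / (8 * M) \<le> real (card {a' \<in> A1. (a', b) \<in> G})"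
      using q M by (simp add: B'_def field_simps)
    moreover have "real (card (bd a)) \<le> 4 * \<epsilon> * a1" using q by (simp add: A0_def)
    moreover have "card {a' \<in> A1. (a', b) \<in> G} \<le> card T + card (bd a)"
    proof -
      have "card {a' \<in> A1. (a', b) \<in> G} \<le> card (T \<union> bd a)"
        using finA1 by (intro card_mono) (auto simp: T_def bd_def)
      also have "\<dots> \<le> card T + card (bd a)" by (rule card_Un_le)
      finally show ?thesis .
    qed
    moreover have "4 * \<epsilon> * a1 \<le> a1 / (16 * M)"
      using pos a1 by (simp add: \<epsilon>_def field_simps)
    ultimately have "a1 / (8 * M) - a1 / (16 * M) \<le> real (card T)" by linarith
    then have "a1 / (16 * M) \<le> real (card T)" using M by (simp add: field_simps)
    then have "a1 / (16 * M) * (\<tau> * m) \<le> real (card T) * (\<tau> * m)"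
      using \<tau>0 pos by (intro mult_right_mono) auto
    also have "\<dots> = (\<Sum>a'\<in>T. \<tau> * m)" by simp
    also have "\<dots> \<le> (\<Sum>a'\<in>T. real (card (cn a a')))"
      by (intro sum_mono) (auto simp: T_def bd_def)
    also have "\<dots> = real (card (Sigma T (cn a)))"
      using finT finABC by (subst card_SigmaI) (auto simp: cn_def)
    also have "card (Sigma T (cn a)) \<le> card {s \<in> C \<times> C \<times> C. (\<lambda>(c1, c2, c3). c1 - c2 + c3) s = q}"
    proof (rule card_ge_of_inj[where h = "\<lambda>(a', b'). (a + b', a' + b', a' + b)"])
      show "finite {s \<in> C \<times> C \<times> C. (\<lambda>(c1, c2, c3). c1 - c2 + c3) s = q}" using finABC by simp
    qed (auto simp: inj_on_def T_def cn_def GC q)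
    finally show "a1 / (16 * M) * (\<tau> * m)
      \<le> real (card {s \<in> C \<times> C \<times> C. (\<lambda>(c1, c2, c3). c1 - c2 + c3) s = q})" by simp
  qed
  also have "\<dots> \<le> m * (m * m)" unfolding card_cartesian_product of_nat_mult
    using cC pos by (intro mult_mono) auto
  finally have "real (card (A0 + B')) * (a1 * \<tau>) * m \<le> (16 * M * m\<^sup>2) * m"
    using M by (simp add: field_simps power2_eq_square)
  then have csum: "real (card (A0 + B')) * (a1 * \<tau>) \<le> 16 * M * m\<^sup>2"
    using pos by simp

  have edges: "real (card (G \<inter> A0 \<times> Y)) = (\<Sum>a\<in>A0. real (card {b \<in> Y. (a, b) \<in> G}))"
    if "Y \<subseteq> B" for Y
  proof -
    have "card (G \<inter> A0 \<times> Y) = (\<Sum>a\<in>A0. card {b \<in> Y. (a, b) \<in> G \<inter> A0 \<times> Y})"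
      using A0 that finABC finite_subset by (intro card_eq_sum_fibers) blast+
    also have "\<dots> = (\<Sum>a\<in>A0. card {b \<in> Y. (a, b) \<in> G})"
      by (intro sum.cong refl arg_cong[of _ _ card]) auto
    finally show ?thesis by simp
  qed
  \<comment> \<open>In units of m |A1| / M, the degrees give \<open>A0\<close> at least 3/8 of
    edges, and those that miss \<open>B'\<close> make up at most 1/8.\<close>
  have "3 * a1 / 4 * (m / (2 * M)) \<le> real (card A0) * (m / (2 * M))"
    using cA0 pos by (intro mult_right_mono) auto
  also have "\<dots> = (\<Sum>a\<in>A0. m / (2 * M))" by simp
  also have "\<dots> \<le> (\<Sum>a\<in>A0. real (card {b \<in> B. (a, b) \<in> G}))"
    using A1(3) A0 M by (intro sum_mono) (auto simp: field_simps)
  also have "\<dots> = real (card (G \<inter> A0 \<times> B))" using edges by simp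
  also have "card (G \<inter> A0 \<times> B) \<le> card (G \<inter> A0 \<times> B') + card (G \<inter> A0 \<times> (B - B'))"
  proof -
    have "G \<inter> A0 \<times> B \<subseteq> (G \<inter> A0 \<times> B') \<union> (G \<inter> A0 \<times> (B - B'))" by auto
    then have "card (G \<inter> A0 \<times> B) \<le> card ((G \<inter> A0 \<times> B') \<union> (G \<inter> A0 \<times> (B - B')))"
      using fin by (intro card_mono) auto
    also have "\<dots> \<le> card (G \<inter> A0 \<times> B') + card (G \<inter> A0 \<times> (B - B'))" by (rule card_Un_le)
    finally show ?thesis .
  qed
  finally have 1: "3 * a1 / 4 * (m / (2 * M)) \<le> real (card (G \<inter> A0 \<times> B')) + real (card (G \<inter> A0 \<times> (B - B')))"
    by simp
  have "card (G \<inter> A0 \<times> (B - B')) = (\<Sum>a\<in>A0. card {b \<in> B - B'. (a, b) \<in> G})"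
    using edges[of "B - B'"] by (simp flip: of_nat_sum)
  also have "\<dots> = (\<Sum>b\<in>B - B'. card {a \<in> A0. (a, b) \<in> G})"
    using A0 finABC by (intro sum_card_swap) auto
  finally have "real (card (G \<inter> A0 \<times> (B - B'))) = (\<Sum>b\<in>B - B'. real (card {a \<in> A0. (a, b) \<in> G}))"
    by simp
  also have "\<dots> \<le> (\<Sum>b\<in>B - B'. a1 / (8 * M))"
  proof (rule sum_mono)
    fix b assume "b \<in> B - B'"
    then have "8 * M * real (card {a \<in> A1. (a, b) \<in> G}) < a1" by (auto simp: B'_def)
    then have "real (card {a \<in> A1. (a, b) \<in> G}) \<le> a1 / (8 * M)" using M by (simp add: field_simps)
    moreover have "card {a \<in> A0. (a, b) \<in> G} \<le> card {a \<in> A1. (a, b) \<in> G}"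
      using A0 finA1 by (intro card_mono) auto
    ultimately show "real (card {a \<in> A0. (a, b) \<in> G}) \<le> a1 / (8 * M)" by linarith
  qed
  also have "\<dots> = real (card (B - B')) * (a1 / (8 * M))" by simp
  also have "\<dots> \<le> m * (a1 / (8 * M))"
  proof (rule mult_right_mono)
    have "card (B - B') \<le> card B" using finABC by (intro card_mono) auto
    then show "real (card (B - B')) \<le> m" using card by (simp add: B_def)
  qed (use a1 M in auto)
  finally have "3 * a1 / 4 * (m / (2 * M)) \<le> real (card (G \<inter> A0 \<times> B')) + m * (a1 / (8 * M))"
    using 1 by linarith
  then have cH: "m * a1 \<le> 4 * M * real (card (G \<inter> A0 \<times> B'))"
    using M by (simp add: field_simps)
  show thesis
  proof (rule that[of A0 A1 B' D])
    show "A0 \<subseteq> A1" "A1 \<subseteq> fst ` G" "B' \<subseteq> snd ` G" "finite D"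
      using A0 A1 finD by (auto simp: A_def B'_def B_def)
    show "real (card {a \<in> A1. z - a \<notin> D}) \<le> \<rho> / (16 * M) * real (card A1)" if "z \<in> A0" for z
      using badD[OF that] by (simp add: \<epsilon>_def a1_def)
  qed (use A1(2) cA0 cH cD csum cdiff in \<open>simp_all add: a1_def\<close>)
qed

section \<open>Dilates in a prime field\<close>

text \<open>The field is a subset of a ring type, so that one type can house fields of all prime
  orders; its unit \<open>e\<close> need not be a unit of the ambient ring. The last assumption
  encodes primality: repeatedly adding \<open>e\<close> reaches everything.\<close>

locale prime_field =
  fixes K :: "'a::comm_ring set" and e :: 'a
  assumes finite_K: "finite K"
    and zero_K: "0 \<in> K" and add_K: "x \<in> K \<Longrightarrow> y \<in> K \<Longrightarrow> x + y \<in> K"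
    and uminus_K: "x \<in> K \<Longrightarrow> - x \<in> K" and mult_K: "x \<in> K \<Longrightarrow> y \<in> K \<Longrightarrow> x * y \<in> K"
    and no_zero_divisors_K: "x \<in> K \<Longrightarrow> y \<in> K \<Longrightarrow> x * y = 0 \<Longrightarrow> x = 0 \<or> y = 0"
    and unit_K: "e \<in> K" and mult_unit: "x \<in> K \<Longrightarrow> e * x = x"
    and inverse_ex: "x \<in> K \<Longrightarrow> x \<noteq> 0 \<Longrightarrow> \<exists>y\<in>K. x * y = e"
    and unit_generates: "S \<subseteq> K \<Longrightarrow> S \<noteq> {} \<Longrightarrow> (\<And>s. s \<in> S \<Longrightarrow> s + e \<in> S) \<Longrightarrow> S = K"
begin

lemma diff_K: "x \<in> K \<Longrightarrow> y \<in> K \<Longrightarrow> x - y \<in> K"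
  using add_K[of x "- y"] uminus_K[of y] by simp

lemma mult_cancel_K:
  assumes "x \<in> K" "y \<in> K" "z \<in> K" "x \<noteq> 0" "x * y = x * z"
  shows "y = z"
proof -
  have "x * (y - z) = 0" using assms by (simp add: algebra_simps)
  then show ?thesis using no_zero_divisors_K[of x "y - z"] diff_K assms by auto
qed

text \<open>Since \<^term>\<open>e\<close> generates the additive group, the set of ratios of differences of
  \<^term>\<open>V\<close> is everything or not closed under adding \<^term>\<open>e\<close>.\<close>

lemma ratio_dichotomy:
  assumes V: "V \<subseteq> K" "s0 \<in> V" "t0 \<in> V" "s0 \<noteq> t0"
  obtains
    (all) "\<And>\<zeta>. \<zeta> \<in> K \<Longrightarrow> \<exists>l3\<in>V. \<exists>l4\<in>V. \<exists>l5\<in>V. \<exists>l6\<in>V. l5 \<noteq> l6 \<and> l3 - l4 = \<zeta> * (l5 - l6)"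
  | (inj) l3 l4 l5 l6 where "l3 \<in> V" "l4 \<in> V" "l5 \<in> V" "l6 \<in> V"
      "inj_on (\<lambda>(s, t). (l5 - l6) * s + (l3 - l4 + (l5 - l6)) * t) (V \<times> V)"
proof -
  define R where "R = {\<zeta> \<in> K. \<exists>l3\<in>V. \<exists>l4\<in>V. \<exists>l5\<in>V. \<exists>l6\<in>V. l5 \<noteq> l6 \<and> l3 - l4 = \<zeta> * (l5 - l6)}"
  have "0 \<in> R" using V zero_K unfolding R_def by fastforce
  show thesis
  proof (cases "\<forall>s\<in>R. s + e \<in> R")
    case True
    moreover have "R \<subseteq> K" by (auto simp: R_def)
    ultimately have "R = K" using \<open>0 \<in> R\<close> by (intro unit_generates) auto
    then show thesis using all unfolding R_def by blast
  next
    case False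
    then obtain \<zeta> where \<zeta>: "\<zeta> \<in> R" "\<zeta> + e \<notin> R" by blast
    then obtain l3 l4 l5 l6 where l: "l3 \<in> V" "l4 \<in> V" "l5 \<in> V" "l6 \<in> V" "l5 \<noteq> l6"
      and eq: "l3 - l4 = \<zeta> * (l5 - l6)" by (auto simp: R_def)
    have \<zeta>K: "\<zeta> \<in> K" using \<zeta> by (simp add: R_def)
    define v where "v = l5 - l6"
    have v: "v \<in> K" "v \<noteq> 0" using l V diff_K by (auto simp: v_def)
    \<comment> \<open>With denominators cleared, the map of the second alternative is v times (s, t)
      |-> s + (\<zeta> + e) t. A collision with distinct t would exhibit \<zeta> + e as a
      ratio.\<close>
    have sum: "l3 - l4 + v = (\<zeta> + e) * v"
      using mult_unit[OF v(1)] by (simp add: eq v_def algebra_simps)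
    have "inj_on (\<lambda>(s, t). (l5 - l6) * s + (l3 - l4 + (l5 - l6)) * t) (V \<times> V)"
    proof (rule inj_onI, clarify)
      fix s t s' t' assume st: "s \<in> V" "t \<in> V" "s' \<in> V" "t' \<in> V"
        and "(l5 - l6) * s + (l3 - l4 + (l5 - l6)) * t = (l5 - l6) * s' + (l3 - l4 + (l5 - l6)) * t'"
      then have "v * s + (\<zeta> + e) * v * t = v * s' + (\<zeta> + e) * v * t'"
        unfolding v_def[symmetric] sum by simp
      then have "v * (s - s') = v * ((\<zeta> + e) * (t' - t))"
        by (simp add: algebra_simps)
      moreover have "s - s' \<in> K" "(\<zeta> + e) * (t' - t) \<in> K"
        using st V \<zeta>K unit_K by (auto intro!: diff_K mult_K add_K)
      ultimately have ss: "s - s' = (\<zeta> + e) * (t' - t)" using mult_cancel_K v by blast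
      have "t' = t"
      proof (rule ccontr)
        assume "t' \<noteq> t"
        then have "\<zeta> + e \<in> R" unfolding R_def using st ss \<zeta>K unit_K add_K by blast
        then show False using \<zeta> by blast
      qed
      then show "s = s' \<and> t = t'" using ss by simp
    qed
    then show thesis using inj l by blast
  qed
qed

end

section \<open>Additive energy and the growth of dilates\<close>

lemma card_square_le_image_mult_energy:
  assumes "finite S"
  shows "(real (card S))\<^sup>2 \<le> real (card (f ` S)) * real (card {(s, t) \<in> S \<times> S. f s = f t})"
proof -
  define F where "F q = {s \<in> S. f s = q}" for q
  have finF: "finite (F q)" for q using assms by (simp add: F_def)
  have "S = (\<Union>q\<in>f ` S. F q)" by (auto simp: F_def)
  then have "card S = card (\<Union>q\<in>f ` S. F q)" by simp
  also have "\<dots> = (\<Sum>q\<in>f ` S. card (F q))"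
    using assms finF by (subst card_UN_disjoint) (auto simp: F_def)
  finally have "(real (card S))\<^sup>2 = (\<Sum>q\<in>f ` S. real (card (F q)))\<^sup>2" by simp
  also have "\<dots> \<le> real (card (f ` S)) * (\<Sum>q\<in>f ` S. (real (card (F q)))\<^sup>2)"
    using assms by (intro square_of_sum_le) auto
  also have "(\<Sum>q\<in>f ` S. (real (card (F q)))\<^sup>2) = real (\<Sum>q\<in>f ` S. card (F q \<times> F q))"
    by (simp add: card_cartesian_product power2_eq_square)
  also have "(\<Sum>q\<in>f ` S. card (F q \<times> F q)) = card (\<Union>q\<in>f ` S. F q \<times> F q)"
    using assms finF by (subst card_UN_disjoint) (auto simp: F_def)
  also have "(\<Union>q\<in>f ` S. F q \<times> F q) = {(s, t) \<in> S \<times> S. f s = f t}" by (auto simp: F_def)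
  finally show ?thesis .
qed

lemma large_fiber_ex:
  fixes m :: real
  assumes "finite S" "S \<noteq> {}" "real (card (f ` S)) \<le> m"
  obtains q where "real (card S) \<le> m * real (card {s \<in> S. f s = q})"
proof -
  have "\<exists>q. real (card S) \<le> m * real (card {s \<in> S. f s = q})"
  proof (rule ccontr)
    assume "\<not> ?thesis"
    then have lt: "m * real (card {s \<in> S. f s = q}) < real (card S)" for q by (simp add: not_le)
    have "m * real (card S) = (\<Sum>q\<in>f ` S. m * real (card {s \<in> S. f s = q}))"
    proof -
      have "card S = card (\<Union>q\<in>f ` S. {s \<in> S. f s = q})" by (rule arg_cong[of _ _ card]) auto
      also have "\<dots> = (\<Sum>q\<in>f ` S. card {s \<in> S. f s = q})"
        using assms by (subst card_UN_disjoint) auto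
      finally show ?thesis by (simp add: sum_distrib_left)
    qed
    also have "\<dots> < (\<Sum>q\<in>f ` S. real (card S))"
      using assms lt by (intro sum_strict_mono) auto
    also have "\<dots> = real (card (f ` S)) * real (card S)" by simp
    also have "\<dots> \<le> m * real (card S)" using assms by (intro mult_right_mono) auto
    finally show False by simp
  qed
  then show thesis using that by blast
qed

context prime_field
begin

text \<open>A collision t + \<zeta> b = t' + \<zeta> b' with b and b' distinct determines \<zeta>.
  The nontrivial collisions for different \<zeta> are therefore disjoint and number at most |T|^2
  |B|^2 altogether; the trivial ones are the diagonal. Cauchy-Schwarz turns the small images into
  many collisions.\<close>

lemma energy_family_bound:
  fixes Q :: real
  assumes fin: "finite I" and \<zeta>: "\<And>i. i \<in> I \<Longrightarrow> \<zeta> i \<in> K" "inj_on \<zeta> I"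
    and T: "T \<subseteq> K" and B: "B \<subseteq> K" "\<And>i. i \<in> I \<Longrightarrow> Bf i \<subseteq> B"
    and Q: "\<And>i. i \<in> I \<Longrightarrow> real (card ((\<lambda>(t, b). t + \<zeta> i * b) ` (T \<times> Bf i))) \<le> Q" "0 \<le> Q"
  shows "(real (card T))\<^sup>2 * (\<Sum>i\<in>I. (real (card (Bf i)))\<^sup>2)
    \<le> Q * (real (card T) * (\<Sum>i\<in>I. real (card (Bf i))) + (real (card T))\<^sup>2 * (real (card B))\<^sup>2)"
proof -
  have finT: "finite T" and finB: "finite B" using T B finite_K finite_subset by blast+
  have finBf: "finite (Bf i)" if "i \<in> I" for i using B(2)[OF that] finB finite_subset by blast
  define f where "f i = (\<lambda>(t, b). t + \<zeta> i * b)" for i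
  define E where "E i = {(x, y) \<in> (T \<times> Bf i) \<times> (T \<times> Bf i). f i x = f i y}" for i
  define E1 where "E1 i = {(x, y) \<in> E i. snd x \<noteq> snd y}" for i
  have finE: "finite (E i)" if "i \<in> I" for i
    by (rule finite_subset[of _ "(T \<times> Bf i) \<times> (T \<times> Bf i)"]) (use finT finBf that in \<open>auto simp: E_def\<close>)
  have finE1: "finite (E1 i)" if "i \<in> I" for i
    by (rule finite_subset[OF _ finE[OF that]]) (auto simp: E1_def)
  have cE: "card (E i) \<le> card T * card (Bf i) + card (E1 i)" if "i \<in> I" for i
  proof -
    have "E i \<subseteq> (\<lambda>x. (x, x)) ` (T \<times> Bf i) \<union> E1 i"
      by (auto simp: E_def E1_def f_def)
    then have "card (E i) \<le> card ((\<lambda>x. (x, x)) ` (T \<times> Bf i) \<union> E1 i)"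
      using finT finBf finE1 that by (intro card_mono) auto
    also have "\<dots> \<le> card ((\<lambda>x. (x, x)) ` (T \<times> Bf i)) + card (E1 i)" by (rule card_Un_le)
    also have "card ((\<lambda>x. (x, x)) ` (T \<times> Bf i)) = card T * card (Bf i)"
      by (subst card_image) (auto simp: inj_on_def card_cartesian_product)
    finally show ?thesis .
  qed
  have "(\<Sum>i\<in>I. card (E1 i)) = card (\<Union>i\<in>I. E1 i)"
  proof (rule card_UN_disjoint[symmetric])
    show "\<forall>i\<in>I. \<forall>j\<in>I. i \<noteq> j \<longrightarrow> E1 i \<inter> E1 j = {}"
    proof (intro ballI impI equals0I, elim IntE)
      fix i j z assume ij: "i \<in> I" "j \<in> I" "i \<noteq> j" and z: "z \<in> E1 i" "z \<in> E1 j"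
      obtain t b t' b' where zz: "z = ((t, b), (t', b'))" by (metis surj_pair)
      have b: "b \<in> K" "b' \<in> K" "b \<noteq> b'" using z B ij by (auto simp: zz E1_def E_def)
      have eqs: "t + \<zeta> i * b = t' + \<zeta> i * b'" "t + \<zeta> j * b = t' + \<zeta> j * b'"
        using z by (auto simp: zz E1_def E_def f_def)
      have "(\<zeta> i - \<zeta> j) * (b - b') = (t + \<zeta> i * b) - (t + \<zeta> j * b) - \<zeta> i * b' + \<zeta> j * b'"
        by (simp add: algebra_simps)
      also have "\<dots> = 0" unfolding eqs by (simp add: algebra_simps)
      finally have "\<zeta> i - \<zeta> j = 0 \<or> b - b' = 0"
        using b \<zeta> ij by (intro no_zero_divisors_K diff_K) auto
      then show False using b \<zeta>(2) ij by (auto dest: inj_onD)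
    qed
  qed (use fin finE1 in auto)
  also have "\<dots> \<le> card ((T \<times> B) \<times> (T \<times> B))"
    using finT finB B by (intro card_mono) (fastforce simp: E1_def E_def)+
  finally have cE1: "(\<Sum>i\<in>I. real (card (E1 i))) \<le> (real (card T))\<^sup>2 * (real (card B))\<^sup>2"
    by (simp add: card_cartesian_product power2_eq_square algebra_simps flip: of_nat_sum of_nat_mult)
  have "(real (card T))\<^sup>2 * (\<Sum>i\<in>I. (real (card (Bf i)))\<^sup>2) = (\<Sum>i\<in>I. (real (card (T \<times> Bf i)))\<^sup>2)"
    by (simp add: card_cartesian_product power_mult_distrib sum_distrib_left)
  also have "\<dots> \<le> (\<Sum>i\<in>I. Q * (real (card T) * real (card (Bf i)) + real (card (E1 i))))"
  proof (rule sum_mono)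
    fix i assume i: "i \<in> I"
    have "(real (card (T \<times> Bf i)))\<^sup>2 \<le> real (card (f i ` (T \<times> Bf i))) * real (card (E i))"
      unfolding E_def using finT finBf[OF i] by (intro card_square_le_image_mult_energy) simp
    also have "\<dots> \<le> Q * (real (card T) * real (card (Bf i)) + real (card (E1 i)))"
      using Q(1)[OF i] Q(2) cE[OF i] unfolding f_def
      by (intro mult_mono) (simp_all flip: of_nat_mult of_nat_add)
    finally show "(real (card (T \<times> Bf i)))\<^sup>2 \<le> Q * (real (card T) * real (card (Bf i)) + real (card (E1 i)))" .
  qed
  also have "\<dots> = Q * (real (card T) * (\<Sum>i\<in>I. real (card (Bf i))) + (\<Sum>i\<in>I. real (card (E1 i))))"
    by (simp add: sum_distrib_left sum.distrib algebra_simps)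
  also have "\<dots> \<le> Q * (real (card T) * (\<Sum>i\<in>I. real (card (Bf i))) + (real (card T))\<^sup>2 * (real (card B))\<^sup>2)"
    using cE1 Q(2) by (intro mult_left_mono) auto
  finally show ?thesis .
qed

end

text \<open>With a' + l b = x0, the identity z - l a = (z - a') - l (a + b) + x0 represents the left
  side by an element of \<open>D\<close> and one of \<open>A0 + B'\<close>. At least half of the
  points (a', b) of \<open>Y\<close> are admissible, and each gives another representation.\<close>

lemma dilate_growth:
  fixes A0 B' D :: "'a::comm_ring set"
  assumes fin: "finite A0" "finite B'" "finite D"
    and Y: "Y \<subseteq> A0 \<times> B'" "\<And>a b. (a, b) \<in> Y \<Longrightarrow> a + l * b = x0"
    and bad: "\<And>z. z \<in> A0 \<Longrightarrow> 2 * real (card {y \<in> Y. z - fst y \<notin> D}) \<le> real (card Y)"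
  shows "real (card (A0 + uminus ` ((*) l ` A0))) * real (card Y) \<le> 2 * real (card (A0 + B')) * real (card D)"
proof -
  have finY: "finite Y" using Y fin by (meson finite_SigmaI finite_subset)
  have finAB: "finite (A0 + B')" using fin by (intro finite_set_plus)
  have "real (card (A0 + uminus ` ((*) l ` A0))) * (real (card Y) / 2) \<le> real (card ((A0 + B') \<times> D))"
  proof (rule card_mult_le_card_of_fibers[where f = "\<lambda>(t, d). d - l * t + x0"])
    show "finite ((A0 + B') \<times> D)" using finAB fin by simp
    fix q assume "q \<in> A0 + uminus ` ((*) l ` A0)"
    then obtain z a where q: "q = z - l * a" "z \<in> A0" "a \<in> A0"
      by (auto elim!: set_plus_elim)
    define T where "T = {y \<in> Y. z - fst y \<in> D}"
    have "card Y \<le> card (T \<union> {y \<in> Y. z - fst y \<notin> D})"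
      using finY by (intro card_mono) (auto simp: T_def)
    also have "\<dots> \<le> card T + card {y \<in> Y. z - fst y \<notin> D}" by (rule card_Un_le)
    finally have "real (card Y) / 2 \<le> real (card T)" using bad[OF q(2)] by linarith
    also have "card T \<le> card {s \<in> (A0 + B') \<times> D. (\<lambda>(t, d). d - l * t + x0) s = q}"
    proof (rule card_ge_of_inj[where h = "\<lambda>(a', b). (a + b, z - a')"])
      show "finite {s \<in> (A0 + B') \<times> D. (\<lambda>(t, d). d - l * t + x0) s = q}" using finAB fin by simp
      show "inj_on (\<lambda>(a', b). (a + b, z - a')) T" by (auto simp: inj_on_def)
      show "(\<lambda>(a', b). (a + b, z - a')) ` T \<subseteq> {s \<in> (A0 + B') \<times> D. (\<lambda>(t, d). d - l * t + x0) s = q}"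
      proof (rule image_subsetI)
        fix y assume "y \<in> T"
        then obtain a' b where ab: "y = (a', b)" "(a', b) \<in> T" by (metis surj_pair)
        then have "(a', b) \<in> Y" by (simp add: T_def)
        then have x0: "x0 = a' + l * b" using Y(2) by force
        have "b \<in> B'" using ab Y by (auto simp: T_def)
        then have "a + b \<in> A0 + B'" using q by (intro set_plus_intro)
        moreover have "z - a' - l * (a + b) + x0 = q" unfolding x0 q by (simp add: algebra_simps)
        moreover have "z - a' \<in> D" using ab by (simp add: T_def)
        ultimately show "(case y of (a', b) \<Rightarrow> (a + b, z - a')) \<in> {s \<in> (A0 + B') \<times> D. (\<lambda>(t, d). d - l * t + x0) s = q}"
          using ab by simp
      qed
    qed
    finally show "real (card Y) / 2 \<le> real (card {s \<in> (A0 + B') \<times> D. (\<lambda>(t, d). d - l * t + x0) s = q})"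
      by simp
  qed
  then show ?thesis by (simp add: card_cartesian_product)
qed

text \<open>Elimination of \<open>a1\<close> and \<tau>. The factor \<rho>^3 consists of one \<rho>
  from the fibre size \<open>y\<close> and two from \<tau>^2; the constant is 2^30 = 2^12 *
  512^2.\<close>

lemma dilate_growth_estimate:
  fixes c y s d a1 m M \<rho> \<tau> :: real
  assumes "c * y \<le> 2 * s * d" "s * (a1 * \<tau>) \<le> 16 * M * m\<^sup>2" "d * \<tau> \<le> m"
    "\<rho> * a1 / (8 * M) \<le> y" "m \<le> 4 * M * a1" "\<tau> = \<rho> / (512 * M ^ 3)"
    "0 < m" "1 \<le> M" "0 < \<rho>" "0 < a1" "0 \<le> c" "0 \<le> s" "0 \<le> d"
  shows "c \<le> 2 ^ 30 * M ^ 10 / \<rho> ^ 3 * m"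
proof -
  have \<tau>: "\<tau> > 0" using assms by simp
  have M: "M > 0" using assms by simp
  have "c * (\<rho> * a1 / (8 * M)) * (a1 * \<tau>\<^sup>2) \<le> c * y * (a1 * \<tau>\<^sup>2)"
    using assms \<tau> by (intro mult_right_mono mult_left_mono) auto
  also have "\<dots> \<le> 2 * s * d * (a1 * \<tau>\<^sup>2)"
    using assms \<tau> by (intro mult_right_mono) auto
  also have "\<dots> = 2 * ((s * (a1 * \<tau>)) * (d * \<tau>))" by (simp add: power2_eq_square)
  also have "\<dots> \<le> 2 * ((16 * M * m\<^sup>2) * m)"
    using assms(2,3,7,8,13) \<tau> by (intro mult_left_mono mult_mono[OF assms(2,3)]) auto
  finally have "c * (\<rho> * a1 / (8 * M)) * (a1 * \<tau>\<^sup>2) \<le> 2 * ((16 * M * m\<^sup>2) * m)" .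
  then have 1: "c * \<rho> * \<tau>\<^sup>2 * a1\<^sup>2 \<le> 256 * M\<^sup>2 * m ^ 3"
    using M by (simp add: field_simps power2_eq_square power3_eq_cube)
  have "m\<^sup>2 \<le> (4 * M * a1)\<^sup>2" using assms by (intro power_mono) auto
  then have "c * \<rho> * \<tau>\<^sup>2 * m\<^sup>2 \<le> c * \<rho> * \<tau>\<^sup>2 * (4 * M * a1)\<^sup>2"
    using assms by (intro mult_left_mono) auto
  also have "\<dots> = 16 * M\<^sup>2 * (c * \<rho> * \<tau>\<^sup>2 * a1\<^sup>2)" by (simp add: power2_eq_square)
  also have "\<dots> \<le> 16 * M\<^sup>2 * (256 * M\<^sup>2 * m ^ 3)" using 1 by (intro mult_left_mono) auto
  finally have "(c * \<rho> * \<tau>\<^sup>2) * m\<^sup>2 \<le> (4096 * M ^ 4 * m) * m\<^sup>2"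
    by (simp add: power2_eq_square power3_eq_cube power4_eq_xxxx algebra_simps)
  then have 2: "c * \<rho> * \<tau>\<^sup>2 \<le> 4096 * M ^ 4 * m" using assms by simp
  have "c * \<rho> ^ 3 = (c * \<rho> * \<tau>\<^sup>2) * (512 * M ^ 3)\<^sup>2"
    using assms M by (simp add: power_divide power2_eq_square power3_eq_cube)
  also have "\<dots> \<le> (4096 * M ^ 4 * m) * (512 * M ^ 3)\<^sup>2"
    using 2 by (intro mult_right_mono) auto
  also have "\<dots> = 2 ^ 30 * M ^ 10 * m" by (simp add: power_mult_distrib flip: power_mult power_add)
  finally show ?thesis using assms by (simp add: field_simps)
qed

text \<open>Here \<open>dd\<close> stands for the size of the difference set, at most 2^21 M^7 /
  \<rho>^2 times m; the other factor is the sixth power of the growth of \<open>A0\<close> under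
  four dilates.\<close>

lemma sextuple_estimate:
  fixes u dd a1 m M \<rho> \<tau> :: real
  assumes "u \<le> (2 ^ 35 * M ^ 11 / \<rho> ^ 3) ^ 6 * dd" "dd * (a1 * \<tau>\<^sup>2) \<le> 2 * m\<^sup>2"
    "m \<le> 4 * M * a1" "\<tau> = \<rho> / (512 * M ^ 3)" "0 < m" "1 \<le> M" "0 < \<rho>" "0 < a1" "0 \<le> dd"
  shows "u \<le> 2 ^ 231 * M ^ 73 / \<rho> ^ 20 * m"
proof -
  have M: "M > 0" using assms by simp
  have "dd * \<tau>\<^sup>2 * m \<le> dd * \<tau>\<^sup>2 * (4 * M * a1)" using assms by (intro mult_left_mono) auto
  also have "\<dots> = 4 * M * (dd * (a1 * \<tau>\<^sup>2))" by simp
  also have "\<dots> \<le> 4 * M * (2 * m\<^sup>2)" using assms by (intro mult_left_mono) auto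
  finally have "(dd * \<tau>\<^sup>2) * m \<le> (8 * M * m) * m" by (simp add: power2_eq_square)
  then have 1: "dd * \<tau>\<^sup>2 \<le> 8 * M * m" using assms by simp
  have "dd * \<rho>\<^sup>2 = (dd * \<tau>\<^sup>2) * (512 * M ^ 3)\<^sup>2"
    using assms M by (simp add: power_divide power2_eq_square power3_eq_cube)
  also have "\<dots> \<le> (8 * M * m) * (512 * M ^ 3)\<^sup>2" using 1 by (intro mult_right_mono) auto
  also have "\<dots> = 2 ^ 21 * M ^ 7 * m"
    by (simp add: power_mult_distrib flip: power_mult power_add power_Suc)
  finally have 2: "dd \<le> 2 ^ 21 * M ^ 7 / \<rho>\<^sup>2 * m" using assms by (simp add: field_simps)
  have "(2 ^ 35 * M ^ 11 / \<rho> ^ 3) ^ 6 * dd \<le> (2 ^ 35 * M ^ 11 / \<rho> ^ 3) ^ 6 * (2 ^ 21 * M ^ 7 / \<rho>\<^sup>2 * m)"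
    using 2 M assms by (intro mult_left_mono) auto
  also have "\<dots> = 2 ^ 231 * M ^ 73 / \<rho> ^ 20 * m"
    by (simp add: power_mult_distrib power_divide flip: power_mult power_add)
  finally show ?thesis using assms by linarith
qed

section \<open>The sum-product argument\<close>

context prime_field
begin

text \<open>\<open>M\<close> measures how far \<open>G\<close> is from a full product, and \<rho>
  how many dilates see a given point of \<open>G\<close>. When all of \<open>K\<close> consists of
  ratios, the energy count ends in the first or third alternative; when the map on pairs is
  injective, in the first or second. Each alternative will be impossible for too many
  incidences.\<close>

theorem many_small_dilated_sums:
  fixes G :: "('a \<times> 'a) set" and m M \<rho> :: real
  assumes G: "G \<subseteq> K \<times> K"
    and card: "real (card (fst ` G)) \<le> m" "real (card (snd ` G)) \<le> m"
      "real (card ((\<lambda>(a, b). a + b) ` G)) \<le> m" "m\<^sup>2 \<le> M * real (card G)"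
    and pos: "0 < m" "1 \<le> M" "0 < \<rho>" "\<rho> \<le> 1"
    and \<Lambda>: "\<Lambda> \<subseteq> K" "0 \<notin> \<Lambda>" "\<And>l. l \<in> \<Lambda> \<Longrightarrow> G\<Lambda> l \<subseteq> G"
    and popular: "\<And>g. g \<in> G \<Longrightarrow> \<rho> * real (card \<Lambda>) \<le> real (card {l \<in> \<Lambda>. g \<in> G\<Lambda> l})"
    and small: "\<And>l. l \<in> \<Lambda> \<Longrightarrow> real (card ((\<lambda>(a, b). a + l * b) ` G\<Lambda> l)) \<le> m"
  shows "m \<le> 2 ^ 245 * M ^ 78 / \<rho> ^ 22 \<or> (real (card \<Lambda>))\<^sup>2 \<le> 2 ^ 254 * M ^ 81 / \<rho> ^ 26 * m
    \<or> real (card K) \<le> 2 ^ 232 * M ^ 73 / \<rho> ^ 20 * m"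
proof -
  have M: "M > 0" using pos by simp
  have finG: "finite G" using G finite_K by (meson finite_SigmaI finite_subset)
  have fin\<Lambda>: "finite \<Lambda>" using \<Lambda> finite_K finite_subset by blast
  define \<tau> where "\<tau> = \<rho> / (512 * M ^ 3)"
  have \<tau>0: "\<tau> > 0" using pos by (simp add: \<tau>_def)
  obtain A1 A0 B' D where bsg: "A0 \<subseteq> A1" "A1 \<subseteq> fst ` G" "B' \<subseteq> snd ` G"
    "m \<le> 4 * M * real (card A1)" "3 * real (card A1) \<le> 4 * real (card A0)"
    "m * real (card A1) \<le> 4 * M * real (card (G \<inter> A0 \<times> B'))"
    "finite D" "real (card D) * \<tau> \<le> m"
    "\<And>z. z \<in> A0 \<Longrightarrow> real (card {a \<in> A1. z - a \<notin> D}) \<le> \<rho> / (16 * M) * real (card A1)"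
    "real (card (A0 + B')) * (real (card A1) * \<tau>) \<le> 16 * M * m\<^sup>2"
    "real (card (A0 + uminus ` A0)) * (real (card A1) * \<tau>\<^sup>2) \<le> 2 * m\<^sup>2"
    by (rule bsg_structure[OF finG card pos \<tau>_def], rule that)
  define a1 where "a1 = real (card A1)"
  define H where "H = G \<inter> A0 \<times> B'"
  have a1: "a1 > 0"
  proof (rule ccontr)
    assume "\<not> a1 > 0"
    then have "a1 = 0" by (simp add: a1_def)
    then show False using bsg(4) pos by (simp add: a1_def)
  qed
  have finA1: "finite A1" "finite A0" "finite B'"
    using bsg(1-3) finG by (meson finite_subset finite_imageI)+
  have A0K: "A0 \<subseteq> K" "B' \<subseteq> K" "snd ` G \<subseteq> K" using bsg G by fastforce+
  define A where "A = real (card A0)"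
  have A: "m \<le> 8 * M * A" "A > 0"
  proof -
    have "4 * M * a1 \<le> 4 * M * (4 / 3 * A)"
      using bsg(5) M by (intro mult_left_mono) (auto simp: A_def a1_def)
    also have "\<dots> \<le> 8 * M * A" using M by (simp add: A_def)
    finally show "m \<le> 8 * M * A" using bsg(4) unfolding a1_def by linarith
    show "A > 0" using bsg(5) a1 by (simp add: A_def a1_def)
  qed
  have A0ne: "A0 \<noteq> {}" using A by (auto simp: A_def)
  have finH: "finite H" using finG by (simp add: H_def)
  have cH: "m * a1 \<le> 4 * M * real (card H)" using bsg(6) by (simp add: H_def a1_def)
  have H0: "real (card H) > 0"
  proof (rule ccontr)
    assume "\<not> real (card H) > 0"
    then have "m * a1 \<le> 0" using cH by simp
    then show False using pos a1 by (simp add: mult_le_0_iff)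
  qed

  \<comment> \<open>By popularity, an average dilate retains the proportion \<rho> of
    \<open>H\<close>. Those retaining half of this form at least the proportion \<rho> / 2 of
    \<open>\<Lambda>\<close>.\<close>
  define V where "V = {l \<in> \<Lambda>. \<rho> / 2 * real (card H) \<le> real (card (H \<inter> G\<Lambda> l))}"
  have V: "V \<subseteq> \<Lambda>" "finite V" "V \<subseteq> K" using fin\<Lambda> \<Lambda> by (auto simp: V_def)
  have "(\<rho> * real (card \<Lambda>)) * real (card H) = (\<Sum>g\<in>H. \<rho> * real (card \<Lambda>))" by simp
  also have "\<dots> \<le> (\<Sum>g\<in>H. real (card {l \<in> \<Lambda>. g \<in> G\<Lambda> l}))"
    using popular by (intro sum_mono) (auto simp: H_def)
  also have "\<dots> = real (\<Sum>l\<in>\<Lambda>. card {g \<in> H. g \<in> G\<Lambda> l})"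
    using sum_card_swap[OF finH fin\<Lambda>, of "\<lambda>g l. g \<in> G\<Lambda> l"] by (simp flip: of_nat_sum)
  also have "\<dots> = (\<Sum>l\<in>\<Lambda>. real (card (H \<inter> G\<Lambda> l)))" by (simp add: Int_def)
  also have "\<dots> = (\<Sum>l\<in>V. real (card (H \<inter> G\<Lambda> l))) + (\<Sum>l\<in>\<Lambda> - V. real (card (H \<inter> G\<Lambda> l)))"
    using V fin\<Lambda> by (metis add.commute sum.subset_diff)
  also have "\<dots> \<le> (\<Sum>l\<in>V. real (card H)) + (\<Sum>l\<in>\<Lambda> - V. \<rho> / 2 * real (card H))"
    using finH by (intro add_mono sum_mono) (auto simp: V_def intro!: card_mono)
  also have "\<dots> \<le> real (card V) * real (card H) + real (card \<Lambda>) * (\<rho> / 2 * real (card H))"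
  proof -
    have "card (\<Lambda> - V) \<le> card \<Lambda>" using fin\<Lambda> by (intro card_mono) auto
    then have "real (card (\<Lambda> - V)) * (\<rho> / 2 * real (card H)) \<le> real (card \<Lambda>) * (\<rho> / 2 * real (card H))"
      using pos by (intro mult_right_mono) auto
    then show ?thesis by simp
  qed
  finally have "(\<rho> / 2 * real (card \<Lambda>)) * real (card H) \<le> real (card V) * real (card H)"
    by (simp add: algebra_simps)
  then have cV: "\<rho> / 2 * real (card \<Lambda>) \<le> real (card V)" using H0 by simp

  \<comment> \<open>At least \<rho> m |A1| / (8 M) points of \<open>H\<close> survive for each l in
    \<open>V\<close>, and a + l b takes at most m values on them, so some level set has
    \<open>y\<close> points.\<close>
  define y where "y = \<rho> * a1 / (8 * M)"
  have "\<exists>x. y \<le> real (card {g \<in> H \<inter> G\<Lambda> l. (\<lambda>(a, b). a + l * b) g = x})" if l: "l \<in> V" for l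
  proof -
    have ne: "real (card (H \<inter> G\<Lambda> l)) > 0"
    proof -
      have "0 < \<rho> / 2 * real (card H)" using pos H0 by simp
      also have "\<dots> \<le> real (card (H \<inter> G\<Lambda> l))" using l by (simp add: V_def)
      finally show ?thesis .
    qed
    have "finite (G\<Lambda> l)" using \<Lambda>(3) l V finG finite_subset by blast
    then have "card ((\<lambda>(a, b). a + l * b) ` (H \<inter> G\<Lambda> l)) \<le> card ((\<lambda>(a, b). a + l * b) ` G\<Lambda> l)"
      by (intro card_mono) auto
    then have "real (card ((\<lambda>(a, b). a + l * b) ` (H \<inter> G\<Lambda> l))) \<le> m"
      using small[of l] l V by force
    moreover have "H \<inter> G\<Lambda> l \<noteq> {}" using ne by auto
    ultimately obtain x where x: "real (card (H \<inter> G\<Lambda> l)) \<le> m * real (card {g \<in> H \<inter> G\<Lambda> l. (\<lambda>(a, b). a + l * b) g = x})"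
      using large_fiber_ex[of "H \<inter> G\<Lambda> l" "\<lambda>(a, b). a + l * b" m] finH by blast
    have "\<rho> / 2 * (m * a1 / (4 * M)) \<le> \<rho> / 2 * real (card H)"
      using cH M pos by (intro mult_left_mono) (auto simp: field_simps)
    also have "\<dots> \<le> real (card (H \<inter> G\<Lambda> l))" using l by (simp add: V_def)
    finally have "m * y \<le> real (card (H \<inter> G\<Lambda> l))" by (simp add: y_def algebra_simps)
    then have "m * y \<le> m * real (card {g \<in> H \<inter> G\<Lambda> l. (\<lambda>(a, b). a + l * b) g = x})" using x by linarith
    then show ?thesis using pos by (auto simp: mult_le_cancel_left_pos)
  qed
  then have ex: "\<exists>x. y \<le> real (card {g \<in> H \<inter> G\<Lambda> l. (\<lambda>(a, b). a + l * b) g = x})" if "l \<in> V" for l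
    using that .
  define x where "x l = (SOME x. y \<le> real (card {g \<in> H \<inter> G\<Lambda> l. (\<lambda>(a, b). a + l * b) g = x}))" for l
  have x: "y \<le> real (card {g \<in> H \<inter> G\<Lambda> l. (\<lambda>(a, b). a + l * b) g = x l})" if "l \<in> V" for l
    unfolding x_def by (rule someI_ex[OF ex[OF that]])
  define Y where "Y l = {g \<in> H \<inter> G\<Lambda> l. (\<lambda>(a, b). a + l * b) g = x l}" for l
  define Bs where "Bs l = snd ` Y l" for l
  have Ysub: "Y l \<subseteq> A0 \<times> B'" "Y l \<subseteq> G" "finite (Y l)" for l
    using finH finite_subset[of "Y l" H] by (auto simp: Y_def H_def)
  have Yeq: "a + l * b = x l" if "(a, b) \<in> Y l" for a b l using that by (auto simp: Y_def)
  have Yeq': "fst g + l * snd g = x l" if "g \<in> Y l" for g l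
    using that Yeq[of "fst g" "snd g" l] by simp
  have cBs: "card (Bs l) = card (Y l)" for l
    unfolding Bs_def
  proof (rule card_image, rule inj_onI)
    fix g h assume gh: "g \<in> Y l" "h \<in> Y l" "snd g = snd h"
    then have "fst g + l * snd g = fst h + l * snd h"
      using Yeq'[of g l] Yeq'[of h l] by simp
    then show "g = h" using gh by (simp add: prod_eq_iff)
  qed
  have cY: "y \<le> real (card (Y l))" if "l \<in> V" for l using x[OF that] by (simp add: Y_def)
  have injfst: "inj_on fst (Y l)" if l: "l \<in> V" for l
  proof (rule inj_onI)
    fix g h assume gh: "g \<in> Y l" "h \<in> Y l" "fst g = fst h"
    then have "fst h + l * snd g = fst h + l * snd h"
      using Yeq'[of g l] Yeq'[of h l] by simp
    then have "l * snd g = l * snd h" by simp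
    moreover have "snd g \<in> snd ` G" "snd h \<in> snd ` G" using gh Ysub(2) by blast+
    then have "snd g \<in> K" "snd h \<in> K" using A0K by blast+
    moreover have "l \<in> \<Lambda>" using l V(1) by blast
    then have "l \<in> K" "l \<noteq> 0" using \<Lambda> by blast+
    ultimately have "snd g = snd h" using mult_cancel_K by blast
    then show "g = h" using gh by (simp add: prod_eq_iff)
  qed
  have dil: "real (card (A0 + uminus ` ((*) l ` A0))) \<le> 2 ^ 30 * M ^ 10 / \<rho> ^ 3 * m" if l: "l \<in> V" for l
  proof (rule dilate_growth_estimate[OF _ bsg(10,8) _ bsg(4) \<tau>_def pos(1-3)])
    show "real (card (A0 + uminus ` ((*) l ` A0))) * real (card (Y l)) \<le> 2 * real (card (A0 + B')) * real (card D)"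
    proof (rule dilate_growth[where ?x0.0 = "x l"])
      fix z assume z: "z \<in> A0"
      have "card {y \<in> Y l. z - fst y \<notin> D} \<le> card {a \<in> A1. z - a \<notin> D}"
      proof (rule card_ge_of_inj[where h = fst])
        show "inj_on fst {y \<in> Y l. z - fst y \<notin> D}"
          using injfst[OF l] by (rule inj_on_subset) auto
        show "fst ` {y \<in> Y l. z - fst y \<notin> D} \<subseteq> {a \<in> A1. z - a \<notin> D}"
          using Ysub(1)[of l] bsg(1) by fastforce
      qed (use finA1 in auto)
      \<comment> \<open>The exceptional share of \<open>A1\<close> was arranged to be exactly y / 2,
        so at least half of the level set stays usable. Projecting to the first coordinate is
        injective there because l is nonzero.\<close>
      then have "2 * real (card {y \<in> Y l. z - fst y \<notin> D}) \<le> 2 * (\<rho> / (16 * M) * a1)"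
        using bsg(9)[OF z] unfolding a1_def by linarith
      also have "\<dots> = y" by (simp add: y_def)
      also have "\<dots> \<le> real (card (Y l))" by (rule cY[OF l])
      finally show "2 * real (card {y \<in> Y l. z - fst y \<notin> D}) \<le> real (card (Y l))" .
    qed (use finA1 bsg Ysub Yeq in auto)
    show "\<rho> * real (card A1) / (8 * M) \<le> real (card (Y l))" using cY[OF l] by (simp add: y_def a1_def)
  qed (use a1 in \<open>auto simp: a1_def\<close>)

  define Q where "Q = 2 ^ 231 * M ^ 73 / \<rho> ^ 20 * m"
  have Q0: "Q > 0" using pos by (simp add: Q_def)
  \<comment> \<open>Uniting the negated dilates for all l in \<open>L\<close> lets one summand
    \<open>X L\<close> serve in all six places; with four dilates this costs only a factor
    4.\<close>
  define X where "X L = (\<Union>l\<in>L. uminus ` ((*) l ` A0))" for L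
  have XI: "- (l * a) \<in> X L" if "l \<in> L" "a \<in> A0" for l a L using that by (auto simp: X_def)
  define U where "U L = A0 + (X L + X L + X L) + uminus ` (X L + X L + X L)" for L
  have UI: "a + (p1 + p2 + p3) - (n1 + n2 + n3) \<in> U L"
    if "a \<in> A0" "p1 \<in> X L" "p2 \<in> X L" "p3 \<in> X L" "n1 \<in> X L" "n2 \<in> X L" "n3 \<in> X L" for a p1 p2 p3 n1 n2 n3 L
  proof -
    have "- (n1 + n2 + n3) \<in> uminus ` (X L + X L + X L)"
      using that by (intro imageI set_plus_intro)
    then have "a + (p1 + p2 + p3) + - (n1 + n2 + n3) \<in> U L"
      unfolding U_def using that by (intro set_plus_intro)
    then show ?thesis by (simp only: diff_conv_add_uminus)
  qed
  have U: "finite (U L)" "real (card (U L)) \<le> Q" if L: "L \<subseteq> V" "card L \<le> 4" "finite L" for L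
  proof -
    have finX: "finite (X L)" using L finA1 by (auto simp: X_def)
    then show "finite (U L)" unfolding U_def using finA1 by (intro finite_set_plus finite_imageI)
    have "A0 + X L = (\<Union>l\<in>L. A0 + uminus ` ((*) l ` A0))"
      by (auto simp: X_def set_plus_def)
    then have "card (A0 + X L) \<le> (\<Sum>l\<in>L. card (A0 + uminus ` ((*) l ` A0)))"
      using card_UN_le[OF L(3)] by metis
    then have "real (card (A0 + X L)) \<le> (\<Sum>l\<in>L. real (card (A0 + uminus ` ((*) l ` A0))))"
      by (metis of_nat_le_iff of_nat_sum)
    also have "\<dots> \<le> (\<Sum>l\<in>L. 2 ^ 30 * M ^ 10 / \<rho> ^ 3 * m)"
      using dil L by (intro sum_mono) auto
    also have "\<dots> = real (card L) * (2 ^ 30 * M ^ 10 / \<rho> ^ 3 * m)" by simp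
    also have "\<dots> \<le> 4 * (2 ^ 30 * M ^ 10 / \<rho> ^ 3 * (8 * M * A))"
      using L A pos by (intro mult_mono mult_left_mono) auto
    also have "\<dots> = 2 ^ 35 * M ^ 11 / \<rho> ^ 3 * A" using power_add[of M 10 1] by simp
    finally have "real (card (U L)) \<le> (2 ^ 35 * M ^ 11 / \<rho> ^ 3) ^ 6 * real (card (A0 + uminus ` A0))"
      unfolding U_def A_def using finA1 A0ne finX by (intro petridis_sextuple) auto
    then show "real (card (U L)) \<le> Q"
      unfolding Q_def using a1 by (intro sextuple_estimate[OF _ bsg(11,4) \<tau>_def pos(1-3)]) (auto simp: a1_def)
  qed

  have m1: "m \<ge> 1"
  proof -
    have "card (fst ` G) > 0"
      using H0 finG unfolding H_def by (auto simp: card_gt_0_iff)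
    then show ?thesis using card by linarith
  qed
  show ?thesis
  proof (cases "card V \<le> 1")
    \<comment> \<open>With fewer than two elements \<open>V\<close> has no ratios, but then
      |\<Lambda>| <= 2 / \<rho>, and m >= 1 gives the second alternative.\<close>
    case True
    then have "real (card \<Lambda>) \<le> 2 / \<rho>" using cV pos by (simp add: field_simps)
    then have "(real (card \<Lambda>))\<^sup>2 \<le> (2 / \<rho>)\<^sup>2" by (intro power_mono) auto
    also have "\<dots> = 4 * 1 / \<rho>\<^sup>2 * 1" by (simp add: power_divide)
    also have "\<dots> \<le> 2 ^ 254 * M ^ 81 / \<rho> ^ 26 * m"
      using pos m1 by (intro mult_mono frac_le power_decreasing one_le_power) auto
    finally show ?thesis by simp
  next
    case False
    then have V2: "card V > 1" by simp
    then obtain s0 t0 where st0: "s0 \<in> V" "t0 \<in> V" "s0 \<noteq> t0"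
      by (metis One_nat_def card_le_Suc0_iff_eq V(2) not_le)
    from V(3) st0 show ?thesis
    proof (cases rule: ratio_dichotomy)
      \<comment> \<open>Here clearing the denominator of \<zeta> leaves (l5 - l6) t + (l3 - l4) b,
        only four dilates. The fixed \<open>a0\<close> fills the undilated place of
        \<open>U L\<close>, and adding and subtracting l3 t fills the two remaining ones.\<close>
      case all
      obtain a0 where a0: "a0 \<in> A0" using A0ne by blast
      have "A\<^sup>2 * (\<Sum>i\<in>K. A\<^sup>2) \<le> Q * (A * (\<Sum>i\<in>K. A) + A\<^sup>2 * A\<^sup>2)"
        unfolding A_def
      proof (rule energy_family_bound[where \<zeta> = "\<lambda>z. z"])
        fix \<zeta> assume \<zeta>: "\<zeta> \<in> K"
        obtain l3 l4 l5 l6 where l: "l3 \<in> V" "l4 \<in> V" "l5 \<in> V" "l6 \<in> V" "l5 \<noteq> l6" "l3 - l4 = \<zeta> * (l5 - l6)"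
          using all[OF \<zeta>] by blast
        define L where "L = {l3, l4, l5, l6}"
        have L: "L \<subseteq> V" "card L \<le> 4" "finite L"
          using l by (auto simp: L_def card_insert_if)
        define S where "S = (\<lambda>(t, b). t + \<zeta> * b) ` (A0 \<times> A0)"
        have SK: "S \<subseteq> K" using A0K \<zeta> by (auto simp: S_def intro!: add_K mult_K)
        have "card S \<le> card (U L)"
        proof (rule card_ge_of_inj[where h = "\<lambda>x. (l5 - l6) * x + a0"])
          show "finite (U L)" using U L by blast
          have "l5 - l6 \<in> K" "l5 - l6 \<noteq> 0" using l V(3) by (auto intro!: diff_K)
          note v = this
          show "inj_on (\<lambda>x. (l5 - l6) * x + a0) S"
          proof (rule inj_onI)
            fix u w assume uw: "u \<in> S" "w \<in> S" "(l5 - l6) * u + a0 = (l5 - l6) * w + a0"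
            then have "(l5 - l6) * u = (l5 - l6) * w" by (simp only: add_right_cancel)
            moreover have "u \<in> K" "w \<in> K" using uw SK by blast+
            ultimately show "u = w" using mult_cancel_K v by blast
          qed
          show "(\<lambda>x. (l5 - l6) * x + a0) ` S \<subseteq> U L"
          proof (rule image_subsetI)
            fix x assume "x \<in> S"
            then obtain t b where tb: "x = t + \<zeta> * b" "t \<in> A0" "b \<in> A0" by (auto simp: S_def)
            have "(l5 - l6) * x = (l5 - l6) * t + (\<zeta> * (l5 - l6)) * b"
              unfolding tb by (simp add: algebra_simps)
            also have "\<dots> = (l5 - l6) * t + (l3 - l4) * b" using l by simp
            finally have "(l5 - l6) * x + a0 = a0 + (- (l6 * t) + - (l4 * b) + - (l3 * t))
                - (- (l5 * t) + - (l3 * b) + - (l3 * t))"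
              by (simp add: algebra_simps)
            also have "\<dots> \<in> U L"
              using tb a0 by (intro UI XI) (auto simp: L_def)
            finally show "(l5 - l6) * x + a0 \<in> U L" .
          qed
        qed
        then show "real (card ((\<lambda>(t, b). t + \<zeta> * b) ` (A0 \<times> A0))) \<le> Q"
          using U(2)[OF L] unfolding S_def by linarith
      qed (use finite_K A0K Q0 in auto)
      then have "A\<^sup>2 * (A\<^sup>2 * real (card K)) \<le> A\<^sup>2 * (Q * (real (card K) + A\<^sup>2))"
        by (simp add: power2_eq_square algebra_simps)
      then have le: "A\<^sup>2 * real (card K) \<le> Q * (real (card K) + A\<^sup>2)"
        using A by (simp only: mult_le_cancel_left_pos zero_less_power)
      \<comment> \<open>One of the two summands on the right of \<open>le\<close> must be at least
        half of the left side.\<close>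
      have "A\<^sup>2 \<le> 2 * Q \<or> real (card K) \<le> 2 * Q"
      proof (rule ccontr)
        assume "\<not> ?thesis"
        then have 1: "2 * Q < A\<^sup>2" "2 * Q < real (card K)" by auto
        then have "2 * Q * real (card K) < A\<^sup>2 * real (card K)" "2 * Q * A\<^sup>2 < real (card K) * A\<^sup>2"
          using Q0 A by (intro mult_strict_right_mono; simp)+
        then show False using le by (simp add: algebra_simps)
      qed
      then show ?thesis
      proof
        assume "A\<^sup>2 \<le> 2 * Q"
        have "m * m \<le> (8 * M * A) * (8 * M * A)" using A pos by (intro mult_mono) auto
        also have "\<dots> = 64 * M\<^sup>2 * A\<^sup>2" by (simp add: power2_eq_square)
        also have "\<dots> \<le> 64 * M\<^sup>2 * (2 * Q)" using \<open>A\<^sup>2 \<le> 2 * Q\<close> by (intro mult_left_mono) auto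
        also have "\<dots> = (2 ^ 238 * M ^ 75 / \<rho> ^ 20) * m" by (simp add: Q_def flip: power_add)
        finally have "m \<le> 2 ^ 238 * M ^ 75 / \<rho> ^ 20" using pos(1) by (simp only: mult_le_cancel_right_pos)
        also have "\<dots> \<le> 2 ^ 245 * M ^ 78 / \<rho> ^ 22"
          using pos by (intro frac_le mult_mono power_increasing power_decreasing) auto
        finally show ?thesis by simp
      next
        assume "real (card K) \<le> 2 * Q"
        then show ?thesis by (simp add: Q_def)
      qed
    next
      case (inj l3 l4 l5 l6)
      define L where "L = {l3, l4, l5, l6}"
      have L: "L \<subseteq> V" "card L \<le> 4" "finite L"
        using inj by (auto simp: L_def card_insert_if)
      define B where "B = snd ` G"
      have finB: "finite B" using finG by (simp add: B_def)
      have BsB: "Bs l \<subseteq> B" for l using Ysub(2) by (auto simp: Bs_def B_def)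
      \<comment> \<open>For b in both \<open>Bs s\<close> and \<open>Bs t\<close> there are a, a' in
        \<open>A0\<close> with a + s b = x s and a' + t b = x t. Multiplying by l5 - l6 and by l3 -
        l4 + (l5 - l6) and adding expresses \<zeta> b by a constant and six dilates of
        \<open>A0\<close>, so \<open>A0 + \<zeta> B\<close> lies in a translate of
        \<open>U L\<close> when b is restricted to the intersection \<open>Bf\<close>.\<close>
      define \<zeta> where "\<zeta> = (\<lambda>(s, t). (l5 - l6) * s + (l3 - l4 + (l5 - l6)) * t)"
      define Bf where "Bf = (\<lambda>(s, t). Bs s \<inter> Bs t)"
      define W where "W = (\<Sum>i\<in>V \<times> V. real (card (Bf i)))"
      define v where "v = real (card V)"
      have v0: "v > 0" using V2 by (simp add: v_def)
      have "A\<^sup>2 * (\<Sum>i\<in>V \<times> V. (real (card (Bf i)))\<^sup>2) \<le> Q * (A * W + A\<^sup>2 * (real (card B))\<^sup>2)"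
        unfolding A_def W_def
      proof (rule energy_family_bound[where \<zeta> = \<zeta>])
        fix i assume i: "i \<in> V \<times> V"
        then obtain s t where st: "i = (s, t)" "s \<in> V" "t \<in> V" by blast
        show "\<zeta> i \<in> K"
          using st inj V by (auto simp: \<zeta>_def intro!: add_K mult_K diff_K)
        show "Bf i \<subseteq> B" using BsB by (auto simp: Bf_def st)
        define c0 where "c0 = (l5 - l6) * x s + (l3 - l4 + (l5 - l6)) * x t"
        have "card ((\<lambda>(t, b). t + \<zeta> i * b) ` (A0 \<times> Bf i)) \<le> card (U L)"
        proof (rule card_ge_of_inj[where h = "\<lambda>u. u - c0"])
          show "finite (U L)" using U L by blast
          show "inj_on (\<lambda>u. u - c0) ((\<lambda>(t, b). t + \<zeta> i * b) ` (A0 \<times> Bf i))" by (rule inj_onI) simp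
          show "(\<lambda>u. u - c0) ` (\<lambda>(t, b). t + \<zeta> i * b) ` (A0 \<times> Bf i) \<subseteq> U L"
          proof (clarify)
            fix u b assume ub: "u \<in> A0" "b \<in> Bf i"
            then obtain a a' where a: "(a, b) \<in> Y s" "(a', b) \<in> Y t"
              by (auto simp: Bf_def st Bs_def)
            then have aA: "a \<in> A0" "a' \<in> A0" using Ysub by blast+
            have c0': "c0 = (l5 - l6) * (a + s * b) + (l3 - l4 + (l5 - l6)) * (a' + t * b)"
              using Yeq[OF a(1)] Yeq[OF a(2)] by (simp add: c0_def)
            have "u + \<zeta> i * b - c0 = u + (- (l5 * a) + - (l5 * a') + - (l3 * a'))
                - (- (l6 * a) + - (l6 * a') + - (l4 * a'))"
              unfolding c0' \<zeta>_def st by (simp add: algebra_simps)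
            also have "\<dots> \<in> U L" using ub aA by (intro UI XI) (auto simp: L_def)
            finally show "u + \<zeta> i * b - c0 \<in> U L" .
          qed
        qed
        then show "real (card ((\<lambda>(t, b). t + \<zeta> i * b) ` (A0 \<times> Bf i))) \<le> Q"
          using U(2)[OF L] by linarith
      qed (use V inj A0K Q0 in \<open>auto simp: \<zeta>_def B_def\<close>)
      also have "\<dots> \<le> Q * (A * W + A\<^sup>2 * m\<^sup>2)"
        using card Q0 by (intro mult_left_mono add_left_mono power_mono) (auto simp: B_def)
      finally have en: "A\<^sup>2 * (\<Sum>i\<in>V \<times> V. (real (card (Bf i)))\<^sup>2) \<le> Q * (A * W + A\<^sup>2 * m\<^sup>2)" .
      have "W\<^sup>2 \<le> real (card (V \<times> V)) * (\<Sum>i\<in>V \<times> V. (real (card (Bf i)))\<^sup>2)"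
        unfolding W_def using V by (intro square_of_sum_le) auto
      then have W2: "W\<^sup>2 \<le> v\<^sup>2 * (\<Sum>i\<in>V \<times> V. (real (card (Bf i)))\<^sup>2)"
        by (simp add: card_cartesian_product v_def power2_eq_square)
      have "A\<^sup>2 * W\<^sup>2 \<le> A\<^sup>2 * (v\<^sup>2 * (\<Sum>i\<in>V \<times> V. (real (card (Bf i)))\<^sup>2))"
        using W2 by (intro mult_left_mono) auto
      also have "\<dots> = v\<^sup>2 * (A\<^sup>2 * (\<Sum>i\<in>V \<times> V. (real (card (Bf i)))\<^sup>2))" by simp
      also have "\<dots> \<le> v\<^sup>2 * (Q * (A * W + A\<^sup>2 * m\<^sup>2))" using en by (intro mult_left_mono) auto
      finally have main: "A\<^sup>2 * W\<^sup>2 \<le> v\<^sup>2 * (Q * (A * W + A\<^sup>2 * m\<^sup>2))" .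
      \<comment> \<open>The intersections are large on average: \<open>W\<close> is the second
        moment of the number \<open>n b\<close> of sets containing b, and the first moment is at
        least v y.\<close>
      define n where "n b = card {s \<in> V. b \<in> Bs s}" for b
      have "(\<Sum>i\<in>V \<times> V. card (Bf i)) = (\<Sum>i\<in>V \<times> V. card {b \<in> B. b \<in> Bf i})"
        using BsB by (intro sum.cong refl arg_cong[of _ _ card]) (auto simp: Bf_def)
      also have "\<dots> = (\<Sum>b\<in>B. card {i \<in> V \<times> V. b \<in> Bf i})"
        using V finB by (intro sum_card_swap) auto
      also have "\<dots> = (\<Sum>b\<in>B. (n b)\<^sup>2)"
      proof (rule sum.cong[OF refl])
        fix b
        have "{i \<in> V \<times> V. b \<in> Bf i} = {s \<in> V. b \<in> Bs s} \<times> {s \<in> V. b \<in> Bs s}" by (auto simp: Bf_def)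
        then show "card {i \<in> V \<times> V. b \<in> Bf i} = (n b)\<^sup>2"
          by (simp add: card_cartesian_product n_def power2_eq_square)
      qed
      finally have Wn: "W = (\<Sum>b\<in>B. (real (n b))\<^sup>2)"
        unfolding W_def by (simp flip: of_nat_sum of_nat_power)
      have "(\<Sum>s\<in>V. card (Bs s)) = (\<Sum>s\<in>V. card {b \<in> B. b \<in> Bs s})"
        using BsB by (intro sum.cong refl arg_cong[of _ _ card]) auto
      also have "\<dots> = (\<Sum>b\<in>B. n b)" unfolding n_def
        using V finB by (intro sum_card_swap) auto
      finally have "(\<Sum>b\<in>B. real (n b)) = (\<Sum>s\<in>V. real (card (Bs s)))"
        by (simp flip: of_nat_sum)
      also have "\<dots> \<ge> (\<Sum>s\<in>V. y)" using cY by (intro sum_mono) (simp add: cBs)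
      finally have vy: "v * y \<le> (\<Sum>b\<in>B. real (n b))" by (simp add: v_def)
      \<comment> \<open>Since m <= 4 M |A1|, this \<beta> satisfies \<beta> m <= y.\<close>
      define \<beta> where "\<beta> = \<rho> / (32 * M\<^sup>2)"
      have \<beta>0: "\<beta> > 0" using pos M by (simp add: \<beta>_def)
      have "\<beta> * m \<le> \<beta> * (4 * M * a1)" using bsg(4) \<beta>0 by (intro mult_left_mono) (auto simp: a1_def)
      also have "\<dots> = y" using M by (simp add: \<beta>_def y_def power2_eq_square)
      finally have "v * (\<beta> * m) \<le> v * y" using v0 by (intro mult_left_mono) auto
      then have "(v * (\<beta> * m))\<^sup>2 \<le> (\<Sum>b\<in>B. real (n b))\<^sup>2"
        using vy v0 \<beta>0 pos by (intro power_mono order_trans[OF _ vy]) auto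
      also have "\<dots> \<le> m * W" unfolding Wn using finB card by (intro square_of_sum_le) (auto simp: B_def)
      finally have "m * (v\<^sup>2 * \<beta>\<^sup>2 * m) \<le> m * W" by (simp add: power2_eq_square algebra_simps)
      then have W: "v\<^sup>2 * \<beta>\<^sup>2 * m \<le> W" using pos mult_le_cancel_left_pos by blast
      have W0: "W > 0"
        using v0 \<beta>0 pos by (intro less_le_trans[OF _ W]) auto
      \<comment> \<open>Again one of the two summands in \<open>main\<close> is at least half:
        either the diagonal collisions or the nontrivial ones dominate.\<close>
      have "A * W \<le> 2 * Q * v\<^sup>2 \<or> W\<^sup>2 \<le> 2 * Q * v\<^sup>2 * m\<^sup>2"
      proof (rule ccontr)
        assume "\<not> ?thesis"
        then have 1: "2 * Q * v\<^sup>2 < A * W" "2 * Q * v\<^sup>2 * m\<^sup>2 < W\<^sup>2" by auto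
        then have "(2 * Q * v\<^sup>2) * (A * W) < (A * W) * (A * W)" "A\<^sup>2 * (2 * Q * v\<^sup>2 * m\<^sup>2) < A\<^sup>2 * W\<^sup>2"
          using W0 A by (intro mult_strict_right_mono mult_strict_left_mono; simp)+
        then show False using main by (simp add: power2_eq_square algebra_simps)
      qed
      then show ?thesis
      proof
        assume "A * W \<le> 2 * Q * v\<^sup>2"
        then have "A * (v\<^sup>2 * \<beta>\<^sup>2 * m) \<le> 2 * Q * v\<^sup>2"
          using mult_left_mono[OF W less_imp_le[OF A(2)]] by linarith
        then have "v\<^sup>2 * (A * \<beta>\<^sup>2 * m) \<le> v\<^sup>2 * (2 * Q)" by (simp only: ac_simps)
        then have "A * \<beta>\<^sup>2 * m \<le> 2 * Q" using v0 by simp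
        then have "8 * M * (A * \<beta>\<^sup>2 * m) \<le> 8 * M * (2 * Q)" using M by (intro mult_left_mono) auto
        moreover have "m * (\<beta>\<^sup>2 * m) \<le> (8 * M * A) * (\<beta>\<^sup>2 * m)"
          using A pos by (intro mult_right_mono) auto
        ultimately have "(m * \<beta>\<^sup>2) * m \<le> (16 * M * (2 ^ 231 * M ^ 73 / \<rho> ^ 20)) * m"
          by (simp add: algebra_simps Q_def)
        then have "m * \<beta>\<^sup>2 \<le> 16 * M * (2 ^ 231 * M ^ 73 / \<rho> ^ 20)"
          using pos mult_le_cancel_right_pos by blast
        then have "(m * \<beta>\<^sup>2) * (32 * M\<^sup>2 / \<rho>)\<^sup>2 \<le> (16 * M * (2 ^ 231 * M ^ 73 / \<rho> ^ 20)) * (32 * M\<^sup>2 / \<rho>)\<^sup>2"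
          by (rule mult_right_mono) simp
        also have "(m * \<beta>\<^sup>2) * (32 * M\<^sup>2 / \<rho>)\<^sup>2 = m"
          using pos M by (simp add: \<beta>_def power_divide power_mult_distrib)
        also have "(16 * M * (2 ^ 231 * M ^ 73 / \<rho> ^ 20)) * (32 * M\<^sup>2 / \<rho>)\<^sup>2 = 2 ^ 245 * M ^ 78 / \<rho> ^ 22"
          by (simp add: power_divide power_mult_distrib flip: power_mult power_add power_Suc)
        finally show ?thesis by simp
      next
        assume "W\<^sup>2 \<le> 2 * Q * v\<^sup>2 * m\<^sup>2"
        moreover have "(v\<^sup>2 * \<beta>\<^sup>2 * m)\<^sup>2 \<le> W\<^sup>2" using W v0 \<beta>0 pos by (intro power_mono) auto
        ultimately have "(v\<^sup>2 * m\<^sup>2) * (v\<^sup>2 * \<beta> ^ 4) \<le> (v\<^sup>2 * m\<^sup>2) * (2 * Q)"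
          by (simp add: power2_eq_square power4_eq_xxxx algebra_simps)
        then have 1: "v\<^sup>2 * \<beta> ^ 4 \<le> 2 * Q" using v0 pos by simp
        have "(\<rho> / 2 * real (card \<Lambda>))\<^sup>2 \<le> v\<^sup>2" using cV pos by (intro power_mono) (auto simp: v_def)
        then have "(\<rho> / 2 * real (card \<Lambda>))\<^sup>2 * \<beta> ^ 4 \<le> v\<^sup>2 * \<beta> ^ 4" by (intro mult_right_mono) auto
        then have "(real (card \<Lambda>))\<^sup>2 * ((\<rho> / 2)\<^sup>2 * \<beta> ^ 4) \<le> 2 * Q"
          using 1 unfolding power_mult_distrib by (simp only: mult.assoc mult.commute mult.left_commute)
        then have "(real (card \<Lambda>))\<^sup>2 * ((\<rho> / 2)\<^sup>2 * \<beta> ^ 4) * (4 * 2 ^ 20 * M ^ 8 / \<rho> ^ 6) \<le> 2 * Q * (4 * 2 ^ 20 * M ^ 8 / \<rho> ^ 6)"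
          using pos by (intro mult_right_mono) auto
        also have "(real (card \<Lambda>))\<^sup>2 * ((\<rho> / 2)\<^sup>2 * \<beta> ^ 4) * (4 * 2 ^ 20 * M ^ 8 / \<rho> ^ 6) = (real (card \<Lambda>))\<^sup>2"
          using pos M by (simp add: \<beta>_def power_divide power_mult_distrib flip: power_mult power_add)
        also have "2 * Q * (4 * 2 ^ 20 * M ^ 8 / \<rho> ^ 6) = 2 ^ 254 * M ^ 81 / \<rho> ^ 26 * m"
          by (simp add: Q_def flip: power_add)
        finally show ?thesis by simp
      qed
    qed
  qed
qed

end

section \<open>Selecting a rich line\<close>

text \<open>Up to repetitions, \<open>w q\<close> counts the points joined to q by rich lines.
  Summing \<open>w q\<close> over all incidences with rich lines gives the sum of
  \<open>dg q * w q\<close>, a second moment, and averaging over the rich lines finds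
  \<open>l0\<close>. The second half of \<open>D\<close> absorbs the repetitions: \<open>l0\<close>
  itself has at most 2N / D points, and q is counted once per line, at most 2D times. This turns the
  constant 8 into 16.\<close>

lemma rich_line_ex:
  fixes P :: "'p set" and L :: "'p set set" and N D I :: real
  assumes fin: "finite P" "finite L"
    and linear: "\<And>x y l l'. x \<in> P \<Longrightarrow> y \<in> P \<Longrightarrow> x \<noteq> y \<Longrightarrow> l \<in> L \<Longrightarrow> l' \<in> L \<Longrightarrow>
      x \<in> l \<Longrightarrow> y \<in> l \<Longrightarrow> x \<in> l' \<Longrightarrow> y \<in> l' \<Longrightarrow> l = l'"
    and L: "real (card L) \<le> N"
    and deg: "\<And>q. q \<in> P \<Longrightarrow> D \<le> real (card {l \<in> L. q \<in> l})"
      "\<And>q. q \<in> P \<Longrightarrow> real (card {l \<in> L. q \<in> l}) \<le> 2 * D"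
    and I: "I = (\<Sum>q\<in>P. real (card {l \<in> L. q \<in> l}))" "I > 0"
    and D: "2 \<le> D" "2 * N / D + 2 * D \<le> I * D / (16 * N)"
  obtains l0 where "l0 \<in> L" "I \<le> 2 * N * real (card (l0 \<inter> P))"
    "I * D / (16 * N) * real (card (l0 \<inter> P))
       \<le> (\<Sum>p\<in>P - l0. real (card {q \<in> l0 \<inter> P. \<exists>l\<in>L. q \<in> l \<and> p \<in> l}))"
proof -
  define c where "c l = real (card (l \<inter> P))" for l
  \<comment> \<open>Lines with fewer than half of the average number of points lose at most half of
    the incidences.\<close>
  define L' where "L' = {l \<in> L. I \<le> 2 * N * c l}"
  define dg where "dg q = real (card {l \<in> L'. q \<in> l})" for q
  define w where "w q = (\<Sum>l\<in>{l \<in> L'. q \<in> l}. c l)" for q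
  have finL': "finite L'" "L' \<subseteq> L" using fin by (auto simp: L'_def)
  have inP: "card {q \<in> P. q \<in> l} = card (l \<inter> P)" for l
    by (rule arg_cong[of _ _ card]) auto
  have swap: "(\<Sum>q\<in>P. real (card {l \<in> X. q \<in> l})) = (\<Sum>l\<in>X. c l)" if "finite X" for X
  proof -
    have "(\<Sum>q\<in>P. card {l \<in> X. q \<in> l}) = (\<Sum>l\<in>X. card {q \<in> P. q \<in> l})"
      using fin that by (intro sum_card_swap)
    then show ?thesis by (simp add: c_def inP flip: of_nat_sum)
  qed
  have L0: "L \<noteq> {}" using I by auto
  then have N: "N > 0" using L fin by (meson card_gt_0_iff less_le_trans of_nat_0_less_iff)
  have cL: "(\<Sum>l\<in>L. c l) = I" using swap[OF fin(2)] I by simp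
  have "(\<Sum>l\<in>L. c l) = (\<Sum>l\<in>L'. c l) + (\<Sum>l\<in>L - L'. c l)"
    using fin finL' by (metis add.commute sum.subset_diff)
  also have "(\<Sum>l\<in>L - L'. c l) \<le> (\<Sum>l\<in>L - L'. I / (2 * N))"
    using N by (intro sum_mono) (auto simp: L'_def field_simps)
  also have "\<dots> \<le> N * (I / (2 * N))"
  proof -
    have "card (L - L') \<le> card L" using fin by (intro card_mono) auto
    then have "real (card (L - L')) * (I / (2 * N)) \<le> N * (I / (2 * N))"
      using L I N by (intro mult_right_mono) auto
    then show ?thesis by simp
  qed
  finally have cL': "I / 2 \<le> (\<Sum>l\<in>L'. c l)" using cL N by simp
  have cP: "real (card P) * D \<le> I"
  proof -
    have "(\<Sum>q\<in>P. D) \<le> I" unfolding I using deg by (intro sum_mono)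
    then show ?thesis by simp
  qed
  \<comment> \<open>Cauchy-Schwarz over the points; as each has degree at least \<open>D\<close>,
    there are at most I / D of them.\<close>
  have "(I / 2)\<^sup>2 \<le> (\<Sum>q\<in>P. dg q)\<^sup>2"
    using cL' swap[OF finL'(1)] I by (intro power_mono) (auto simp: dg_def)
  also have "\<dots> \<le> real (card P) * (\<Sum>q\<in>P. (dg q)\<^sup>2)" using fin by (intro square_of_sum_le) auto
  finally have "D * (I / 2)\<^sup>2 \<le> D * (real (card P) * (\<Sum>q\<in>P. (dg q)\<^sup>2))"
    using D by (intro mult_left_mono) auto
  also have "\<dots> = (real (card P) * D) * (\<Sum>q\<in>P. (dg q)\<^sup>2)" by simp
  also have "\<dots> \<le> I * (\<Sum>q\<in>P. (dg q)\<^sup>2)" using cP by (intro mult_right_mono sum_nonneg) auto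
  finally have "I * (D * I / 4) \<le> I * (\<Sum>q\<in>P. (dg q)\<^sup>2)" by (simp add: power2_eq_square algebra_simps)
  then have dg2: "D * I / 4 \<le> (\<Sum>q\<in>P. (dg q)\<^sup>2)" using I(2) mult_le_cancel_left_pos by blast
  have wdg: "dg q * (I / (2 * N)) \<le> w q" for q
  proof -
    have "(\<Sum>l\<in>{l \<in> L'. q \<in> l}. I / (2 * N)) \<le> w q"
      unfolding w_def using N by (intro sum_mono) (auto simp: L'_def field_simps)
    then show ?thesis by (simp add: dg_def)
  qed
  have "(\<Sum>l\<in>L'. \<Sum>q\<in>l \<inter> P. w q) = (\<Sum>l\<in>L'. \<Sum>q\<in>P. if q \<in> l then w q else 0)"
  proof (rule sum.cong[OF refl])
    fix l
    have "l \<inter> P = {q \<in> P. q \<in> l}" by auto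
    then show "(\<Sum>q\<in>l \<inter> P. w q) = (\<Sum>q\<in>P. if q \<in> l then w q else 0)"
      using fin by (simp add: sum.inter_filter)
  qed
  also have "\<dots> = (\<Sum>q\<in>P. \<Sum>l\<in>L'. if q \<in> l then w q else 0)" by (rule sum.swap)
  also have "\<dots> = (\<Sum>q\<in>P. dg q * w q)"
    using finL' by (simp add: sum.inter_filter[symmetric] dg_def)
  also have "\<dots> \<ge> (\<Sum>q\<in>P. (dg q)\<^sup>2 * (I / (2 * N)))"
  proof (rule sum_mono)
    fix q
    have "dg q * (dg q * (I / (2 * N))) \<le> dg q * w q" using wdg by (intro mult_left_mono) (auto simp: dg_def)
    then show "(dg q)\<^sup>2 * (I / (2 * N)) \<le> dg q * w q" by (simp add: power2_eq_square)
  qed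
  finally have "(\<Sum>q\<in>P. (dg q)\<^sup>2) * (I / (2 * N)) \<le> (\<Sum>l\<in>L'. \<Sum>q\<in>l \<inter> P. w q)"
    by (simp only: sum_distrib_right)
  moreover have "D * I / 4 * (I / (2 * N)) \<le> (\<Sum>q\<in>P. (dg q)\<^sup>2) * (I / (2 * N))"
    using dg2 I N by (intro mult_right_mono) auto
  moreover have "I * D / (8 * N) * I = D * I / 4 * (I / (2 * N))" by simp
  ultimately have tot: "I * D / (8 * N) * I \<le> (\<Sum>l\<in>L'. \<Sum>q\<in>l \<inter> P. w q)" by linarith
  have "\<exists>l0\<in>L'. I * D / (8 * N) * c l0 \<le> (\<Sum>q\<in>l0 \<inter> P. w q)"
  proof (rule ccontr)
    assume "\<not> ?thesis"
    then have "(\<Sum>q\<in>l0 \<inter> P. w q) < I * D / (8 * N) * c l0" if "l0 \<in> L'" for l0 using that by force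
    moreover have "L' \<noteq> {}" using cL' I by auto
    ultimately have "(\<Sum>l\<in>L'. \<Sum>q\<in>l \<inter> P. w q) < (\<Sum>l\<in>L'. I * D / (8 * N) * c l)"
      using finL' by (intro sum_strict_mono)
    also have "\<dots> = I * D / (8 * N) * (\<Sum>l\<in>L'. c l)" by (simp add: sum_distrib_left)
    also have "\<dots> \<le> I * D / (8 * N) * I"
    proof (rule mult_left_mono)
      have "(\<Sum>l\<in>L'. c l) \<le> (\<Sum>l\<in>L. c l)" using fin finL' by (intro sum_mono2) (auto simp: c_def)
      then show "(\<Sum>l\<in>L'. c l) \<le> I" using cL by simp
    qed (use I D N in auto)
    finally show False using tot by simp
  qed
  then obtain l0 where l0: "l0 \<in> L'" "I * D / (8 * N) * c l0 \<le> (\<Sum>q\<in>l0 \<inter> P. w q)" by blast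
  have l0L: "l0 \<in> L" using l0 finL' by blast
  define S where "S = l0 \<inter> P"
  have finS: "finite S" using fin by (simp add: S_def)

  \<comment> \<open>Each point of \<open>l0\<close> has at least D - 1 further lines, and these are
    distinct for distinct points, since two common points force a line to be
    \<open>l0\<close>.\<close>
  have "c l0 * (D - 1) \<le> N"
  proof -
    define F where "F q = {l \<in> L. q \<in> l} - {l0}" for q
    have finF: "finite (F q)" for q using fin by (simp add: F_def)
    have "(\<Sum>q\<in>S. D - 1) \<le> (\<Sum>q\<in>S. real (card (F q)))"
    proof (rule sum_mono)
      fix q assume q: "q \<in> S"
      then have "card {l \<in> L. q \<in> l} = Suc (card (F q))"
        unfolding F_def using fin l0L by (intro card.remove) (auto simp: S_def)
      then show "D - 1 \<le> real (card (F q))" using deg(1)[of q] q by (simp add: S_def)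
    qed
    also have "\<dots> = real (card (\<Union>q\<in>S. F q))"
    proof -
      have "card (\<Union>q\<in>S. F q) = (\<Sum>q\<in>S. card (F q))"
        using finS finF
      proof (intro card_UN_disjoint ballI impI)
        fix i j assume ij: "i \<in> S" "j \<in> S" "i \<noteq> j"
        show "F i \<inter> F j = {}"
        proof (rule equals0I)
          fix l assume l: "l \<in> F i \<inter> F j"
          then have "l = l0" using ij l0L by (intro linear[of i j]) (auto simp: F_def S_def)
          then show False using l by (auto simp: F_def)
        qed
      qed auto
      then show ?thesis by simp
    qed
    also have "\<dots> \<le> real (card L)"
      using fin by (intro of_nat_mono card_mono) (auto simp: F_def)
    finally show ?thesis using L by (simp add: c_def S_def algebra_simps)
  qed
  moreover have "c l0 * (D / 2) \<le> c l0 * (D - 1)" using D by (intro mult_left_mono) (auto simp: c_def)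
  ultimately have cl0: "c l0 \<le> 2 * N / D" using D by (simp add: field_simps)

  \<comment> \<open>Removing \<open>l0\<close> costs \<open>c l0\<close>. On each other line through
    q only q lies on \<open>l0\<close>, which costs 1 per line, and these lines are disjoint away
    from q.\<close>
  have each: "w q - c l0 - 2 * D \<le> real (card {p \<in> P - l0. \<exists>l\<in>L. q \<in> l \<and> p \<in> l})" if q: "q \<in> S" for q
  proof -
    define X where "X = {l \<in> L'. q \<in> l} - {l0}"
    have finX: "finite X" using finL' by (simp add: X_def)
    have "w q \<le> c l0 + (\<Sum>l\<in>X. c l)"
    proof -
      have "w q = c l0 + (\<Sum>l\<in>X. c l)"
        unfolding w_def X_def using finL' l0 q by (intro sum.remove) (auto simp: S_def)
      then show ?thesis by simp
    qed
    also have "(\<Sum>l\<in>X. c l) = (\<Sum>l\<in>X. real (card (l \<inter> P - l0)) + 1)"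
    proof (rule sum.cong[OF refl])
      fix l assume l: "l \<in> X"
      have "l \<inter> P - l0 = l \<inter> P - {q}"
      proof -
        have "r = q" if "r \<in> l" "r \<in> P" "r \<in> l0" for r
        proof (rule ccontr)
          assume "r \<noteq> q"
          then have "l = l0" using that l q l0L finL' by (intro linear[of r q]) (auto simp: X_def S_def)
          then show False using l by (simp add: X_def)
        qed
        then show ?thesis using q l by (auto simp: S_def X_def)
      qed
      moreover have "card (l \<inter> P) = Suc (card (l \<inter> P - {q}))"
        using fin q l by (intro card.remove) (auto simp: X_def S_def)
      ultimately show "c l = real (card (l \<inter> P - l0)) + 1" by (simp add: c_def)
    qed
    also have "\<dots> = (\<Sum>l\<in>X. real (card (l \<inter> P - l0))) + real (card X)" by (simp add: sum.distrib)
    also have "card X \<le> card {l \<in> L. q \<in> l}"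
      using fin finL' by (intro card_mono) (auto simp: X_def)
    also have "real (card {l \<in> L. q \<in> l}) \<le> 2 * D" using deg(2) q by (simp add: S_def)
    also have "(\<Sum>l\<in>X. real (card (l \<inter> P - l0))) = real (card (\<Union>l\<in>X. l \<inter> P - l0))"
    proof -
      have "card (\<Union>l\<in>X. l \<inter> P - l0) = (\<Sum>l\<in>X. card (l \<inter> P - l0))"
        using finX fin
      proof (intro card_UN_disjoint ballI impI)
        fix l l' assume ll: "l \<in> X" "l' \<in> X" "l \<noteq> l'"
        show "(l \<inter> P - l0) \<inter> (l' \<inter> P - l0) = {}"
        proof (rule equals0I)
          fix r assume r: "r \<in> (l \<inter> P - l0) \<inter> (l' \<inter> P - l0)"
          then have "l = l'" using ll q finL' by (intro linear[of r q]) (auto simp: X_def S_def)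
          then show False using ll by simp
        qed
      qed auto
      then show ?thesis by simp
    qed
    also have "card (\<Union>l\<in>X. l \<inter> P - l0) \<le> card {p \<in> P - l0. \<exists>l\<in>L. q \<in> l \<and> p \<in> l}"
      using fin finL' by (intro card_mono) (auto simp: X_def)
    finally show ?thesis by simp
  qed
  have "I * D / (16 * N) * c l0 \<le> (\<Sum>q\<in>S. w q - c l0 - 2 * D)"
  proof -
    have "(c l0 + 2 * D) * c l0 \<le> (I * D / (16 * N)) * c l0"
      using cl0 D by (intro mult_right_mono) (auto simp: c_def)
    moreover have "(\<Sum>q\<in>S. w q - c l0 - 2 * D) = (\<Sum>q\<in>S. w q) - (c l0 + 2 * D) * c l0"
      by (simp add: sum_subtractf c_def S_def algebra_simps)
    ultimately show ?thesis using l0(2) by (simp add: S_def)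
  qed
  also have "\<dots> \<le> (\<Sum>q\<in>S. real (card {p \<in> P - l0. \<exists>l\<in>L. q \<in> l \<and> p \<in> l}))"
    using each by (intro sum_mono)
  also have "\<dots> = (\<Sum>p\<in>P - l0. real (card {q \<in> S. \<exists>l\<in>L. q \<in> l \<and> p \<in> l}))"
    using sum_card_swap[OF finS, of "P - l0" "\<lambda>q p. \<exists>l\<in>L. q \<in> l \<and> p \<in> l"] fin
    by (simp flip: of_nat_sum)
  finally show thesis
    using that[of l0] l0 l0L by (simp add: S_def c_def L'_def)
qed

text \<open>Pigeonhole over triples of distinct elements of \<open>S\<close>: a point p related to x
  elements contributes nearly x^3 triples. Three such elements become the two axes and the direction
  of the sum. Restricting to popular p first keeps a lower bound on the degree of every selected
  point.\<close>

lemma popular_triple_ex: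
  fixes S :: "'s set" and Q :: "'p set" and \<rho> n :: real
  assumes fin: "finite S" "finite Q" and n: "real (card Q) \<le> n" "0 < n" and \<rho>: "0 < \<rho>" "4 \<le> \<rho> * real (card S)"
    and sum: "2 * \<rho> * real (card S) * n \<le> (\<Sum>p\<in>Q. real (card {q \<in> S. R p q}))"
  obtains q1 q2 q3 where "q1 \<in> S" "q2 \<in> S" "q3 \<in> S" "q1 \<noteq> q2" "q1 \<noteq> q3" "q2 \<noteq> q3"
    "\<rho> ^ 3 * n / 4 \<le> real (card {p \<in> Q. R p q1 \<and> R p q2 \<and> R p q3 \<and> \<rho> * real (card S) \<le> real (card {q \<in> S. R p q})})"
proof -
  define t where "t = \<rho> * real (card S)"
  define X where "X p = {q \<in> S. R p q}" for p
  define x where "x p = real (card (X p))" for p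
  define Q' where "Q' = {p \<in> Q. t \<le> x p}"
  have finQ': "finite Q'" "Q' \<subseteq> Q" using fin by (auto simp: Q'_def)
  have finX: "finite (X p)" for p using fin by (simp add: X_def)
  have t: "t \<ge> 4" using \<rho> by (simp add: t_def)
  have "2 * t * n \<le> (\<Sum>p\<in>Q. x p)" using sum by (simp add: t_def x_def X_def)
  also have "\<dots> = (\<Sum>p\<in>Q'. x p) + (\<Sum>p\<in>Q - Q'. x p)"
    using fin finQ' by (metis add.commute sum.subset_diff)
  also have "(\<Sum>p\<in>Q - Q'. x p) \<le> (\<Sum>p\<in>Q - Q'. t)" by (intro sum_mono) (auto simp: Q'_def)
  also have "\<dots> = real (card (Q - Q')) * t" by simp
  also have "\<dots> \<le> n * t"
  proof (rule mult_right_mono)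
    have "card (Q - Q') \<le> card Q" using fin by (intro card_mono) auto
    then show "real (card (Q - Q')) \<le> n" using n by linarith
  qed (use t in simp)
  finally have sx: "t * n \<le> (\<Sum>p\<in>Q'. x p)" by (simp add: algebra_simps)
  have cQ': "real (card Q') \<le> n" using finQ' fin n by (meson card_mono of_nat_mono order_trans)
  \<comment> \<open>The tangent to the cube at t replaces the power mean inequality; the difference
    is (x - t)^2 (x + 2t).\<close>
  have cube: "3 * t\<^sup>2 * x p - 2 * t ^ 3 \<le> x p ^ 3" for p
  proof -
    have "0 \<le> (x p - t)\<^sup>2 * (x p + 2 * t)" using t by (simp add: x_def)
    then show ?thesis by (simp add: power2_eq_square power3_eq_cube algebra_simps)
  qed
  have "t ^ 3 * n \<le> 3 * t\<^sup>2 * (t * n) - 2 * t ^ 3 * n" by (simp add: power2_eq_square power3_eq_cube)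
  also have "\<dots> \<le> 3 * t\<^sup>2 * (\<Sum>p\<in>Q'. x p) - 2 * t ^ 3 * real (card Q')"
    using sx cQ' t by (intro diff_mono mult_left_mono) auto
  also have "\<dots> = (\<Sum>p\<in>Q'. 3 * t\<^sup>2 * x p - 2 * t ^ 3)"
    by (simp add: sum_subtractf sum_distrib_left)
  also have "\<dots> \<le> (\<Sum>p\<in>Q'. x p ^ 3)" using cube by (intro sum_mono)
  finally have s3: "t ^ 3 * n \<le> (\<Sum>p\<in>Q'. x p ^ 3)" .
  define Tr where "Tr = {(q1, q2, q3) \<in> S \<times> S \<times> S. q1 \<noteq> q2 \<and> q1 \<noteq> q3 \<and> q2 \<noteq> q3}"
  define RR where "RR p = (\<lambda>(q1, q2, q3). R p q1 \<and> R p q2 \<and> R p q3)" for p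
  have finTr: "finite Tr" by (rule finite_subset[of _ "S \<times> S \<times> S"]) (use fin in \<open>auto simp: Tr_def\<close>)
  have triples: "x p ^ 3 / 4 \<le> real (card {z \<in> Tr. RR p z})" if p: "p \<in> Q'" for p
  proof -
    have x4: "4 \<le> x p" using p t by (simp add: Q'_def)
    \<comment> \<open>Triples with a coincidence number at most 3 x^2, and x >= 4 leaves a quarter
      of all triples.\<close>
    define F1 where "F1 = (\<lambda>(a, b). (a, a, b)) ` (X p \<times> X p)"
    define F2 where "F2 = (\<lambda>(a, b). (a, b, a)) ` (X p \<times> X p)"
    define F3 where "F3 = (\<lambda>(a, b). (b, a, a)) ` (X p \<times> X p)"
    have cF: "card F1 \<le> card (X p) * card (X p)" "card F2 \<le> card (X p) * card (X p)" "card F3 \<le> card (X p) * card (X p)"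
      unfolding F1_def F2_def F3_def card_cartesian_product[symmetric]
      using finX by (intro card_image_le; simp)+
    have finF: "finite F1" "finite F2" "finite F3" using finX by (auto simp: F1_def F2_def F3_def)
    have "X p \<times> X p \<times> X p \<subseteq> {z \<in> Tr. RR p z} \<union> (F1 \<union> (F2 \<union> F3))"
      by (auto simp: Tr_def RR_def F1_def F2_def F3_def X_def image_iff)
    then have "card (X p \<times> X p \<times> X p) \<le> card ({z \<in> Tr. RR p z} \<union> (F1 \<union> (F2 \<union> F3)))"
      using finTr finF by (intro card_mono) auto
    also have "\<dots> \<le> card {z \<in> Tr. RR p z} + (card F1 + (card F2 + card F3))"
      by (intro order_trans[OF card_Un_le] add_mono order.refl)
    finally have "card (X p) * (card (X p) * card (X p)) \<le> card {z \<in> Tr. RR p z} + 3 * (card (X p) * card (X p))"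
      using cF by (simp add: card_cartesian_product)
    then have "x p * (x p * x p) \<le> real (card {z \<in> Tr. RR p z}) + 3 * (x p * x p)"
      unfolding x_def of_nat_mult[symmetric] by linarith
    moreover have "4 * (x p * x p) \<le> x p * (x p * x p)" using x4 by (intro mult_right_mono) auto
    ultimately show ?thesis by (simp add: power3_eq_cube)
  qed
  have "t ^ 3 * n / 4 \<le> (\<Sum>p\<in>Q'. x p ^ 3 / 4)" using s3 by (simp add: sum_divide_distrib[symmetric])
  also have "\<dots> \<le> (\<Sum>p\<in>Q'. real (card {z \<in> Tr. RR p z}))" using triples by (intro sum_mono)
  also have "\<dots> = (\<Sum>z\<in>Tr. real (card {p \<in> Q'. RR p z}))"
    using sum_card_swap[OF finQ'(1) finTr, of RR] by (simp flip: of_nat_sum)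
  finally have tot: "t ^ 3 * n / 4 \<le> (\<Sum>z\<in>Tr. real (card {p \<in> Q'. RR p z}))" .
  have "\<exists>z\<in>Tr. \<rho> ^ 3 * n / 4 \<le> real (card {p \<in> Q'. RR p z})"
  proof (rule ccontr)
    assume "\<not> ?thesis"
    then have "real (card {p \<in> Q'. RR p z}) < \<rho> ^ 3 * n / 4" if "z \<in> Tr" for z using that by force
    moreover have "Tr \<noteq> {}"
    proof
      assume "Tr = {}"
      then have "t ^ 3 * n / 4 \<le> 0" using tot by simp
      moreover have "t ^ 3 * n > 0" using t n by simp
      ultimately show False by simp
    qed
    ultimately have "(\<Sum>z\<in>Tr. real (card {p \<in> Q'. RR p z})) < (\<Sum>z\<in>Tr. \<rho> ^ 3 * n / 4)"
      using finTr by (intro sum_strict_mono)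
    also have "\<dots> = real (card Tr) * (\<rho> ^ 3 * n / 4)" by simp
    also have "\<dots> \<le> real (card S) ^ 3 * (\<rho> ^ 3 * n / 4)"
    proof (rule mult_right_mono)
      have "card Tr \<le> card (S \<times> S \<times> S)" using fin by (intro card_mono) (auto simp: Tr_def)
      also have "\<dots> = card S ^ 3" by (simp add: card_cartesian_product power3_eq_cube)
      finally show "real (card Tr) \<le> real (card S) ^ 3" by (metis of_nat_le_iff of_nat_power)
    qed (use \<rho> n in auto)
    also have "\<dots> = t ^ 3 * n / 4" by (simp add: t_def power_mult_distrib)
    finally show False using tot by simp
  qed
  then obtain q1 q2 q3 where z: "(q1, q2, q3) \<in> Tr" "\<rho> ^ 3 * n / 4 \<le> real (card {p \<in> Q'. RR p (q1, q2, q3)})"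
    by (metis surj_pair)
  have "{p \<in> Q'. RR p (q1, q2, q3)} = {p \<in> Q. R p q1 \<and> R p q2 \<and> R p q3 \<and> \<rho> * real (card S) \<le> real (card {q \<in> S. R p q})}"
    by (auto simp: Q'_def RR_def t_def x_def X_def)
  then show thesis using z that[of q1 q2 q3] by (simp add: Tr_def)
qed

section \<open>Projections and incidences\<close>

context prime_field
begin

definition inv_K :: "'a \<Rightarrow> 'a" where
  "inv_K x = (SOME y. y \<in> K \<and> x * y = e)"

lemma inv_K:
  assumes "x \<in> K" "x \<noteq> 0"
  shows "inv_K x \<in> K" "x * inv_K x = e"
proof -
  have "inv_K x \<in> K \<and> x * inv_K x = e"
    unfolding inv_K_def by (rule someI_ex) (use inverse_ex[OF assms] in blast)
  then show "inv_K x \<in> K" "x * inv_K x = e" by auto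
qed

lemma inv_K_cancel: "x \<in> K \<Longrightarrow> x \<noteq> 0 \<Longrightarrow> y \<in> K \<Longrightarrow> x * (inv_K x * y) = y"
  using inv_K mult_unit by (simp flip: mult.assoc)

lemma inv_K_nonzero: "x \<in> K \<Longrightarrow> x \<noteq> 0 \<Longrightarrow> inv_K x \<noteq> 0"
  using inv_K_cancel[of x x] by auto

lemma mult_nonzero_K: "x \<in> K \<Longrightarrow> y \<in> K \<Longrightarrow> x \<noteq> 0 \<Longrightarrow> y \<noteq> 0 \<Longrightarrow> x * y \<noteq> 0"
  using no_zero_divisors_K by blast

lemmas K_closed = diff_K add_K mult_K uminus_K inv_K(1) mult_nonzero_K inv_K_nonzero

text \<open>Three of the projections \<open>v - c u\<close> serve as \<open>\<alpha>\<close>, \<open>\<beta>\<close> and \<open>\<alpha> + \<beta>\<close>; a fourth one is then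
  \<open>\<alpha> + \<lambda> \<beta>\<close> up to scaling, where \<open>\<lambda>\<close> is the cross-ratio of the four values of \<open>c\<close>.\<close>

lemma many_small_projections:
  fixes u v :: "'p \<Rightarrow> 'a" and m M \<rho> :: real
  assumes fin: "finite T" and uv: "\<And>p. p \<in> T \<Longrightarrow> u p \<in> K" "\<And>p. p \<in> T \<Longrightarrow> v p \<in> K"
    "inj_on (\<lambda>p. (u p, v p)) T"
    and S: "S \<subseteq> K" "c1 \<in> S" "c2 \<in> S" "c3 \<in> S" "c1 \<noteq> c2" "c1 \<noteq> c3" "c2 \<noteq> c3"
    and R: "\<And>p. p \<in> T \<Longrightarrow> R p c1 \<and> R p c2 \<and> R p c3"
      "\<And>p. p \<in> T \<Longrightarrow> \<rho> * real (card S) \<le> real (card {c \<in> S. R p c})"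
    and small: "\<And>c. c \<in> S \<Longrightarrow> real (card ((\<lambda>p. v p - c * u p) ` {p \<in> T. R p c})) \<le> m"
    and pos: "0 < m" "1 \<le> M" "0 < \<rho>" "\<rho> \<le> 1" "4 \<le> \<rho> * real (card S)" "m\<^sup>2 \<le> M * real (card T)"
  shows "m \<le> 2 ^ 245 * M ^ 78 / (\<rho> / 2) ^ 22 \<or> (real (card S) / 2)\<^sup>2 \<le> 2 ^ 254 * M ^ 81 / (\<rho> / 2) ^ 26 * m
    \<or> real (card K) \<le> 2 ^ 232 * M ^ 73 / (\<rho> / 2) ^ 20 * m"
proof -
  have cK: "c1 \<in> K" "c2 \<in> K" "c3 \<in> K" using S by auto
  have finS: "finite S" using S finite_K finite_subset by blast
  \<comment> \<open>\<open>k3\<close> scales the second projection so that the sum of \<alpha> and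
    \<beta> becomes a multiple of the projection with parameter \<open>c3\<close>.\<close>
  define k3 where "k3 = (c3 - c1) * inv_K (c2 - c3)"
  have k3: "k3 \<in> K" "k3 \<noteq> 0" unfolding k3_def using cK S by (simp_all add: K_closed)
  define k where "k c = (c - c1) * inv_K (c2 - c) * inv_K k3" for c
  define \<alpha> where "\<alpha> p = v p - c1 * u p" for p
  define \<beta> where "\<beta> p = k3 * (v p - c2 * u p)" for p
  \<comment> \<open>The parameter \<open>c1\<close> would give the dilation factor 0, and
    \<open>c2\<close> the point at infinity.\<close>
  define S' where "S' = S - {c1, c2}"
  have \<alpha>\<beta>K: "\<alpha> p \<in> K" "\<beta> p \<in> K" if "p \<in> T" for p
    unfolding \<alpha>_def \<beta>_def using that uv cK k3 by (auto intro!: K_closed)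
  \<comment> \<open>Multiplied by c2 - c, this says (c2 - c)(v - c1 u) + (c - c1)(v - c2 u) = (c2 -
    c1)(v - c u).\<close>
  have lin: "v p - c1 * u p + (c - c1) * inv_K (c2 - c) * (v p - c2 * u p)
      = (c2 - c1) * inv_K (c2 - c) * (v p - c * u p)" if "p \<in> T" "c \<in> K" "c \<noteq> c2" for p c
  proof -
    define i where "i = inv_K (c2 - c)"
    have c: "c2 - c \<in> K" "c2 - c \<noteq> 0" using that cK by (auto intro!: K_closed)
    have iK: "i \<in> K" using c by (simp add: i_def inv_K)
    have ce: "(c2 - c) * i = e" using c by (simp add: i_def inv_K)
    have "v p - c1 * u p = e * (v p - c1 * u p)"
      using that uv cK by (intro mult_unit[symmetric] K_closed) auto
    also have "\<dots> = (c2 - c) * i * (v p - c1 * u p)" using ce by simp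
    finally have "v p - c1 * u p + (c - c1) * i * (v p - c2 * u p)
      = (c2 - c) * i * (v p - c1 * u p) + (c - c1) * i * (v p - c2 * u p)" by simp
    also have "\<dots> = (c2 - c1) * i * (v p - c * u p)" by (simp add: algebra_simps)
    finally show ?thesis by (simp add: i_def)
  qed
  have sum3: "\<alpha> p + \<beta> p = (c2 - c1) * inv_K (c2 - c3) * (v p - c3 * u p)" if "p \<in> T" for p
    using lin[OF that, of c3] cK S by (simp add: \<alpha>_def \<beta>_def k3_def)
  have sumk: "\<alpha> p + k c * \<beta> p = (c2 - c1) * inv_K (c2 - c) * (v p - c * u p)" if "p \<in> T" "c \<in> S'" for p c
  proof -
    have c: "c \<in> K" "c \<noteq> c2" using that S by (auto simp: S'_def)
    have "k c * \<beta> p = (c - c1) * inv_K (c2 - c) * (k3 * (inv_K k3 * (v p - c2 * u p)))"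
      by (simp add: k_def \<beta>_def algebra_simps)
    also have "k3 * (inv_K k3 * (v p - c2 * u p)) = v p - c2 * u p"
      using k3 uv that cK by (intro inv_K_cancel K_closed) auto
    finally show ?thesis using lin[OF that(1) c] by (simp add: \<alpha>_def)
  qed
  define g where "g p = (\<alpha> p, \<beta> p)" for p
  have injg: "inj_on g T"
  proof (rule inj_onI)
    fix p q assume pq: "p \<in> T" "q \<in> T" "g p = g q"
    then have a: "v p - c1 * u p = v q - c1 * u q" and b0: "k3 * (v p - c2 * u p) = k3 * (v q - c2 * u q)"
      by (auto simp: g_def \<alpha>_def \<beta>_def)
    have b: "v p - c2 * u p = v q - c2 * u q"
      by (rule mult_cancel_K[OF _ _ _ _ b0]) (simp_all add: pq uv cK k3 K_closed)
    have "(c2 - c1) * u p = (v p - c1 * u p) - (v p - c2 * u p)" by (simp add: algebra_simps)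
    also have "\<dots> = (c2 - c1) * u q" unfolding a b by (simp add: algebra_simps)
    finally have "u p = u q"
      by (rule mult_cancel_K[rotated 4]) (use S(5) in \<open>simp_all add: pq uv cK K_closed\<close>)
    moreover then have "v p = v q" using a by simp
    ultimately show "p = q" using uv(3) pq by (auto dest: inj_onD)
  qed
  have kK: "k c \<in> K" "k c \<noteq> 0" if "c \<in> S'" for c
    unfolding k_def using that S cK k3 by (auto simp: S'_def K_closed)
  have injk: "inj_on k S'"
  proof (rule inj_onI)
    fix c d assume cd: "c \<in> S'" "d \<in> S'" "k c = k d"
    have K: "c \<in> K" "d \<in> K" "c2 - c \<in> K" "c2 - c \<noteq> 0" "c2 - d \<in> K" "c2 - d \<noteq> 0"
      using cd S cK by (auto simp: S'_def intro!: K_closed)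
    have "inv_K k3 * ((c - c1) * inv_K (c2 - c)) = inv_K k3 * ((d - c1) * inv_K (c2 - d))"
      using cd by (simp add: k_def mult.commute)
    then have eq: "(c - c1) * inv_K (c2 - c) = (d - c1) * inv_K (c2 - d)"
      by (rule mult_cancel_K[rotated 4]) (simp_all add: k3 K cK K_closed del: right_minus_eq)
    have "(c2 - d) * (c - c1) = (c2 - c) * (inv_K (c2 - c) * ((c2 - d) * (c - c1)))"
      using K cK by (intro inv_K_cancel[symmetric] K_closed) auto
    also have "\<dots> = (c2 - c) * (c2 - d) * ((c - c1) * inv_K (c2 - c))" by (simp add: ac_simps)
    also have "\<dots> = (c2 - d) * (inv_K (c2 - d) * ((c2 - c) * (d - c1)))"
      unfolding eq by (simp add: ac_simps)
    also have "\<dots> = (c2 - c) * (d - c1)" using K cK by (intro inv_K_cancel K_closed) auto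
    finally have "(c2 - c1) * c = (c2 - c1) * d" by (simp add: algebra_simps)
    then show "c = d"
      by (rule mult_cancel_K[rotated 4]) (use S(5) in \<open>simp_all add: K cK K_closed\<close>)
  qed
  define \<Lambda> where "\<Lambda> = k ` S'"
  define G\<Lambda> where "G\<Lambda> l = g ` {p \<in> T. \<exists>c\<in>S'. k c = l \<and> R p c}" for l
  have G\<Lambda>k: "G\<Lambda> (k c) = g ` {p \<in> T. R p c}" if "c \<in> S'" for c
    unfolding G\<Lambda>_def using that injk by (intro arg_cong[of _ _ "image g"]) (auto dest: inj_onD)
  have cS': "real (card S') = real (card S) - 2"
  proof -
    have "card S' = card S - card {c1, c2}" unfolding S'_def using S by (intro card_Diff_subset) auto
    moreover have "card {c1, c2} = 2" using S by simp
    moreover have "card {c1, c2} \<le> card S" using S finS by (intro card_mono) auto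
    ultimately show ?thesis by simp
  qed
  have c\<Lambda>: "real (card \<Lambda>) = real (card S) - 2"
    unfolding \<Lambda>_def using card_image[OF injk] cS' by simp
  have S4: "real (card S) \<ge> 4"
  proof -
    have "\<rho> * real (card S) \<le> 1 * real (card S)" using pos by (intro mult_right_mono) auto
    then show ?thesis using pos by linarith
  qed
  have card_le: "real (card (h ` {p \<in> T. R p c})) \<le> m"
    if "c \<in> S" "\<And>p. p \<in> T \<Longrightarrow> h p = s * (v p - c * u p)" for h s c
  proof -
    have "h ` {p \<in> T. R p c} = (*) s ` (\<lambda>p. v p - c * u p) ` {p \<in> T. R p c}"
      using that(2) by (auto simp: image_image)
    then have "card (h ` {p \<in> T. R p c}) \<le> card ((\<lambda>p. v p - c * u p) ` {p \<in> T. R p c})"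
      using fin by (simp add: card_image_le)
    then show ?thesis using small[OF that(1)] by linarith
  qed
  have T: "{p \<in> T. R p c1} = T" "{p \<in> T. R p c2} = T" "{p \<in> T. R p c3} = T" using R by auto
  have "m \<le> 2 ^ 245 * M ^ 78 / (\<rho> / 2) ^ 22 \<or> (real (card \<Lambda>))\<^sup>2 \<le> 2 ^ 254 * M ^ 81 / (\<rho> / 2) ^ 26 * m
    \<or> real (card K) \<le> 2 ^ 232 * M ^ 73 / (\<rho> / 2) ^ 20 * m"
  proof (rule many_small_dilated_sums[where G = "g ` T" and G\<Lambda> = G\<Lambda>])
    show "g ` T \<subseteq> K \<times> K" using \<alpha>\<beta>K by (auto simp: g_def)
    have "fst ` g ` T = \<alpha> ` T" "snd ` g ` T = \<beta> ` T" "(\<lambda>(a, b). a + b) ` g ` T = (\<lambda>p. \<alpha> p + \<beta> p) ` T"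
      by (simp_all add: image_image g_def)
    moreover have "real (card (\<alpha> ` {p \<in> T. R p c1})) \<le> m"
    proof -
      have "\<alpha> ` {p \<in> T. R p c1} = (\<lambda>p. v p - c1 * u p) ` {p \<in> T. R p c1}" by (simp add: \<alpha>_def[abs_def])
      then show ?thesis using small[OF S(2)] by simp
    qed
    moreover have "real (card (\<beta> ` {p \<in> T. R p c2})) \<le> m"
      by (rule card_le[OF S(3)]) (simp add: \<beta>_def)
    moreover have "real (card ((\<lambda>p. \<alpha> p + \<beta> p) ` {p \<in> T. R p c3})) \<le> m"
      by (rule card_le[OF S(4)]) (simp add: sum3)
    ultimately show "real (card (fst ` g ` T)) \<le> m" "real (card (snd ` g ` T)) \<le> m"
      "real (card ((\<lambda>(a, b). a + b) ` g ` T)) \<le> m" unfolding T by simp_all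
    show "m\<^sup>2 \<le> M * real (card (g ` T))" using pos card_image[OF injg] by simp
    show "\<Lambda> \<subseteq> K" "0 \<notin> \<Lambda>" using kK by (auto simp: \<Lambda>_def)
    show "G\<Lambda> l \<subseteq> g ` T" for l by (auto simp: G\<Lambda>_def)
    show "\<rho> / 2 * real (card \<Lambda>) \<le> real (card {l \<in> \<Lambda>. z \<in> G\<Lambda> l})" if z: "z \<in> g ` T" for z
    proof -
      obtain p where p: "p \<in> T" "z = g p" using z by blast
      \<comment> \<open>Losing \<open>c1\<close> and \<open>c2\<close> costs at most 2, half of
        \<rho> |S| by assumption; hence \<rho> / 2 in place of \<rho>.\<close>
      have "{c \<in> S. R p c} \<subseteq> {c1, c2} \<union> {c \<in> S'. R p c}" by (auto simp: S'_def)
      then have "card {c \<in> S. R p c} \<le> card ({c1, c2} \<union> {c \<in> S'. R p c})"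
        using finS by (intro card_mono) (auto simp: S'_def)
      also have "\<dots> \<le> card {c1, c2} + card {c \<in> S'. R p c}" by (rule card_Un_le)
      also have "card {c1, c2} = 2" using S by simp
      also have "card {c \<in> S'. R p c} = card (k ` {c \<in> S'. R p c})"
        using injk by (intro card_image[symmetric]) (auto intro: inj_on_subset)
      also have "\<dots> \<le> card {l \<in> \<Lambda>. z \<in> G\<Lambda> l}"
      proof (rule card_mono)
        show "finite {l \<in> \<Lambda>. z \<in> G\<Lambda> l}" using finS by (simp add: \<Lambda>_def S'_def)
        show "k ` {c \<in> S'. R p c} \<subseteq> {l \<in> \<Lambda>. z \<in> G\<Lambda> l}"
          using p G\<Lambda>k by (auto simp: \<Lambda>_def)
      qed
      finally have "\<rho> * real (card S) \<le> 2 + real (card {l \<in> \<Lambda>. z \<in> G\<Lambda> l})"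
        using R(2)[OF p(1)] by linarith
      moreover have "\<rho> / 2 * real (card \<Lambda>) \<le> \<rho> / 2 * real (card S)"
        using pos c\<Lambda> by (intro mult_left_mono) auto
      ultimately show ?thesis using pos(5) by linarith
    qed
    show "real (card ((\<lambda>(a, b). a + l * b) ` G\<Lambda> l)) \<le> m" if l: "l \<in> \<Lambda>" for l
    proof -
      obtain c where c: "c \<in> S'" "l = k c" using l by (auto simp: \<Lambda>_def)
      have "(\<lambda>(a, b). a + l * b) ` G\<Lambda> l = (\<lambda>p. \<alpha> p + k c * \<beta> p) ` {p \<in> T. R p c}"
        unfolding c(2) G\<Lambda>k[OF c(1)] by (simp add: image_image g_def)
      also have "real (card \<dots>) \<le> m"
        using c by (intro card_le[of c]) (auto simp: S'_def intro!: sumk)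
      finally show ?thesis .
    qed
  qed (use pos in auto)
  moreover have "(real (card S) / 2)\<^sup>2 \<le> (real (card \<Lambda>))\<^sup>2"
    using S4 c\<Lambda> by (intro power_mono) auto
  ultimately show ?thesis by linarith
qed

section \<open>Lines over the field and projective coordinates\<close>

definition lines_K :: "('a \<times> 'a) set set" where
  "lines_K = {{(x, y). (x, y) \<in> K \<times> K \<and> a * x + b * y = c} | a b c. a \<in> K \<and> b \<in> K \<and> c \<in> K \<and> (a, b) \<noteq> (0, 0)}"

lemma finite_lines_K: "finite lines_K"
proof (rule finite_subset)
  show "lines_K \<subseteq> Pow (K \<times> K)" by (auto simp: lines_K_def)
qed (use finite_K in simp)

text \<open>Multiplying the determinant \<open>d\<close> by either coefficient of the line turns it
  into a combination of differences of the line equation, which vanish. One coefficient is nonzero,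
  so no division is involved.\<close>

lemma collinear_det:
  assumes "l \<in> lines_K" "(x0, y0) \<in> l" "(x1, y1) \<in> l" "(x2, y2) \<in> l"
  shows "(x1 - x0) * (y2 - y0) = (y1 - y0) * (x2 - x0)"
proof -
  obtain a b c where l: "a \<in> K" "b \<in> K" "(a, b) \<noteq> (0, 0)" "l = {(x, y). (x, y) \<in> K \<times> K \<and> a * x + b * y = c}"
    using assms(1) by (auto simp: lines_K_def)
  have K: "x0 \<in> K" "y0 \<in> K" "x1 \<in> K" "y1 \<in> K" "x2 \<in> K" "y2 \<in> K"
    and eqs: "a * x0 + b * y0 = c" "a * x1 + b * y1 = c" "a * x2 + b * y2 = c"
    using assms l by auto
  define d where "d = (x1 - x0) * (y2 - y0) - (y1 - y0) * (x2 - x0)"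
  have dK: "d \<in> K" using K by (auto simp: d_def intro!: K_closed)
  have "a * d = ((a * x1 + b * y1) - (a * x0 + b * y0)) * (y2 - y0) - ((a * x2 + b * y2) - (a * x0 + b * y0)) * (y1 - y0)"
    by (simp add: d_def algebra_simps)
  then have "a * d = 0" unfolding eqs by simp
  moreover have "b * d = ((a * x2 + b * y2) - (a * x0 + b * y0)) * (x1 - x0) - ((a * x1 + b * y1) - (a * x0 + b * y0)) * (x2 - x0)"
    by (simp add: d_def algebra_simps)
  then have "b * d = 0" unfolding eqs by simp
  ultimately have "d = 0" using l dK no_zero_divisors_K by blast
  then show ?thesis by (simp add: d_def)
qed

text \<open>The defect \<open>h\<close> of a third point in the equation of the other line is
  annihilated by both coordinates of the direction vector of the two common points, and one of these
  is nonzero.\<close>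

lemma line_unique:
  assumes "l \<in> lines_K" "l' \<in> lines_K" "p \<noteq> q" "p \<in> l" "q \<in> l" "p \<in> l'" "q \<in> l'"
  shows "l = l'"
proof -
  have sub: "l \<subseteq> l'" if h: "l \<in> lines_K" "l' \<in> lines_K" "p \<noteq> q" "p \<in> l" "q \<in> l" "p \<in> l'" "q \<in> l'" for l l' p q
  proof
    fix r assume r: "r \<in> l"
    obtain x0 y0 x1 y1 x2 y2 where pts: "q = (x0, y0)" "p = (x1, y1)" "r = (x2, y2)"
      by (metis surj_pair)
    obtain a b c where l': "a \<in> K" "b \<in> K" "l' = {(x, y). (x, y) \<in> K \<times> K \<and> a * x + b * y = c}"
      using h(2) by (auto simp: lines_K_def)
    have K: "x0 \<in> K" "y0 \<in> K" "x1 \<in> K" "y1 \<in> K" and eqs: "a * x0 + b * y0 = c" "a * x1 + b * y1 = c"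
      using h l' pts by auto
    have K2: "x2 \<in> K" "y2 \<in> K" using r pts h(1) by (auto simp: lines_K_def)
    have det: "(x1 - x0) * (y2 - y0) = (y1 - y0) * (x2 - x0)"
      using collinear_det[OF h(1), of x0 y0 x1 y1 x2 y2] h r pts by simp
    define h where "h = a * (x2 - x0) + b * (y2 - y0)"
    have hK: "h \<in> K" using K K2 l' by (auto simp: h_def intro!: K_closed)
    have "(x1 - x0) * h = a * (x1 - x0) * (x2 - x0) + b * ((x1 - x0) * (y2 - y0))"
      by (simp add: h_def algebra_simps)
    also have "\<dots> = ((a * x1 + b * y1) - (a * x0 + b * y0)) * (x2 - x0)"
      unfolding det by (simp add: algebra_simps)
    finally have 1: "(x1 - x0) * h = 0" unfolding eqs by simp
    have "(y1 - y0) * h = a * ((y1 - y0) * (x2 - x0)) + b * (y1 - y0) * (y2 - y0)"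
      by (simp add: h_def algebra_simps)
    also have "\<dots> = ((a * x1 + b * y1) - (a * x0 + b * y0)) * (y2 - y0)"
      unfolding det[symmetric] by (simp add: algebra_simps)
    finally have 2: "(y1 - y0) * h = 0" unfolding eqs by simp
    have "x1 - x0 \<noteq> 0 \<or> y1 - y0 \<noteq> 0" using h(3) pts by auto
    then have "h = 0" using 1 2 hK K no_zero_divisors_K[of "x1 - x0" h] no_zero_divisors_K[of "y1 - y0" h] diff_K
      by blast
    then have "a * x2 + b * y2 = c" using eqs(1) by (simp add: h_def algebra_simps)
    then show "r \<in> l'" using l' pts K2 by simp
  qed
  show ?thesis using sub[of l l' p q] sub[of l' l p q] assms by blast
qed

text \<open>A projective transformation sends \<open>l0\<close> to infinity: with affine coordinates \<open>X\<close>, \<open>Y\<close> in which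
  \<open>l0\<close> is \<open>X = 0\<close>, put \<open>u = 1 / X\<close> and \<open>v = Y / X\<close>. The lines through the point of \<open>l0\<close> with
  \<open>Y = c\<close> become those of slope \<open>c\<close>.\<close>

lemma projective_coordinates:
  assumes "l0 \<in> lines_K"
  obtains u v Y :: "'a \<times> 'a \<Rightarrow> 'a" where
    "\<And>p. p \<in> K \<times> K - l0 \<Longrightarrow> u p \<in> K" "\<And>p. p \<in> K \<times> K - l0 \<Longrightarrow> v p \<in> K"
    "inj_on (\<lambda>p. (u p, v p)) (K \<times> K - l0)" "\<And>q. q \<in> l0 \<Longrightarrow> Y q \<in> K" "inj_on Y l0"
    "\<And>l p p' q. l \<in> lines_K \<Longrightarrow> q \<in> l0 \<Longrightarrow> p \<notin> l0 \<Longrightarrow> p' \<notin> l0 \<Longrightarrow> q \<in> l \<Longrightarrow> p \<in> l \<Longrightarrow> p' \<in> l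
      \<Longrightarrow> v p - Y q * u p = v p' - Y q * u p'"
proof -
  obtain a b c where l0: "a \<in> K" "b \<in> K" "c \<in> K" "(a, b) \<noteq> (0, 0)"
    "l0 = {(x, y). (x, y) \<in> K \<times> K \<and> a * x + b * y = c}"
    using assms by (auto simp: lines_K_def)
  \<comment> \<open>The second coordinate completes (a, b) to a matrix whose determinant is
    \<open>e\<close> up to sign, so the change of coordinates is injective.\<close>
  obtain \<alpha> \<beta> where ab: "\<alpha> \<in> K" "\<beta> \<in> K" "\<alpha> * b - \<beta> * a = e"
  proof (cases "b = 0")
    case False
    then show ?thesis using that[of "inv_K b" 0] inv_K[of b] l0 zero_K by (simp add: mult.commute)
  next
    case True
    then have "a \<noteq> 0" using l0 by simp
    then show ?thesis using that[of 0 "- inv_K a"] inv_K[of a] l0 zero_K uminus_K by (simp add: mult.commute)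
  qed
  define X where "X p = a * fst p + b * snd p - c" for p
  define Y where "Y p = \<alpha> * fst p + \<beta> * snd p" for p
  define u where "u p = inv_K (X p)" for p
  define v where "v p = inv_K (X p) * Y p" for p
  have XYK: "X p \<in> K" "Y p \<in> K" if "p \<in> K \<times> K" for p
    using that l0 ab by (auto simp: X_def Y_def intro!: K_closed)
  have X0: "X p = 0 \<longleftrightarrow> p \<in> l0" if "p \<in> K \<times> K" for p
    using that l0 by (auto simp: X_def)
  have l0K: "l0 \<subseteq> K \<times> K" using l0 by auto
  have lK: "l \<subseteq> K \<times> K" if "l \<in> lines_K" for l using that by (auto simp: lines_K_def)
  have inj: "p = q" if pq: "p \<in> K \<times> K" "q \<in> K \<times> K" "X p = X q" "Y p = Y q" for p q
  proof -
    define dx where "dx = fst p - fst q"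
    define dy where "dy = snd p - snd q"
    have K: "dx \<in> K" "dy \<in> K" using pq by (auto simp: dx_def dy_def intro!: K_closed)
    have 1: "a * dx + b * dy = 0" using pq(3) by (simp add: X_def dx_def dy_def algebra_simps)
    have 2: "\<alpha> * dx + \<beta> * dy = 0" using pq(4) by (simp add: Y_def dx_def dy_def algebra_simps)
    have "dx = (\<alpha> * b - \<beta> * a) * dx" using mult_unit K ab by simp
    also have "\<dots> = b * (\<alpha> * dx + \<beta> * dy) - \<beta> * (a * dx + b * dy)" by (simp add: algebra_simps)
    finally have "dx = 0" unfolding 1 2 by simp
    have "dy = (\<alpha> * b - \<beta> * a) * dy" using mult_unit K ab by simp
    also have "\<dots> = \<alpha> * (a * dx + b * dy) - a * (\<alpha> * dx + \<beta> * dy)" by (simp add: algebra_simps)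
    finally have "dy = 0" unfolding 1 2 by simp
    show ?thesis using \<open>dx = 0\<close> \<open>dy = 0\<close> by (simp add: dx_def dy_def prod_eq_iff)
  qed
  show thesis
  proof (rule that[of u v Y])
    fix p assume p: "p \<in> K \<times> K - l0"
    then have "X p \<noteq> 0" using X0 by blast
    then show "u p \<in> K" "v p \<in> K" using p XYK by (auto simp: u_def v_def intro!: K_closed)
  next
    show "inj_on (\<lambda>p. (u p, v p)) (K \<times> K - l0)"
    proof (rule inj_onI)
      fix p q assume pq: "p \<in> K \<times> K - l0" "q \<in> K \<times> K - l0" "(u p, v p) = (u q, v q)"
      have K: "X p \<in> K" "X q \<in> K" "Y p \<in> K" "Y q \<in> K" "X p \<noteq> 0" "X q \<noteq> 0"
        using pq XYK X0 by blast+
      have i: "inv_K (X p) \<in> K" "inv_K (X p) \<noteq> 0" using K by (simp_all add: K_closed)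
      have ii: "inv_K (X p) = inv_K (X q)" using pq by (simp add: u_def)
      then have "inv_K (X p) * X p = inv_K (X p) * X q" using inv_K(2)[OF K(1,5)] inv_K(2)[OF K(2,6)]
        by (simp add: mult.commute)
      then have "X p = X q" using mult_cancel_K i K by blast
      moreover have "inv_K (X p) * Y p = inv_K (X p) * Y q" using pq ii by (simp add: v_def)
      then have "Y p = Y q" using mult_cancel_K i K by blast
      ultimately show "p = q" using inj pq by blast
    qed
  next
    show "Y q \<in> K" if "q \<in> l0" for q using that l0K XYK by blast
    show "inj_on Y l0"
    proof (rule inj_onI)
      fix p q assume "p \<in> l0" "q \<in> l0" "Y p = Y q"
      then show "p = q" using inj[of p q] X0[of p] X0[of q] l0K by force
    qed
  next
    fix l p p' q
    assume l: "l \<in> lines_K" "q \<in> l0" "p \<notin> l0" "p' \<notin> l0" "q \<in> l" "p \<in> l" "p' \<in> l"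
    have pK: "p \<in> K \<times> K" "p' \<in> K \<times> K" "q \<in> K \<times> K" using l lK by blast+
    have K: "X p \<in> K" "X p' \<in> K" "Y p \<in> K" "Y p' \<in> K" "Y q \<in> K" "X p \<noteq> 0" "X p' \<noteq> 0" and Xq: "X q = 0"
      using pK XYK X0 l by blast+
    obtain x0 y0 x1 y1 x2 y2 where pts: "q = (x0, y0)" "p = (x1, y1)" "p' = (x2, y2)"
      by (metis surj_pair)
    have det: "(x1 - x0) * (y2 - y0) = (y1 - y0) * (x2 - x0)"
      using collinear_det[OF l(1)] l pts by blast
    \<comment> \<open>Collinearity survives the affine change of coordinates. As X q = 0, dividing
      by X p and X p' compares the slopes (Y p - Y q) / X p, which are v p - Y q * u p.\<close>
    have "(Y p - Y q) * (X p' - X q) - (Y p' - Y q) * (X p - X q)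
      = (\<alpha> * b - \<beta> * a) * ((x1 - x0) * (y2 - y0) - (y1 - y0) * (x2 - x0))"
      by (simp add: X_def Y_def pts algebra_simps)
    then have eq: "(Y p - Y q) * X p' = (Y p' - Y q) * X p" using det Xq by simp
    have "X p * X p' * ((Y p - Y q) * inv_K (X p)) = X p * (inv_K (X p) * ((Y p - Y q) * X p'))"
      by (simp add: ac_simps)
    also have "\<dots> = (Y p - Y q) * X p'" using K by (intro inv_K_cancel K_closed)
    also have "\<dots> = (Y p' - Y q) * X p" by (rule eq)
    also have "\<dots> = X p' * (inv_K (X p') * ((Y p' - Y q) * X p))"
      using K by (intro inv_K_cancel[symmetric] K_closed)
    also have "\<dots> = X p * X p' * ((Y p' - Y q) * inv_K (X p'))" by (simp add: ac_simps)
    finally have "(Y p - Y q) * inv_K (X p) = (Y p' - Y q) * inv_K (X p')"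
      by (rule mult_cancel_K[rotated 4]) (simp_all add: K K_closed)
    then show "v p - Y q * u p = v p' - Y q * u p'"
      by (simp add: u_def v_def algebra_simps)
  qed
qed

end

text \<open>Rewrites the bounds in \<kappa> alone, using 2 / \<rho> <= 2^8 \<kappa>^2. The variable
  \<open>b\<close> stands for 2 and keeps powers such as \<open>b ^ 2332\<close>
  unevaluated.\<close>

lemma power_estimate:
  fixes b \<kappa> \<rho> M :: real
  assumes "b = 2" "M = b ^ 23 * \<kappa> ^ 4" "1 \<le> \<kappa>" "0 < \<rho>" "1 \<le> \<rho> * (128 * \<kappa>\<^sup>2)"
  shows "2 ^ i * M ^ j / (\<rho> / 2) ^ k \<le> b ^ (i + 23 * j + 8 * k) * \<kappa> ^ (4 * j + 2 * k)"
proof -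
  have "2 / \<rho> \<le> b ^ 8 * \<kappa>\<^sup>2" using assms by (simp add: field_simps)
  then have "(2 / \<rho>) ^ k \<le> (b ^ 8 * \<kappa>\<^sup>2) ^ k" using assms by (intro power_mono) auto
  then have "b ^ i * M ^ j * (2 / \<rho>) ^ k \<le> b ^ i * M ^ j * (b ^ 8 * \<kappa>\<^sup>2) ^ k"
    using assms by (intro mult_left_mono) auto
  also have "\<dots> = b ^ (i + 23 * j + 8 * k) * \<kappa> ^ (4 * j + 2 * k)"
    unfolding assms(2) power_mult_distrib power_mult[symmetric] power_add by (simp only: ac_simps)
  finally show ?thesis using assms(1) by (simp add: power_divide)
qed

context prime_field
begin

text \<open>The case of points of comparable degree. The constants come from the alternative that
  bounds |S|^2: it gives 2^2325 \<kappa>^376 times 2D, and passing from |S| and \<open>D\<close> to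
  n = \<open>sqrt N\<close> costs another 2^7 \<kappa>^2. The other two alternatives give smaller
  powers.\<close>

lemma regular_incidence_bound:
  fixes N D \<kappa> :: real
  assumes P: "P \<subseteq> K \<times> K" "real (card P) \<le> N" and L: "L \<subseteq> lines_K" "real (card L) \<le> N"
    and N: "0 < N" "N \<le> real (card K)" and D: "0 < D"
    and deg: "\<And>q. q \<in> P \<Longrightarrow> D \<le> real (card {l \<in> L. q \<in> l})"
      "\<And>q. q \<in> P \<Longrightarrow> real (card {l \<in> L. q \<in> l}) \<le> 2 * D"
    and \<kappa>: "1 \<le> \<kappa>" "N * sqrt N \<le> \<kappa> * (\<Sum>q\<in>P. real (card {l \<in> L. q \<in> l}))"
  shows "sqrt N \<le> 2 ^ 2332 * \<kappa> ^ 378"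
proof (rule ccontr)
  define b :: real where "b = 2"
  define n where "n = sqrt N"
  define I where "I = (\<Sum>q\<in>P. real (card {l \<in> L. q \<in> l}))"
  assume "\<not> ?thesis"
  then have big: "b ^ 2332 * \<kappa> ^ 378 < n" by (simp only: b_def n_def not_le)
  have small: "b ^ i * \<kappa> ^ j < n" if "i \<le> 2332" "j \<le> 378" for i j
  proof -
    have "b ^ i * \<kappa> ^ j \<le> b ^ 2332 * \<kappa> ^ 378"
      using that \<kappa> by (intro mult_mono power_increasing) (auto simp: b_def)
    then show ?thesis using big by linarith
  qed
  have n: "n > 0" "n\<^sup>2 = N" using N by (simp_all add: n_def)
  have big3: "1024 * \<kappa> ^ 3 < n" using small[of 10 3] by (simp add: b_def)
  have \<kappa>3: "\<kappa> \<le> \<kappa> ^ 3" using \<kappa>(1) by (simp add: self_le_power)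
  have finP: "finite P" using P finite_K by (meson finite_SigmaI finite_subset)
  have finL: "finite L" by (rule finite_subset[OF L(1) finite_lines_K])
  have NI: "N * n \<le> \<kappa> * I" using \<kappa>(2) by (simp add: n_def I_def)
  have I0: "I > 0"
  proof (rule ccontr)
    assume "\<not> I > 0"
    then have "\<kappa> * I \<le> 0" using \<kappa>(1) by (simp add: mult_nonneg_nonpos)
    moreover have "N * n > 0" using N n by simp
    ultimately show False using NI by linarith
  qed
  have IP: "I \<le> 2 * D * real (card P)" "real (card P) * D \<le> I"
  proof -
    have "I \<le> (\<Sum>q\<in>P. 2 * D)" unfolding I_def using deg by (intro sum_mono)
    then show "I \<le> 2 * D * real (card P)" by (simp add: algebra_simps)
    have "(\<Sum>q\<in>P. D) \<le> I" unfolding I_def using deg by (intro sum_mono)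
    then show "real (card P) * D \<le> I" by simp
  qed
  have "\<kappa> * I \<le> \<kappa> * (2 * D * real (card P))" using IP(1) \<kappa>(1) by (intro mult_left_mono) auto
  then have "N * n \<le> \<kappa> * (2 * D * real (card P))" using NI by linarith
  also have "\<dots> \<le> \<kappa> * (2 * D * N)" using P D \<kappa> by (intro mult_left_mono) auto
  finally have "N * n \<le> N * (2 * \<kappa> * D)" by (simp add: algebra_simps)
  then have nD: "n \<le> 2 * \<kappa> * D" using N(1) by (simp only: mult_le_cancel_left_pos)
  have D2: "2 \<le> D"
  proof -
    have "\<kappa> * 4 \<le> 1024 * \<kappa> ^ 3" using \<kappa>3 \<kappa>(1) by linarith
    then have "\<kappa> * 4 \<le> \<kappa> * (2 * D)" using big3 nD by (simp add: algebra_simps)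
    then show ?thesis using \<kappa>(1) by simp
  qed
  have Dsq: "N \<le> (2 * \<kappa> * D)\<^sup>2" unfolding n(2)[symmetric] using nD n by (intro power_mono) auto
  \<comment> \<open>Both terms on the left are at most half of n D / (16 \<kappa>), because n
    exceeds a multiple of \<kappa>^3 and \<open>D\<close> is at least n / (2 \<kappa>).\<close>
  have cond: "2 * N / D + 2 * D \<le> I * D / (16 * N)"
  proof -
    have "n * D / (16 * \<kappa>) \<le> I * D / (16 * N)"
    proof -
      have "n / \<kappa> \<le> I / N" using NI N \<kappa> by (simp add: field_simps)
      then have "n / \<kappa> * (D / 16) \<le> I / N * (D / 16)" using D by (intro mult_right_mono) auto
      then show ?thesis by (simp add: field_simps)
    qed
    moreover have "2 * D \<le> n * D / (32 * \<kappa>)"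
    proof -
      have "64 * \<kappa> * D \<le> n * D" using big3 \<kappa>3 \<kappa>(1) D by (intro mult_right_mono) auto
      then show ?thesis using \<kappa> by (simp add: field_simps)
    qed
    moreover have "2 * N / D \<le> n * D / (32 * \<kappa>)"
    proof -
      have "\<kappa> ^ 3 \<ge> 0" using \<kappa>(1) by simp
      then have "256 * \<kappa> ^ 3 * N \<le> n * N" using big3 N by (intro mult_right_mono) linarith+
      also have "\<dots> \<le> n * (2 * \<kappa> * D)\<^sup>2" using Dsq n by (intro mult_left_mono) auto
      finally have "(4 * \<kappa>\<^sup>2) * (64 * \<kappa> * N) \<le> (4 * \<kappa>\<^sup>2) * (n * D\<^sup>2)"
        by (simp add: power2_eq_square power3_eq_cube algebra_simps)
      then have "64 * \<kappa> * N \<le> n * D\<^sup>2" 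
      proof (rule mult_left_le_imp_le)
        show "0 < 4 * \<kappa>\<^sup>2" using \<kappa>(1) by simp
      qed
      then show ?thesis using \<kappa> D by (simp add: field_simps power2_eq_square)
    qed
    moreover have "n * D / (32 * \<kappa>) + n * D / (32 * \<kappa>) = n * D / (16 * \<kappa>)" by simp
    ultimately show ?thesis by linarith
  qed
  obtain l0 where l0: "l0 \<in> L" "I \<le> 2 * N * real (card (l0 \<inter> P))"
    "I * D / (16 * N) * real (card (l0 \<inter> P))
       \<le> (\<Sum>p\<in>P - l0. real (card {q \<in> l0 \<inter> P. \<exists>l\<in>L. q \<in> l \<and> p \<in> l}))"
  proof (rule rich_line_ex[OF finP finL _ L(2) deg I_def I0 D2 cond])
    show "l = l'" if "x \<noteq> y" "l \<in> L" "l' \<in> L" "x \<in> l" "y \<in> l" "x \<in> l'" "y \<in> l'" for x y l l'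
      using line_unique[of l l' x y] that L by blast
  qed
  define S where "S = l0 \<inter> P"
  define s where "s = real (card S)"
  define R where "R p q \<longleftrightarrow> (\<exists>l\<in>L. q \<in> l \<and> p \<in> l)" for p q
  \<comment> \<open>Chosen so that |P| D <= I gives 2 \<rho> s |P| <= I D s / (16 N), the bound
    supplied by the rich line.\<close>
  define \<rho> where "\<rho> = D\<^sup>2 / (32 * N)"
  have finS: "finite S" using finP by (simp add: S_def)
  have \<rho>0: "\<rho> > 0" using D N by (simp add: \<rho>_def)
  have ns: "n \<le> 2 * \<kappa> * s"
  proof -
    have "\<kappa> * I \<le> \<kappa> * (2 * N * s)"
      using l0(2) \<kappa>(1) unfolding s_def S_def by (intro mult_left_mono) auto
    then have "N * n \<le> \<kappa> * (2 * N * s)" using NI by linarith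
    then have "N * n \<le> N * (2 * \<kappa> * s)" by (simp add: algebra_simps)
    then show ?thesis using N(1) by (simp only: mult_le_cancel_left_pos)
  qed
  have s0: "s > 0"
  proof (rule ccontr)
    assume "\<not> s > 0"
    then have "s = 0" by (simp add: s_def)
    then show False using ns n by simp
  qed
  have \<rho>1: "1 \<le> \<rho> * (128 * \<kappa>\<^sup>2)"
    using Dsq N by (simp add: \<rho>_def field_simps power2_eq_square)
  have \<rho>s: "4 \<le> \<rho> * s"
  proof -
    have "1024 * \<kappa> ^ 3 \<le> 1 * (2 * \<kappa> * s)" using big3 ns by linarith
    also have "\<dots> \<le> \<rho> * (128 * \<kappa>\<^sup>2) * (2 * \<kappa> * s)"
      using \<rho>1 \<kappa> s0 by (intro mult_right_mono) auto
    finally have "\<kappa> ^ 3 * 1024 \<le> \<kappa> ^ 3 * (256 * (\<rho> * s))"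
      by (simp add: power2_eq_square power3_eq_cube algebra_simps)
    then have "1024 \<le> 256 * (\<rho> * s)" 
      by (rule mult_left_le_imp_le) (use \<kappa>(1) in simp)
    then show ?thesis by simp
  qed
  have P0: "0 < real (card P)"
  proof (rule ccontr)
    assume "\<not> 0 < real (card P)"
    then have "card P = 0" by simp
    then show False using IP(1) I0 by simp
  qed
  have sum: "2 * \<rho> * s * real (card P) \<le> (\<Sum>p\<in>P - l0. real (card {q \<in> S. R p q}))"
  proof -
    have "2 * \<rho> * s * real (card P) = (real (card P) * D) * (D * s / (16 * N))"
      by (simp add: \<rho>_def power2_eq_square)
    also have "\<dots> \<le> I * (D * s / (16 * N))" using IP(2) D s0 N by (intro mult_right_mono) auto
    also have "\<dots> \<le> (\<Sum>p\<in>P - l0. real (card {q \<in> S. R p q}))"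
      using l0(3) by (simp add: S_def s_def R_def)
    finally show ?thesis .
  qed
  \<comment> \<open>A point of \<open>P\<close> is joined to at most s points of \<open>S\<close>.
    This trivial bound also yields D <= 4n.\<close>
  have \<rho>2: "2 * \<rho> \<le> 1"
  proof -
    have "(\<Sum>p\<in>P - l0. real (card {q \<in> S. R p q})) \<le> (\<Sum>p\<in>P - l0. s)"
      unfolding s_def using finS by (intro sum_mono of_nat_mono card_mono) auto
    also have "\<dots> = real (card (P - l0)) * s" by simp
    also have "\<dots> \<le> real (card P) * s" using finP s0 by (intro mult_right_mono of_nat_mono card_mono) auto
    finally have "(s * real (card P)) * (2 * \<rho>) \<le> (s * real (card P)) * 1"
      using sum by (simp add: algebra_simps)
    then show ?thesis using s0 P0 by (simp only: mult_le_cancel_left_pos mult_pos_pos)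
  qed
  have Dn: "D \<le> 4 * n"
  proof -
    have "D\<^sup>2 \<le> (4 * n)\<^sup>2" using \<rho>2 N n by (simp add: \<rho>_def field_simps power_mult_distrib)
    then show ?thesis by (rule power2_le_imp_le) (use n in simp)
  qed
  have cPl: "real (card (P - l0)) \<le> real (card P)" using finP by (intro of_nat_mono card_mono) auto
  obtain q1 q2 q3 where q: "q1 \<in> S" "q2 \<in> S" "q3 \<in> S" "q1 \<noteq> q2" "q1 \<noteq> q3" "q2 \<noteq> q3"
    and T: "\<rho> ^ 3 * real (card P) / 4 \<le> real (card {p \<in> P - l0. R p q1 \<and> R p q2 \<and> R p q3 \<and> \<rho> * real (card S) \<le> real (card {q \<in> S. R p q})})"
    by (rule popular_triple_ex[OF finS _ cPl P0 \<rho>0 \<rho>s[unfolded s_def] sum[unfolded s_def]])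
      (use finP in simp, rule that)
  define T where "T = {p \<in> P - l0. R p q1 \<and> R p q2 \<and> R p q3 \<and> \<rho> * s \<le> real (card {q \<in> S. R p q})}"
  have finT: "finite T" and cT: "\<rho> ^ 3 * real (card P) / 4 \<le> real (card T)"
    using finP T by (auto simp: T_def s_def)
  have TK: "T \<subseteq> K \<times> K - l0" using P by (auto simp: T_def)
  have l0K: "l0 \<in> lines_K" using l0 L by blast
  obtain u v Y :: "'a \<times> 'a \<Rightarrow> 'a" where
    uv: "\<And>p. p \<in> K \<times> K - l0 \<Longrightarrow> u p \<in> K" "\<And>p. p \<in> K \<times> K - l0 \<Longrightarrow> v p \<in> K"
    "inj_on (\<lambda>p. (u p, v p)) (K \<times> K - l0)" and Y: "\<And>q. q \<in> l0 \<Longrightarrow> Y q \<in> K" "inj_on Y l0"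
    and col: "\<And>l p p' q. l \<in> lines_K \<Longrightarrow> q \<in> l0 \<Longrightarrow> p \<notin> l0 \<Longrightarrow> p' \<notin> l0 \<Longrightarrow> q \<in> l \<Longrightarrow> p \<in> l \<Longrightarrow> p' \<in> l
      \<Longrightarrow> v p - Y q * u p = v p' - Y q * u p'"
    by (rule projective_coordinates[OF l0K]) (rule that)
  have injY: "inj_on Y S" using Y(2) by (rule inj_on_subset) (auto simp: S_def)
  define R' where "R' p c \<longleftrightarrow> (\<exists>q\<in>S. Y q = c \<and> R p q)" for p c
  have R'Y: "R' p (Y q) \<longleftrightarrow> R p q" if "q \<in> S" for p q
    using that injY by (auto simp: R'_def dest: inj_onD)
  have cR': "card {c \<in> Y ` S. R' p c} = card {q \<in> S. R p q}" for p
  proof -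
    have "{c \<in> Y ` S. R' p c} = Y ` {q \<in> S. R' p (Y q)}" by auto
    also have "{q \<in> S. R' p (Y q)} = {q \<in> S. R p q}" by (rule Collect_cong) (metis R'Y)
    finally have "{c \<in> Y ` S. R' p c} = Y ` {q \<in> S. R p q}" .
    then show ?thesis using injY by (simp add: card_image inj_on_subset)
  qed
  have cYS: "real (card (Y ` S)) = s" using injY by (simp add: card_image s_def)
  \<comment> \<open>The density condition asks for 4 D^2 <= M \<rho>^3 |P| / 4. Combining n <= 2
    \<kappa> D, cubed, with n^3 <= 2 \<kappa> D |P| gives N^3 <= (2 \<kappa> D)^4 |P|; since
    \<rho>^3 = D^6 / (2^15 N^3), the factor is 2^(4 + 2 + 2 + 15) \<kappa>^4.\<close>
  define M where "M = b ^ 23 * \<kappa> ^ 4"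
  have "2 * D \<le> 2 ^ 245 * M ^ 78 / (\<rho> / 2) ^ 22 \<or> (s / 2)\<^sup>2 \<le> 2 ^ 254 * M ^ 81 / (\<rho> / 2) ^ 26 * (2 * D)
    \<or> real (card K) \<le> 2 ^ 232 * M ^ 73 / (\<rho> / 2) ^ 20 * (2 * D)"
    unfolding cYS[symmetric]
  proof (rule many_small_projections[OF finT])
    show "u p \<in> K" "v p \<in> K" if "p \<in> T" for p using uv TK that by blast+
    show "inj_on (\<lambda>p. (u p, v p)) T" using uv(3) TK by (rule inj_on_subset)
    show "Y ` S \<subseteq> K" using Y(1) by (auto simp: S_def)
    show "Y q1 \<in> Y ` S" "Y q2 \<in> Y ` S" "Y q3 \<in> Y ` S" using q by auto
    show "Y q1 \<noteq> Y q2" "Y q1 \<noteq> Y q3" "Y q2 \<noteq> Y q3" using q injY by (auto dest: inj_onD)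
    show "R' p (Y q1) \<and> R' p (Y q2) \<and> R' p (Y q3)" if "p \<in> T" for p
      using that R'Y q by (auto simp: T_def)
    show "\<rho> * real (card (Y ` S)) \<le> real (card {c \<in> Y ` S. R' p c})" if "p \<in> T" for p
      using that unfolding cYS cR' by (simp add: T_def)
    show "4 \<le> \<rho> * real (card (Y ` S))" unfolding cYS by (rule \<rho>s)
    show "real (card ((\<lambda>p. v p - c * u p) ` {p \<in> T. R' p c})) \<le> 2 * D" if c: "c \<in> Y ` S" for c
    proof -
      obtain q where q: "q \<in> S" "c = Y q" using c by blast
      \<comment> \<open>By \<open>col\<close> the projection of p with parameter Y q depends only on
        the line joining p to q, and q lies on at most 2D lines of \<open>L\<close>.\<close>
      define val where "val l = (let p = SOME p. p \<in> T \<and> p \<in> l in v p - c * u p)" for l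
      have "(\<lambda>p. v p - c * u p) ` {p \<in> T. R' p c} \<subseteq> val ` {l \<in> L. q \<in> l}"
      proof (rule image_subsetI)
        fix p assume p: "p \<in> {p \<in> T. R' p c}"
        then have "R p q" using R'Y q by auto
        then obtain l where l: "l \<in> L" "q \<in> l" "p \<in> l" by (auto simp: R_def)
        define p' where "p' = (SOME p. p \<in> T \<and> p \<in> l)"
        have p': "p' \<in> T \<and> p' \<in> l" unfolding p'_def by (rule someI[of _ p]) (use p l in auto)
        have "v p - c * u p = v p' - c * u p'"
          unfolding q(2) using p p' l L q TK by (intro col[of l q p p']) (auto simp: S_def)
        then have "v p - c * u p = val l" by (simp add: val_def p'_def Let_def)
        then show "v p - c * u p \<in> val ` {l \<in> L. q \<in> l}" using l by blast
      qed
      then have "card ((\<lambda>p. v p - c * u p) ` {p \<in> T. R' p c}) \<le> card (val ` {l \<in> L. q \<in> l})"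
        using finL by (intro card_mono) auto
      also have "\<dots> \<le> card {l \<in> L. q \<in> l}" using finL by (intro card_image_le) auto
      also have "real \<dots> \<le> 2 * D" using deg(2) q by (simp add: S_def)
      finally show ?thesis by simp
    qed
    show "(2 * D)\<^sup>2 \<le> M * real (card T)"
    proof -
      have "N * n \<le> \<kappa> * (2 * D * real (card P))" by fact
      then have 1: "n ^ 3 \<le> 2 * \<kappa> * D * real (card P)"
        unfolding n(2)[symmetric] by (simp add: power2_eq_square power3_eq_cube algebra_simps)
      have "n ^ 3 \<le> (2 * \<kappa> * D) ^ 3" using nD n by (intro power_mono) auto
      then have "n ^ 3 * n ^ 3 \<le> (2 * \<kappa> * D) ^ 3 * (2 * \<kappa> * D * real (card P))"
        using 1 n \<kappa> D by (intro mult_mono) auto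
      then have "N ^ 3 * (4 * D\<^sup>2) \<le> (2 * \<kappa> * D) ^ 3 * (2 * \<kappa> * D * real (card P)) * (4 * D\<^sup>2)"
        unfolding n(2)[symmetric] by (intro mult_right_mono) (auto simp: power_mult[symmetric] simp flip: power_add)
      also have "\<dots> = N ^ 3 * (M * (\<rho> ^ 3 * real (card P) / 4))"
        using N by (simp add: M_def b_def \<rho>_def power_divide power_mult_distrib power2_eq_square power3_eq_cube power4_eq_xxxx)
      finally have "4 * D\<^sup>2 \<le> M * (\<rho> ^ 3 * real (card P) / 4)"
        using N(1) by (simp only: mult_le_cancel_left_pos zero_less_power)
      also have "\<dots> \<le> M * real (card T)" using cT \<kappa>(1) by (intro mult_left_mono) (auto simp: M_def b_def)
      finally show ?thesis by (simp add: power_mult_distrib)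
    qed
    show "1 \<le> M" using \<kappa>(1) mult_mono[of 1 "b ^ 23" 1 "\<kappa> ^ 4"] by (simp add: M_def b_def)
  qed (use D \<rho>0 \<rho>2 in auto)
  note cases = this
  have est: "2 ^ i * M ^ j / (\<rho> / 2) ^ k \<le> b ^ (i + 23 * j + 8 * k) * \<kappa> ^ (4 * j + 2 * k)" for i j k
    by (rule power_estimate[OF b_def M_def \<kappa>(1) \<rho>0 \<rho>1])
  from cases consider
    "2 * D \<le> b ^ 2215 * \<kappa> ^ 356" | "(s / 2)\<^sup>2 \<le> b ^ 2325 * \<kappa> ^ 376 * (2 * D)"
    | "real (card K) \<le> b ^ 2071 * \<kappa> ^ 332 * (2 * D)"
  proof (elim disjE)
    assume "2 * D \<le> 2 ^ 245 * M ^ 78 / (\<rho> / 2) ^ 22"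
    also have "\<dots> \<le> b ^ (245 + 23 * 78 + 8 * 22) * \<kappa> ^ (4 * 78 + 2 * 22)" by (rule est)
    finally show thesis using that(1) by simp
  next
    assume "(s / 2)\<^sup>2 \<le> 2 ^ 254 * M ^ 81 / (\<rho> / 2) ^ 26 * (2 * D)"
    also have "\<dots> \<le> b ^ (254 + 23 * 81 + 8 * 26) * \<kappa> ^ (4 * 81 + 2 * 26) * (2 * D)"
      using D by (intro mult_right_mono est) auto
    finally show thesis using that(2) by simp
  next
    assume "real (card K) \<le> 2 ^ 232 * M ^ 73 / (\<rho> / 2) ^ 20 * (2 * D)"
    also have "\<dots> \<le> b ^ (232 + 23 * 73 + 8 * 20) * \<kappa> ^ (4 * 73 + 2 * 20) * (2 * D)"
      using D by (intro mult_right_mono est) auto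
    finally show thesis using that(3) by simp
  qed
  then show False
  proof cases
    case 1
    have "n \<le> \<kappa> * (2 * D)" using nD by (simp add: algebra_simps)
    also have "\<dots> \<le> \<kappa> * (b ^ 2215 * \<kappa> ^ 356)" using 1 \<kappa>(1) by (intro mult_left_mono) auto
    also have "\<dots> = b ^ 2215 * \<kappa> ^ 357" using power_add[of \<kappa> 356 1] by simp
    finally show False using small[of 2215 357] by simp
  next
    case 2
    have "n * n \<le> (2 * \<kappa> * s) * (2 * \<kappa> * s)" using ns n by (intro mult_mono) auto
    also have "\<dots> = 16 * \<kappa>\<^sup>2 * (s / 2)\<^sup>2" by (simp add: power2_eq_square)
    also have "\<dots> \<le> 16 * \<kappa>\<^sup>2 * (b ^ 2325 * \<kappa> ^ 376 * (2 * D))" using 2 by (intro mult_left_mono) auto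
    also have "\<dots> \<le> 16 * \<kappa>\<^sup>2 * (b ^ 2325 * \<kappa> ^ 376 * (2 * (4 * n)))"
      using Dn \<kappa>(1) by (intro mult_left_mono) (auto simp: b_def)
    also have "\<dots> = (b ^ 7 * b ^ 2325) * (\<kappa>\<^sup>2 * \<kappa> ^ 376) * n" by (simp add: b_def[THEN arg_cong, of "\<lambda>x. x ^ 7"])
    also have "\<dots> = b ^ 2332 * \<kappa> ^ 378 * n" by (simp flip: power_add)
    finally have "n \<le> b ^ 2332 * \<kappa> ^ 378" using n(1) by (simp only: mult_le_cancel_right_pos)
    then show False using big by simp
  next
    case 3
    \<comment> \<open>Here the field has at least N = n^2 elements, while D <= 4n.\<close>
    have "n * n \<le> b ^ 2071 * \<kappa> ^ 332 * (2 * D)" using 3 N n by (simp add: power2_eq_square)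
    also have "\<dots> \<le> b ^ 2071 * \<kappa> ^ 332 * (2 * (4 * n))"
      using Dn \<kappa>(1) by (intro mult_left_mono) (auto simp: b_def)
    also have "\<dots> = (b ^ 3 * b ^ 2071) * \<kappa> ^ 332 * n" by (simp add: b_def[THEN arg_cong, of "\<lambda>x. x ^ 3"])
    also have "\<dots> = b ^ 2074 * \<kappa> ^ 332 * n" by (simp flip: power_add)
    finally have "n \<le> b ^ 2074 * \<kappa> ^ 332" using n(1) by (simp only: mult_le_cancel_right_pos)
    then show False using small[of 2074 332] by simp
  qed
qed

end

context prime_field
begin

text \<open>Dyadic pigeonholing of the degrees: one of at most 1 + log N classes carries a
  proportional share of the incidences, and the loss is absorbed into \<kappa>.\<close>

lemma incidence_bound:
  fixes N :: nat and \<kappa> :: real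
  assumes P: "P \<subseteq> K \<times> K" "card P \<le> N" and L: "L \<subseteq> lines_K" "card L \<le> N"
    and N: "0 < N" "N \<le> card K"
    and \<kappa>: "1 \<le> \<kappa>" "real N * sqrt N \<le> \<kappa> * (\<Sum>q\<in>P. real (card {l \<in> L. q \<in> l}))"
  shows "sqrt N \<le> 2 ^ 2332 * (\<kappa> * (1 + log 2 N)) ^ 378"
proof -
  have finP: "finite P" using P finite_K by (meson finite_SigmaI finite_subset)
  have finL: "finite L" by (rule finite_subset[OF L(1) finite_lines_K])
  define dg where "dg q = card {l \<in> L. q \<in> l}" for q
  define J where "J = nat \<lfloor>log 2 N\<rfloor>"
  define C where "C j = {q \<in> P. 2 ^ j \<le> dg q \<and> dg q < 2 ^ (j + 1)}" for j :: nat
  define I where "I X = (\<Sum>q\<in>X. real (dg q))" for X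
  have log0: "0 \<le> log 2 N" using N by simp
  have J: "real J \<le> log 2 N" using log0 by (simp add: J_def)
  \<comment> \<open>Points of degree 0 belong to no class and contribute nothing; a degree is at
    most |L| <= N, which bounds j by \<open>J\<close>.\<close>
  have cls: "\<exists>j\<le>J. q \<in> C j" if q: "q \<in> P" "dg q \<noteq> 0" for q
  proof -
    obtain j where j: "2 ^ j \<le> dg q" "dg q < 2 ^ (j + 1)" using ex_power_ivl1[of 2 "dg q"] q by auto
    have "dg q \<le> card L" unfolding dg_def using finL by (intro card_mono) auto
    then have "2 ^ j \<le> N" using j L by linarith
    then have "real (2 ^ j) \<le> real N" by (rule of_nat_mono)
    then have "real j \<le> log 2 N" using N by (simp add: le_log_iff powr_realpow)
    then have "j \<le> J" by (simp add: J_def le_nat_floor)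
    then show ?thesis using j q by (auto simp: C_def)
  qed
  have "I P \<le> (\<Sum>q\<in>P. \<Sum>j\<le>J. if q \<in> C j then real (dg q) else 0)"
    unfolding I_def
  proof (rule sum_mono)
    fix q assume q: "q \<in> P"
    show "real (dg q) \<le> (\<Sum>j\<le>J. if q \<in> C j then real (dg q) else 0)"
    proof (cases "dg q = 0")
      case True
      then show ?thesis by (simp add: sum_nonneg)
    next
      case False
      then obtain j where j: "j \<le> J" "q \<in> C j" using cls q by blast
      then have "(if q \<in> C j then real (dg q) else 0) \<le> (\<Sum>j\<le>J. if q \<in> C j then real (dg q) else 0)"
        by (intro member_le_sum) auto
      then show ?thesis using j by simp
    qed
  qed
  also have "\<dots> = (\<Sum>j\<le>J. \<Sum>q\<in>P. if q \<in> C j then real (dg q) else 0)" by (rule sum.swap)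
  also have "\<dots> = (\<Sum>j\<le>J. I (C j))"
  proof (rule sum.cong[OF refl])
    fix j
    have "{q \<in> P. q \<in> C j} = C j" by (auto simp: C_def)
    then show "(\<Sum>q\<in>P. if q \<in> C j then real (dg q) else 0) = I (C j)"
      using finP by (simp add: sum.inter_filter[symmetric] I_def)
  qed
  finally have sumI: "I P \<le> (\<Sum>j\<le>J. I (C j))" .
  have "\<exists>j\<le>J. I P \<le> (1 + real J) * I (C j)"
  proof (rule ccontr)
    assume "\<not> ?thesis"
    then have "I (C j) < I P / (1 + real J)" if "j \<le> J" for j using that by (force simp: field_simps)
    then have "(\<Sum>j\<le>J. I (C j)) < (\<Sum>j\<le>J. I P / (1 + real J))" by (intro sum_strict_mono) auto
    then show False using sumI by simp
  qed
  then obtain j where j: "I P \<le> (1 + real J) * I (C j)" by blast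
  have "sqrt N \<le> 2 ^ 2332 * (\<kappa> * (1 + real J)) ^ 378"
  proof (rule regular_incidence_bound[where P = "C j" and L = L and D = "2 ^ j"])
    have "card (C j) \<le> card P" using finP by (intro card_mono) (auto simp: C_def)
    then show "real (card (C j)) \<le> real N" using P by linarith
    show "C j \<subseteq> K \<times> K" using P by (auto simp: C_def)
    show "2 ^ j \<le> real (card {l \<in> L. q \<in> l})" "real (card {l \<in> L. q \<in> l}) \<le> 2 * 2 ^ j" if "q \<in> C j" for q
    proof -
      have "2 ^ j \<le> dg q" "dg q < 2 ^ (j + 1)" using that by (auto simp: C_def)
      then have "real (2 ^ j) \<le> real (dg q)" "real (dg q) \<le> real (2 ^ (j + 1))" by (simp_all only: of_nat_le_iff less_imp_le)
      then show "2 ^ j \<le> real (card {l \<in> L. q \<in> l})" "real (card {l \<in> L. q \<in> l}) \<le> 2 * 2 ^ j" by (simp_all add: dg_def)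
    qed
    show "1 \<le> \<kappa> * (1 + real J)" using \<kappa>(1) mult_mono[of 1 \<kappa> 1 "1 + real J"] by simp
    have "real N * sqrt N \<le> \<kappa> * I P" using \<kappa>(2) by (simp add: I_def dg_def)
    also have "\<dots> \<le> \<kappa> * ((1 + real J) * I (C j))" using j \<kappa>(1) by (intro mult_left_mono) auto
    finally show "real N * sqrt (real N) \<le> \<kappa> * (1 + real J) * (\<Sum>q\<in>C j. real (card {l \<in> L. q \<in> l}))"
      by (simp add: I_def dg_def mult.assoc)
  qed (use N L in auto)
  also have "\<dots> \<le> 2 ^ 2332 * (\<kappa> * (1 + log 2 N)) ^ 378"
    using J \<kappa>(1) by (intro mult_left_mono power_mono) auto
  finally show ?thesis .
qed

end

section \<open>The prime fields as subsets of one ring\<close>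

text \<open>The prime \<open>p\<close> is a variable, so there is no type for the field with \<open>p\<close> elements. Instead, it
  appears as a factor of the product of all the rings of integers modulo \<open>n\<close>.\<close>

typedef residue_seq = "{f :: nat \<Rightarrow> int. \<forall>n. f n mod int n = f n}"
  by (rule exI[of _ "\<lambda>_. 0"]) simp

setup_lifting type_definition_residue_seq

instantiation residue_seq :: comm_ring
begin

lift_definition zero_residue_seq :: residue_seq is "\<lambda>_. 0" by simp
lift_definition plus_residue_seq :: "residue_seq \<Rightarrow> residue_seq \<Rightarrow> residue_seq"
  is "\<lambda>f g n. (f n + g n) mod int n" by simp
lift_definition minus_residue_seq :: "residue_seq \<Rightarrow> residue_seq \<Rightarrow> residue_seq"
  is "\<lambda>f g n. (f n - g n) mod int n" by simp
lift_definition uminus_residue_seq :: "residue_seq \<Rightarrow> residue_seq"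
  is "\<lambda>f n. (- f n) mod int n" by simp
lift_definition times_residue_seq :: "residue_seq \<Rightarrow> residue_seq \<Rightarrow> residue_seq"
  is "\<lambda>f g n. (f n * g n) mod int n" by simp

instance
  by standard (transfer; force simp: mod_simps algebra_simps)+

end

text \<open>Reduction modulo p placed in the coordinate p. It preserves sums and products, but 1
  goes to the idempotent supported at p, which serves as the unit \<open>e\<close> of the
  image.\<close>

lift_definition residue_embed :: "nat \<Rightarrow> int \<Rightarrow> residue_seq"
  is "\<lambda>p x n. if n = p then x mod int p else 0" by simp

lemma residue_embed_add: "residue_embed p (x + y) = residue_embed p x + residue_embed p y"
  by transfer (auto simp: mod_simps)

lemma residue_embed_mult: "residue_embed p (x * y) = residue_embed p x * residue_embed p y"
  by transfer (auto simp: mod_simps)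

lemma residue_embed_uminus: "residue_embed p (- x) = - residue_embed p x"
  by transfer (auto simp: mod_simps)

lemma residue_embed_0: "residue_embed p 0 = 0"
  by transfer auto

lemma residue_embed_eq_iff: "residue_embed p x = residue_embed p y \<longleftrightarrow> [x = y] (mod int p)"
  by transfer (auto simp: fun_eq_iff unique_euclidean_semiring_class.cong_def)

lemma residue_embed_mod: "residue_embed p (x mod int p) = residue_embed p x"
  by (simp add: residue_embed_eq_iff unique_euclidean_semiring_class.cong_def)

lemma range_residue_embed:
  assumes "p > 0"
  shows "range (residue_embed p) = residue_embed p ` {0..int p - 1}"
proof -
  have "residue_embed p x \<in> residue_embed p ` {0..int p - 1}" for x
    using assms by (intro image_eqI[of _ _ "x mod int p"]) (auto simp: residue_embed_mod)
  then show ?thesis by blast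
qed

lemma inj_on_residue_embed: "inj_on (residue_embed p) {0..int p - 1}"
  by (rule inj_onI) (auto simp: residue_embed_eq_iff unique_euclidean_semiring_class.cong_def)

lemma prime_field_residue_embed:
  assumes p: "prime p"
  shows "prime_field (range (residue_embed p)) (residue_embed p 1)"
proof
  have p0: "p > 0" using p by (simp add: prime_gt_0_nat)
  show "finite (range (residue_embed p))" using range_residue_embed[OF p0] by simp
  show "0 \<in> range (residue_embed p)" using residue_embed_0 by (metis rangeI)
  fix x y assume xy: "x \<in> range (residue_embed p)" "y \<in> range (residue_embed p)"
  then obtain i j where ij: "x = residue_embed p i" "y = residue_embed p j" by blast
  show "x + y \<in> range (residue_embed p)" "x * y \<in> range (residue_embed p)"
    unfolding ij by (metis rangeI residue_embed_add residue_embed_mult)+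
  show "x = 0 \<or> y = 0" if "x * y = 0"
  proof -
    have "[i * j = 0] (mod int p)"
      using that unfolding ij by (metis residue_embed_mult residue_embed_0 residue_embed_eq_iff)
    then have "int p dvd i * j" by (simp add: cong_0_iff)
    then have "int p dvd i \<or> int p dvd j" using p by (simp add: prime_dvd_mult_iff)
    then show ?thesis unfolding ij by (metis cong_0_iff residue_embed_0 residue_embed_eq_iff)
  qed
next
  fix x assume "x \<in> range (residue_embed p)"
  then obtain i where i: "x = residue_embed p i" by blast
  show "- x \<in> range (residue_embed p)" unfolding i by (metis rangeI residue_embed_uminus)
  show "residue_embed p 1 * x = x" unfolding i by (metis residue_embed_mult mult_1)
  show "\<exists>y\<in>range (residue_embed p). x * y = residue_embed p 1" if "x \<noteq> 0"
  proof -
    have "\<not> int p dvd i" using that unfolding i by (metis cong_0_iff residue_embed_0 residue_embed_eq_iff)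
    then have "coprime i (int p)" using p by (metis coprime_commute prime_imp_coprime prime_int_nat_transfer nat_int of_nat_0_le_iff prime_nat_int_transfer)
    then obtain j where "[i * j = 1] (mod int p)" using cong_solve_coprime_int by blast
    then have "x * residue_embed p j = residue_embed p 1"
      unfolding i by (metis residue_embed_mult residue_embed_eq_iff)
    then show ?thesis by blast
  qed
next
  show "residue_embed p 1 \<in> range (residue_embed p)" by simp
next
  fix S assume S: "S \<subseteq> range (residue_embed p)" "S \<noteq> {}"
    and step: "\<And>s. s \<in> S \<Longrightarrow> s + residue_embed p 1 \<in> S"
  have p0: "p > 0" using p by (simp add: prime_gt_0_nat)
  obtain i where i: "residue_embed p i \<in> S" using S by blast
  have steps: "residue_embed p (i + int k) \<in> S" for k
  proof (induction k)
    case (Suc k)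
    have "residue_embed p (i + int (Suc k)) = residue_embed p (i + int k) + residue_embed p 1"
      by (simp flip: residue_embed_add add: ac_simps)
    then show ?case using step[OF Suc] by simp
  qed (use i in simp)
  have "residue_embed p j \<in> S" for j
  proof -
    \<comment> \<open>The number of unit steps from i to j is the least nonnegative residue of j -
      i.\<close>
    have "residue_embed p j = residue_embed p (i + int (nat ((j - i) mod int p)))"
      using p0 by (simp add: residue_embed_eq_iff unique_euclidean_semiring_class.cong_def mod_simps)
    then show ?thesis using steps by metis
  qed
  then show "S = range (residue_embed p)" using S by blast
qed

text \<open>The gap between 1/806 and 1/756 = 1/(2 * 378) absorbs the logarithm and the constant;
  the exponent 7 suffices because 2332 <= 7 * 378.\<close>

lemma eventually_power_dominates:
  "eventually (\<lambda>x::real. 2 ^ 7 * (x powr (1 / 806) * (1 + log 2 x)) < x powr (1 / 756)) at_top"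
  by real_asymp

section \<open>Transfer to residue rings and the asymptotic bound\<close>

lemma incidences_eq_sum:
  assumes "finite P" "finite L"
  shows "incidences P L = (\<Sum>q\<in>P. card {l \<in> L. q \<in> l})"
proof -
  have "{(q, l). q \<in> P \<and> l \<in> L \<and> q \<in> l} = Sigma P (\<lambda>q. {l \<in> L. q \<in> l})" by auto
  then show ?thesis using assms by (simp add: incidences_def)
qed

text \<open>Embedding both coordinates is injective on the plane and maps lines onto lines, so it
  preserves both cardinalities and the degree of every point.\<close>

lemma incidence_bound_residue_ring:
  fixes p N :: nat and \<kappa> :: real
  assumes p: "prime p" "0 < N" "N \<le> p"
    and P: "P \<subseteq> affine_plane (residue_ring (int p))" "card P \<le> N"
    and L: "L \<subseteq> affine_lines (residue_ring (int p))" "card L \<le> N"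
    and \<kappa>: "1 \<le> \<kappa>" "real N * sqrt N \<le> \<kappa> * real (incidences P L)"
  shows "sqrt N \<le> 2 ^ 2332 * (\<kappa> * (1 + log 2 N)) ^ 378"
proof -
  define E where "E = residue_embed p"
  have p0: "p > 0" using p by linarith
  interpret F: prime_field "range E" "E 1" unfolding E_def by (rule prime_field_residue_embed[OF p(1)])
  define Q where "Q = {0..int p - 1}"
  define \<phi> where "\<phi> = map_prod E E"
  have plane: "affine_plane (residue_ring (int p)) = Q \<times> Q"
    by (simp add: affine_plane_def residue_ring_def Q_def)
  have injE: "inj_on E Q" unfolding E_def Q_def by (rule inj_on_residue_embed)
  have rangeE: "range E = E ` Q" unfolding E_def Q_def by (rule range_residue_embed[OF p0])
  have inj\<phi>: "inj_on \<phi> (Q \<times> Q)" unfolding \<phi>_def by (rule map_prod_inj_on[OF injE injE])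
  have finQ: "finite Q" by (simp add: Q_def)
  have lsub: "l \<subseteq> Q \<times> Q" if "l \<in> affine_lines (residue_ring (int p))" for l
    using that by (auto simp: affine_lines_def plane)
  \<comment> \<open>In \<open>residue_ring\<close> every product and every sum is reduced
    separately; the embedding ignores these reductions.\<close>
  have Esum: "E ((a * x mod int p + b * y mod int p) mod int p) = E a * E x + E b * E y" for a b x y
    by (simp add: E_def residue_embed_mod residue_embed_add residue_embed_mult)
  have line: "\<phi> ` l \<in> F.lines_K" if l: "l \<in> affine_lines (residue_ring (int p))" for l
  proof -
    obtain a b c where abc: "a \<in> Q" "b \<in> Q" "c \<in> Q" "(a, b) \<noteq> (0, 0)"
      and leq: "l = {(x, y). (x, y) \<in> Q \<times> Q \<and> (a * x mod int p + b * y mod int p) mod int p = c}"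
      using l unfolding affine_lines_def plane by (auto simp: residue_ring_def Q_def)
    have modQ: "(a * x mod int p + b * y mod int p) mod int p \<in> Q" for x y using p0 by (simp add: Q_def)
    have eq_iff: "E a * E x + E b * E y = E c \<longleftrightarrow> (a * x mod int p + b * y mod int p) mod int p = c" for x y
      unfolding Esum[symmetric] using inj_on_eq_iff[OF injE modQ abc(3)] by simp
    have "\<phi> ` l = {(X, Y). (X, Y) \<in> range E \<times> range E \<and> E a * X + E b * Y = E c}"
    proof (intro equalityI subsetI)
      fix z assume "z \<in> \<phi> ` l"
      then obtain x y where "(x, y) \<in> l" "z = (E x, E y)" by (auto simp: \<phi>_def)
      then show "z \<in> {(X, Y). (X, Y) \<in> range E \<times> range E \<and> E a * X + E b * Y = E c}"
        by (auto simp: leq eq_iff)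
    next
      fix z assume "z \<in> {(X, Y). (X, Y) \<in> range E \<times> range E \<and> E a * X + E b * Y = E c}"
      then obtain X Y where z: "z = (X, Y)" "X \<in> E ` Q" "Y \<in> E ` Q" "E a * X + E b * Y = E c"
        by (auto simp flip: rangeE)
      then obtain x y where xy: "X = E x" "Y = E y" "x \<in> Q" "y \<in> Q" by blast
      then have "(x, y) \<in> l" using z(4) by (simp add: leq eq_iff)
      moreover have "z = \<phi> (x, y)" using z(1) xy by (simp add: \<phi>_def)
      ultimately show "z \<in> \<phi> ` l" by blast
    qed
    moreover have "(E a, E b) \<noteq> (0, 0)"
    proof -
      have "0 \<in> Q" "E 0 = 0" using p0 by (auto simp: Q_def E_def residue_embed_0)
      then show ?thesis using abc inj_onD[OF injE] by (metis prod.inject)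
    qed
    ultimately show ?thesis unfolding F.lines_K_def by blast
  qed
  have finP: "finite P" using P finQ plane by (metis finite_SigmaI finite_subset)
  have finL: "finite L"
  proof (rule finite_subset)
    show "L \<subseteq> Pow (Q \<times> Q)" using L lsub by blast
  qed (use finQ in simp)
  have injL: "inj_on (image \<phi>) L"
  proof (rule inj_onI)
    fix l l' assume "l \<in> L" "l' \<in> L" "\<phi> ` l = \<phi> ` l'"
    then show "l = l'" using inj_on_image_eq_iff[OF inj\<phi>] lsub L by blast
  qed
  have PQ: "P \<subseteq> Q \<times> Q" using P plane by simp
  have injP: "inj_on \<phi> P" using inj\<phi> PQ by (rule inj_on_subset)
  have deg: "card {l \<in> image \<phi> ` L. \<phi> q \<in> l} = card {l \<in> L. q \<in> l}" if "q \<in> P" for q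
  proof -
    have "\<phi> q \<in> \<phi> ` l \<longleftrightarrow> q \<in> l" if "l \<in> L" for l
      using that \<open>q \<in> P\<close> PQ lsub L by (intro inj_on_image_mem_iff[OF inj\<phi>]) auto
    then have "{l \<in> image \<phi> ` L. \<phi> q \<in> l} = image \<phi> ` {l \<in> L. q \<in> l}" by auto
    then show ?thesis using injL by (simp add: card_image inj_on_subset)
  qed
  have "real (incidences P L) = (\<Sum>q\<in>P. real (card {l \<in> image \<phi> ` L. \<phi> q \<in> l}))"
    using incidences_eq_sum[OF finP finL] deg by simp
  also have "\<dots> = (\<Sum>q\<in>\<phi> ` P. real (card {l \<in> image \<phi> ` L. q \<in> l}))"
    using injP by (simp add: sum.reindex)
  finally have I: "real (incidences P L) = (\<Sum>q\<in>\<phi> ` P. real (card {l \<in> image \<phi> ` L. q \<in> l}))" .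
  show ?thesis
  proof (rule F.incidence_bound[where P = "\<phi> ` P" and L = "image \<phi> ` L"])
    show "\<phi> ` P \<subseteq> range E \<times> range E" by (auto simp: \<phi>_def)
    show "card (\<phi> ` P) \<le> N" using P card_image_le[OF finP] by (meson order_trans)
    show "image \<phi> ` L \<subseteq> F.lines_K" using L line by blast
    show "card (image \<phi> ` L) \<le> N" using L card_image_le[OF finL] by (meson order_trans)
    have "card (range E) = p" unfolding rangeE using card_image[OF injE] by (simp add: Q_def)
    then show "N \<le> card (range E)" using p by simp
  qed (use p \<kappa> I in auto)
qed

theorem theorem3:
  fixes \<delta> :: real
  assumes "\<delta> > 0"
  shows "\<exists>C::real. \<forall>(p::nat) (N::nat) (P::(int \<times> int) set) (L::(int \<times> int) set set).
    prime p \<and> 0 < N \<and> N < p \<and>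
    P \<subseteq> affine_plane (residue_ring (int p)) \<and>
    L \<subseteq> affine_lines (residue_ring (int p)) \<and>
    card P \<le> N \<and> card L \<le> N
    \<longrightarrow> real (incidences P L) \<le> C * real N powr (3/2 - 1/806 + \<delta>)"
proof -
  obtain x0 :: real where x0: "\<And>x. x \<ge> x0 \<Longrightarrow> 2 ^ 7 * (x powr (1 / 806) * (1 + log 2 x)) < x powr (1 / 756)"
    using eventually_power_dominates unfolding eventually_at_top_linorder by blast
  show ?thesis
  \<comment> \<open>The summand \<open>x0\<^sup>2\<close> covers N < x0 through the trivial bound by
    N^2; the summand 1 covers all larger N.\<close>
  proof (intro exI[of _ "1 + x0\<^sup>2"] allI impI, elim conjE)
    fix p N :: nat and P :: "(int \<times> int) set" and L :: "(int \<times> int) set set"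
    assume p: "prime p" "0 < N" "N < p"
      and P: "P \<subseteq> affine_plane (residue_ring (int p))" "card P \<le> N"
      and L: "L \<subseteq> affine_lines (residue_ring (int p))" "card L \<le> N"
    have "finite P"
      by (rule finite_subset[OF P(1)]) (simp add: affine_plane_def residue_ring_def)
    have "affine_lines (residue_ring (int p)) \<subseteq> Pow (affine_plane (residue_ring (int p)))"
      by (auto simp: affine_lines_def)
    then have "finite L"
      by (rule finite_subset[OF order_trans[OF L(1)]]) (simp add: affine_plane_def residue_ring_def)
    have "incidences P L \<le> card (P \<times> L)"
      unfolding incidences_def using \<open>finite P\<close> \<open>finite L\<close> by (intro card_mono) auto
    also have "\<dots> \<le> N * N" using P L by (simp add: card_cartesian_product mult_mono)
    finally have triv: "real (incidences P L) \<le> (real N)\<^sup>2"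
      by (metis of_nat_le_iff of_nat_mult power2_eq_square)
    have N1: "1 \<le> real N" using p by linarith
    have exp1: "1 \<le> real N powr (3/2 - 1/806 + \<delta>)" using N1 assms by (intro ge_one_powr_ge_zero) auto
    show "real (incidences P L) \<le> (1 + x0\<^sup>2) * real N powr (3/2 - 1/806 + \<delta>)"
    proof (cases "real N < x0")
      case True
      have "(real N)\<^sup>2 \<le> x0\<^sup>2" using True by (intro power_mono) auto
      then have "real (incidences P L) \<le> x0\<^sup>2" using triv by linarith
      also have "\<dots> \<le> (1 + x0\<^sup>2) * 1" by simp
      also have "\<dots> \<le> (1 + x0\<^sup>2) * real N powr (3/2 - 1/806 + \<delta>)"
        using exp1 by (intro mult_left_mono) auto
      finally show ?thesis .
    next
      case False
      have "real (incidences P L) \<le> real N powr (3/2 - 1/806)"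
      proof (rule ccontr)
        assume "\<not> ?thesis"
        then have big: "real N powr (3/2 - 1/806) \<le> real (incidences P L)" by simp
        \<comment> \<open>The shortfall from N^(3/2) that the negated claim permits.\<close>
        define \<kappa> where "\<kappa> = real N powr (1 / 806)"
        have \<kappa>1: "1 \<le> \<kappa>" unfolding \<kappa>_def using N1 by (intro ge_one_powr_ge_zero) auto
        have "real N * sqrt N = real N powr (1 / 806) * real N powr (3/2 - 1/806)"
          using N1 by (simp add: powr_half_sqrt[symmetric] powr_mult_base flip: powr_add)
        also have "\<dots> \<le> \<kappa> * real (incidences P L)"
          unfolding \<kappa>_def using big by (intro mult_left_mono) auto
        finally have "sqrt N \<le> 2 ^ 2332 * (\<kappa> * (1 + log 2 N)) ^ 378"
          using p P L \<kappa>1 by (intro incidence_bound_residue_ring) auto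
        also have "\<dots> \<le> 2 ^ (7 * 378) * (\<kappa> * (1 + log 2 N)) ^ 378"
          using \<kappa>1 N1 by (intro mult_right_mono power_increasing zero_le_power mult_nonneg_nonneg add_nonneg_nonneg) auto
        also have "\<dots> = (2 ^ 7 * (\<kappa> * (1 + log 2 N))) ^ 378"
          unfolding power_mult power_mult_distrib ..
        also have "\<dots> < (real N powr (1 / 756)) ^ 378"
          unfolding \<kappa>_def using x0[of "real N"] False N1
          by (intro power_strict_mono mult_nonneg_nonneg add_nonneg_nonneg) auto
        also have "\<dots> = sqrt N" using N1 by (simp add: powr_half_sqrt[symmetric] powr_powr flip: powr_realpow)
        finally show False by simp
      qed
      also have "\<dots> \<le> real N powr (3/2 - 1/806 + \<delta>)" using N1 assms by (intro powr_mono) auto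
      also have "\<dots> \<le> (1 + x0\<^sup>2) * real N powr (3/2 - 1/806 + \<delta>)"
        using mult_right_mono[of 1 "1 + x0\<^sup>2" "real N powr (3/2 - 1/806 + \<delta>)"] by simp
      finally show ?thesis .
    qed
  qed
qed

end
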